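(* Let $p>0$ and let $u:\mathbb{R}^4\to\mathbb{R}$ be a solution to $\Delta^2 u=(1-|x|^p)e^{4u}$ in $\mathbb{R}^4$ such that $(1-|y|^p)e^{4u}\in L^1(\mathbb{R}^4)$, and set $\Lambda:=\int_{\mathbb{R}^4}(1-|x|^p)e^{4u}\,dx$. Define $$v(x):=\frac{1}{8\pi^2}\int_{\mathbb{R}^4}\log\left(\frac{|y|}{|x-y|}\right)(1-|y|^p)e^{4u(y)}\,dy.$$ Then there exists a polynomial $P$ of degree at most $2$ which is bounded from above on $\mathbb{R}^4$ such that $u=v+P$. Moreover, $$u(x)=-\frac{\Lambda}{8\pi^2}\log|x|+P(x)+o(\log|x|),\quad\text{as } |x|\to\infty.$$ *)

theory Defs
  imports "HOL-Analysis.Analysis" "HOL-Library.Landau_Symbols"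
begin

definition pd :: "4 \<Rightarrow> (real^4 \<Rightarrow> real) \<Rightarrow> real^4 \<Rightarrow> real" where
  "pd i f x = deriv (\<lambda>t. f (x + t *\<^sub>R axis i 1)) 0"

fun Ck :: "nat \<Rightarrow> (real^4 \<Rightarrow> real) \<Rightarrow> bool" where
  "Ck 0 f = continuous_on UNIV f"
| "Ck (Suc k) f = (continuous_on UNIV f \<and>
     (\<forall>i. (\<forall>x. (\<lambda>t. f (x + t *\<^sub>R axis i 1)) differentiable (at 0)) \<and> Ck k (pd i f)))"

definition laplacian :: "(real^4 \<Rightarrow> real) \<Rightarrow> real^4 \<Rightarrow> real" where
  "laplacian f x = (\<Sum>i\<in>UNIV. pd i (pd i f) x)"

definition poly_deg_le2 :: "(real^4 \<Rightarrow> real) \<Rightarrow> bool" where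
  "poly_deg_le2 P \<longleftrightarrow> (\<exists>(A::real^4^4) (b::real^4) (c::real).
      \<forall>x. P x = x \<bullet> (A *v x) + b \<bullet> x + c)"

end

theory Submission
  imports Defs
begin

text \<open>
  Write \<open>f = (1 - |x|^p) e^(4u)\<close>. Testing \<open>f\<close> against the compactly supported radial weights
  \<open>(1 - |y - x|^2/\<rho>)_+^k\<close> and integrating by parts shows that the normalised weighted means of \<open>u\<close>
  about \<open>x\<close>, as functions of \<open>\<rho>\<close>, satisfy a second order ODE whose right-hand side is a weighted mean
  of \<open>f\<close>. Integrating it yields the exact formula
  \<open>u x = B x \<rho> + 1/(16 \<pi>^2) \<integral> g(|y - x|^2/\<rho>) f(y) dy\<close>, where \<open>B x \<rho>\<close> is the average of \<open>u\<close> against an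
  explicit kernel supported in the ball of radius \<open>sqrt \<rho>\<close> about \<open>x\<close>, and \<open>g(t) = - ln t\<close> plus a
  polynomial, cut off at \<open>t = 1\<close>.

  As \<open>\<rho> \<rightarrow> \<infinity>\<close>, the difference of the potential terms at \<open>x\<close> and at \<open>0\<close> tends to \<open>v x\<close>. The same
  ODE bounds the means of \<open>u\<close> about \<open>0\<close> below by \<open>- C \<rho>\<close>; as \<open>u \<le> e^(4u)\<close> and \<open>e^(4u)\<close> is integrable,
  \<open>|u|\<close> has means of order at most \<open>\<rho>\<close>, so the cubic Taylor remainder of the kernel contributes only
  \<open>O(\<rho>^(-1/2))\<close> and \<open>B x \<rho> - B 0 \<rho>\<close> converges to a polynomial of degree at most 2 in \<open>x\<close>.

  Since unit-scale means of \<open>u\<close> are bounded above, \<open>P\<close> grows at most logarithmically, and a quadratic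
  polynomial with this property is bounded above. Finally, \<open>f \<le> 0\<close> outside the unit ball gives
  \<open>v \<le> C ln |x|\<close>, hence polynomial growth of \<open>f\<close>, which makes the contribution of the logarithmic
  singularity to \<open>v\<close> of order \<open>o(ln |x|)\<close>.
\<close>

section \<open>Differentiation under the integral and integration by parts\<close>

text \<open>Ball weights replace spherical means, so that only Lebesgue measure occurs and every
  identity comes from integration by parts along the axes. The model is Pizzetti's formula: for a
  biharmonic function the mean at scale \<rho> is affine in \<rho>, so
  \<open>avg - \<rho> * davg\<close> returns the value at the centre. With a source \<open>f\<close>
  the defect is a cut-off fundamental solution; 1/(16 pi^2) is half of 1/(8 pi^2) because the
  logarithm is taken of the squared distance. Each step of the ODE raises the exponent of the weight
  by one, giving 5, 6, 7. The start is 5 because the kernel of \<open>bavg\<close> then has lowest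
  power 4, the least power of a positive part that is three times differentiable everywhere, as the
  cubic Taylor remainder demands. The obstacle is circularity: nothing is known about
  \<open>f\<close> near a distant point, since a bound for \<open>u\<close> there needs
  \<open>v\<close>, which depends on \<open>f\<close> there. For the polynomial this is avoided by
  trading the potential at \<open>x\<close> for the one at 0; for \<open>v\<close>, by the sign of
  \<open>f\<close>.\<close>

lemma has_real_derivative_integral:
  fixes F :: "real \<Rightarrow> 'a \<Rightarrow> real"
  assumes e: "e > 0"
    and int: "\<And>t. \<bar>t - t0\<bar> < e \<Longrightarrow> integrable M (F t)"
    and der: "AE y in M. ((\<lambda>t. F t y) has_real_derivative F' y) (at t0)"
    and lip: "\<And>t y. \<bar>t - t0\<bar> < e \<Longrightarrow> \<bar>F t y - F t0 y\<bar> \<le> G y * \<bar>t - t0\<bar>"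
    and G: "integrable M G" and F': "F' \<in> borel_measurable M"
  shows "integrable M F'" and "((\<lambda>t. \<integral>y. F t y \<partial>M) has_real_derivative (\<integral>y. F' y \<partial>M)) (at t0)"
proof -
  \<comment> \<open>Dominated convergence works along sequences, so everything is first proved for
    sequences that avoid \<open>t0\<close> and stay within distance \<open>e\<close>. A general
    sequence enters this range after finitely many terms. The sequence \<open>X0\<close> below is
    one admissible choice and yields the integrability of \<open>F'\<close>.\<close>
  have key: "integrable M F' \<and> (\<lambda>n. ((\<integral>y. F (X n) y \<partial>M) - (\<integral>y. F t0 y \<partial>M)) / (X n - t0)) \<longlonglongrightarrow> (\<integral>y. F' y \<partial>M)"
    if X: "\<And>n. X n \<noteq> t0" "X \<longlonglongrightarrow> t0" "\<And>n. \<bar>X n - t0\<bar> < e" for X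
  proof -
    define Q where "Q n y = (F (X n) y - F t0 y) / (X n - t0)" for n y
    have Qm: "Q n \<in> borel_measurable M" for n
      unfolding Q_def using int[OF X(3)[of n]] int[of t0] e
      by (auto intro!: borel_measurable_divide borel_measurable_diff)
    have Qlim: "AE y in M. (\<lambda>n. Q n y) \<longlonglongrightarrow> F' y"
      using der
    proof eventually_elim
      case (elim y)
      then have "((\<lambda>t. (F t y - F t0 y) / (t - t0)) \<longlongrightarrow> F' y) (at t0)"
        by (simp add: has_field_derivative_iff)
      then show ?case
        unfolding Q_def tendsto_at_iff_sequentially comp_def using X by auto
    qed
    have Qb: "AE y in M. norm (Q n y) \<le> G y" for n
      using lip[OF X(3)[of n]] X(1)[of n] by (auto simp: Q_def abs_divide divide_simps)
    have 1: "integrable M F'"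
      by (rule integrable_dominated_convergence[OF F' Qm G Qlim Qb])
    have 2: "(\<lambda>n. integral\<^sup>L M (Q n)) \<longlonglongrightarrow> integral\<^sup>L M F'"
      by (rule integral_dominated_convergence[OF F' Qm G Qlim Qb])
    have "integral\<^sup>L M (Q n) = ((\<integral>y. F (X n) y \<partial>M) - (\<integral>y. F t0 y \<partial>M)) / (X n - t0)" for n
      unfolding Q_def using int[OF X(3)[of n]] int[of t0] e by simp
    with 1 2 show ?thesis by simp
  qed
  define X0 where "X0 n = t0 + e / 2 * inverse (real (Suc n))" for n
  have "X0 \<longlonglongrightarrow> t0 + e / 2 * 0" unfolding X0_def
    by (intro tendsto_add tendsto_mult tendsto_const LIMSEQ_inverse_real_of_nat)
  then show "integrable M F'"
  proof -
    assume "X0 \<longlonglongrightarrow> t0 + e / 2 * 0"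
    moreover have "\<bar>X0 n - t0\<bar> < e" "X0 n \<noteq> t0" for n
      using e by (auto simp: X0_def abs_mult field_simps intro: add_pos_nonneg)
    ultimately show ?thesis using key[of X0] by auto
  qed
  show "((\<lambda>t. \<integral>y. F t y \<partial>M) has_real_derivative (\<integral>y. F' y \<partial>M)) (at t0)"
    unfolding has_field_derivative_iff tendsto_at_iff_sequentially comp_def
  proof (intro allI impI)
    fix X :: "nat \<Rightarrow> real" assume X: "\<forall>i. X i \<in> UNIV - {t0}" "X \<longlonglongrightarrow> t0"
    have "eventually (\<lambda>n. \<bar>X n - t0\<bar> < e) sequentially"
      using tendstoD[OF X(2) e] by (simp add: dist_real_def)
    then obtain N where N: "\<And>n. n \<ge> N \<Longrightarrow> \<bar>X n - t0\<bar> < e"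
      by (auto simp: eventually_sequentially)
    have "(\<lambda>n. X (n + N)) \<longlonglongrightarrow> t0" using X(2) by (rule LIMSEQ_ignore_initial_segment)
    then have "(\<lambda>n. ((\<integral>y. F (X (n + N)) y \<partial>M) - (\<integral>y. F t0 y \<partial>M)) / (X (n + N) - t0)) \<longlonglongrightarrow> (\<integral>y. F' y \<partial>M)"
      using key[of "\<lambda>n. X (n + N)"] X N by auto
    then show "(\<lambda>n. ((\<integral>y. F (X n) y \<partial>M) - (\<integral>y. F t0 y \<partial>M)) / (X n - t0)) \<longlonglongrightarrow> (\<integral>y. F' y \<partial>M)"
      by (rule LIMSEQ_offset)
  qed
qed

lemma integrable_indicator_cball:
  "integrable lborel (indicator (cball c r) :: 'a::euclidean_space \<Rightarrow> real)"
  by (intro integrable_real_indicator emeasure_bounded_finite) auto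

lemma integrable_continuous_compact_support:
  fixes g :: "'a::euclidean_space \<Rightarrow> real"
  assumes "continuous_on UNIV g" "\<And>y. norm (y - c) > r \<Longrightarrow> g y = 0"
  shows "integrable lborel g"
proof -
  have "integrable lborel (\<lambda>x. indicator (cball c r) x *\<^sub>R g x)"
    by (intro borel_integrable_compact) (auto intro: continuous_on_subset assms(1))
  also have "(\<lambda>x. indicator (cball c r) x *\<^sub>R g x) = g"
    using assms(2) by (auto simp: fun_eq_iff indicator_def dist_norm norm_minus_commute)
  finally show ?thesis .
qed

lemma continuous_bounded_on_cball:
  fixes g :: "'a::euclidean_space \<Rightarrow> real"
  assumes "continuous_on UNIV g"
  obtains B where "B > 0" "\<And>y. norm (y - c) \<le> r \<Longrightarrow> \<bar>g y\<bar> \<le> B"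
proof -
  have "compact (g ` cball c r)"
    by (intro compact_continuous_image continuous_on_subset[OF assms]) auto
  then obtain B where "B > 0" "\<And>z. z \<in> g ` cball c r \<Longrightarrow> norm z \<le> B"
    using compact_imp_bounded bounded_pos by metis
  then show ?thesis using that[of B] by (auto simp: dist_norm norm_minus_commute)
qed

lemma integral_lborel_translation:
  fixes g :: "'a::euclidean_space \<Rightarrow> real"
  assumes "g \<in> borel_measurable borel"
  shows "(\<integral>y. g (y + c) \<partial>lborel) = (\<integral>y. g y \<partial>lborel)"
  by (subst (2) lborel_distr_plus[of c, symmetric], subst integral_distr)
     (use assms in \<open>auto simp: add.commute[of c]\<close>)

text \<open>Translation invariance: the integral of \<open>g (y + t e)\<close> does not depend on
  \<open>t\<close>, so its derivative, the integral of \<open>g'\<close>, vanishes. This bypasses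
  Fubini and asks only for a derivative in the direction \<open>e\<close>, the form in which
  \<open>Ck\<close> supplies derivatives.\<close>

lemma integral_directional_derivative_eq_0:
  fixes g :: "'a::euclidean_space \<Rightarrow> real"
  assumes g: "continuous_on UNIV g" and g': "continuous_on UNIV g'"
    and der: "\<And>y. ((\<lambda>t. g (y + t *\<^sub>R e)) has_real_derivative g' y) (at 0)"
    and supp: "\<And>y. norm (y - c) > r \<Longrightarrow> g y = 0" and e: "norm e = 1"
  shows "integrable lborel g'" "(\<integral>y. g' y \<partial>lborel) = 0"
proof -
  have der': "((\<lambda>t. g (y + t *\<^sub>R e)) has_real_derivative g' (y + s *\<^sub>R e)) (at s)" for y s
  proof -
    have "((\<lambda>t. g ((y + s *\<^sub>R e) + t *\<^sub>R e)) has_real_derivative g' (y + s *\<^sub>R e)) (at (s - s))"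
      using der[of "y + s *\<^sub>R e"] by simp
    then have "((\<lambda>t. g ((y + s *\<^sub>R e) + t *\<^sub>R e)) \<circ> (\<lambda>t. t - s) has_real_derivative g' (y + s *\<^sub>R e) * 1) (at s)"
      by (intro DERIV_chain) (auto intro!: derivative_eq_intros)
    then show ?thesis by (simp add: comp_def algebra_simps flip: scaleR_add_left)
  qed
  \<comment> \<open>Points within \<open>r + 1\<close> of the centre stay within
    \<open>r + 2\<close> under shifts by at most 1; beyond \<open>r + 1\<close> both values of
    \<open>g\<close> vanish.\<close>
  obtain B where B: "B > 0" "\<And>y. norm (y - c) \<le> r + 2 \<Longrightarrow> \<bar>g' y\<bar> \<le> B"
    using continuous_bounded_on_cball[OF g', of c "r + 2"] by metis
  have tri: "norm (y - c) - \<bar>t\<bar> \<le> norm (y + t *\<^sub>R e - c)" "norm (y + t *\<^sub>R e - c) \<le> norm (y - c) + \<bar>t\<bar>" for y t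
  proof -
    have *: "norm (t *\<^sub>R e) = \<bar>t\<bar>" using e by simp
    note [simp del] = norm_scaleR
    show "norm (y + t *\<^sub>R e - c) \<le> norm (y - c) + \<bar>t\<bar>"
      using norm_triangle_ineq[of "y - c" "t *\<^sub>R e"] * by (simp add: algebra_simps)
    show "norm (y - c) - \<bar>t\<bar> \<le> norm (y + t *\<^sub>R e - c)"
      using norm_triangle_ineq4[of "y + t *\<^sub>R e - c" "t *\<^sub>R e"] * by (simp add: algebra_simps)
  qed
  have lip: "\<bar>g (y + t *\<^sub>R e) - g (y + 0 *\<^sub>R e)\<bar> \<le> (B * indicator (cball c (r + 1)) y) * \<bar>t - 0\<bar>"
    if t: "\<bar>t - 0\<bar> < 1" for t y
  proof (cases "norm (y - c) \<le> r + 1")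
    case True
    have "norm (g (y + t *\<^sub>R e) - g (y + 0 *\<^sub>R e)) \<le> B * norm (t - 0)"
    proof (rule field_differentiable_bound[of "{-1..1}" "\<lambda>t. g (y + t *\<^sub>R e)" "\<lambda>s. g' (y + s *\<^sub>R e)"])
      show "norm (g' (y + s *\<^sub>R e)) \<le> B" if "s \<in> {-1..1}" for s
        using B(2)[of "y + s *\<^sub>R e"] tri(2)[of y s] True that by auto
    qed (use t in \<open>auto intro!: DERIV_subset[OF der']\<close>)
    then show ?thesis using True by (simp add: dist_norm norm_minus_commute)
  next
    case False
    then have "g y = 0" "g (y + t *\<^sub>R e) = 0"
      using supp tri(1)[of y t] t by auto
    then show ?thesis using B by simp
  qed
  have gm: "g \<in> borel_measurable borel" and gm': "g' \<in> borel_measurable borel"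
    using g g' by (auto intro: borel_measurable_continuous_onI)
  have int: "integrable lborel (\<lambda>y. g (y + t *\<^sub>R e))" if "\<bar>t - 0\<bar> < 1" for t
  proof (rule integrable_continuous_compact_support)
    show "continuous_on UNIV (\<lambda>y. g (y + t *\<^sub>R e))"
      by (intro continuous_on_compose2[OF g] continuous_intros) auto
    show "g (y + t *\<^sub>R e) = 0" if "norm (y - c) > r + 1" for y
      using that supp tri(1)[of y t] \<open>\<bar>t - 0\<bar> < 1\<close> by auto
  qed
  have ae: "AE y in lborel. ((\<lambda>t. g (y + t *\<^sub>R e)) has_real_derivative g' y) (at 0)"
    using der by simp
  have G: "integrable lborel (\<lambda>y. B * indicator (cball c (r + 1)) y :: real)"
    by (intro integrable_mult_right integrable_indicator_cball)
  note * = has_real_derivative_integral[of 1 0 lborel "\<lambda>t y. g (y + t *\<^sub>R e)" g' "\<lambda>y. B * indicator (cball c (r + 1)) y",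
      OF zero_less_one int ae lip G]
  show "integrable lborel g'" using * gm' by simp
  have "((\<lambda>t. \<integral>y. g (y + t *\<^sub>R e) \<partial>lborel) has_real_derivative (\<integral>y. g' y \<partial>lborel)) (at 0)"
    using * gm' by simp
  moreover have "(\<lambda>t. \<integral>y. g (y + t *\<^sub>R e) \<partial>lborel) = (\<lambda>t. \<integral>y. g y \<partial>lborel)"
    using integral_lborel_translation[OF gm] by simp
  ultimately show "(\<integral>y. g' y \<partial>lborel) = 0"
    by (metis DERIV_const DERIV_unique)
qed

lemma integral_by_parts_compact_support:
  fixes a b :: "'a::euclidean_space \<Rightarrow> real"
  assumes c: "continuous_on UNIV a" "continuous_on UNIV a'" "continuous_on UNIV b" "continuous_on UNIV b'"
    and a: "\<And>y. ((\<lambda>t. a (y + t *\<^sub>R e)) has_real_derivative a' y) (at 0)"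
    and b: "\<And>y. ((\<lambda>t. b (y + t *\<^sub>R e)) has_real_derivative b' y) (at 0)"
    and supp: "\<And>y. norm (y - c) > r \<Longrightarrow> b y = 0" "\<And>y. norm (y - c) > r \<Longrightarrow> b' y = 0" and e: "norm e = 1"
  shows "(\<integral>y. a' y * b y \<partial>lborel) = - (\<integral>y. a y * b' y \<partial>lborel)"
proof -
  have "(\<integral>y. a' y * b y + a y * b' y \<partial>lborel) = 0"
  proof (rule integral_directional_derivative_eq_0(2))
    show "((\<lambda>t. a (y + t *\<^sub>R e) * b (y + t *\<^sub>R e)) has_real_derivative a' y * b y + a y * b' y) (at 0)" for y
      using DERIV_mult[OF a[of y] b[of y]] by (simp add: algebra_simps)
  qed (use c supp e in \<open>auto intro!: continuous_intros\<close>)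
  moreover have "integrable lborel (\<lambda>y. a' y * b y)" "integrable lborel (\<lambda>y. a y * b' y)"
    by (rule integrable_continuous_compact_support[where c = c and r = r]; use c supp in \<open>auto intro!: continuous_intros\<close>)+
  ultimately show ?thesis by simp
qed

lemma norm_sq_shift_axis:
  fixes z :: "real^'n"
  shows "(norm (z + t *\<^sub>R axis i 1))\<^sup>2 = (norm z)\<^sup>2 + 2 * t * z $ i + t\<^sup>2"
  unfolding power2_norm_eq_inner
  by (simp add: inner_add_left inner_add_right inner_axis inner_axis' algebra_simps power2_eq_square)

lemma radial_derivative:
  fixes x y :: "real^'n"
  assumes "\<And>s. (F has_real_derivative F1 s) (at s)"
  shows "((\<lambda>t. F ((norm (y + t *\<^sub>R axis i 1 - x))\<^sup>2)) has_real_derivative 2 * (y - x) $ i * F1 ((norm (y - x))\<^sup>2)) (at 0)"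
proof -
  have *: "(norm (y + t *\<^sub>R axis i 1 - x))\<^sup>2 = (norm (y - x))\<^sup>2 + 2 * t * (y - x) $ i + t\<^sup>2" for t
    using norm_sq_shift_axis[of "y - x" t i] by (simp add: algebra_simps)
  show ?thesis unfolding *
    by (rule DERIV_chain2[of F "F1 ((norm (y - x))\<^sup>2)", THEN DERIV_cong])
       (use assms[of "(norm (y - x))\<^sup>2"] in \<open>auto intro!: derivative_eq_intros\<close>)
qed

section \<open>The classes \<open>Ck\<close> and Green's identity for radial weights\<close>

lemma Ck_continuous: "Ck k f \<Longrightarrow> continuous_on UNIV f"
  by (cases k) auto

lemma Ck_Suc_mono: "Ck (Suc k) f \<Longrightarrow> Ck k f"
  by (induction k arbitrary: f) auto

lemma Ck_Suc_pd: "Ck (Suc k) f \<Longrightarrow> Ck k (pd i f)"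
  by auto

lemma Ck_has_derivative_pd:
  assumes "Ck (Suc k) f"
  shows "((\<lambda>t. f (x + t *\<^sub>R axis i 1)) has_real_derivative pd i f x) (at 0)"
  using assms unfolding pd_def by (simp add: DERIV_deriv_iff_real_differentiable)

lemma Ck_add:
  assumes "Ck k f" "Ck k g"
  shows "Ck k (\<lambda>x. f x + g x)"
  using assms
proof (induction k arbitrary: f g)
  case 0
  then show ?case by (auto intro: continuous_intros)
next
  case (Suc k)
  have d: "((\<lambda>t. f (x + t *\<^sub>R axis i 1) + g (x + t *\<^sub>R axis i 1)) has_real_derivative pd i f x + pd i g x) (at 0)" for i x
    using Ck_has_derivative_pd[OF Suc.prems(1)] Ck_has_derivative_pd[OF Suc.prems(2)]
    by (auto intro!: derivative_eq_intros)
  then have "pd i (\<lambda>x. f x + g x) = (\<lambda>x. pd i f x + pd i g x)" for i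
    by (auto simp: fun_eq_iff pd_def DERIV_imp_deriv)
  moreover have "Ck k (\<lambda>x. pd i f x + pd i g x)" for i
    using Suc by auto
  ultimately show ?case
    using Suc.prems d by (auto intro!: continuous_intros simp: real_differentiable_def simp del: Ck.simps(1)) blast+
qed

lemma Ck_const: "Ck k (\<lambda>x. c)"
proof (induction k arbitrary: c)
  case (Suc k)
  have "pd i (\<lambda>x. c) = (\<lambda>x. 0)" for i by (simp add: pd_def fun_eq_iff)
  then show ?case using Suc by simp
qed simp

lemma Ck_sum: "finite I \<Longrightarrow> (\<And>i. i \<in> I \<Longrightarrow> Ck k (f i)) \<Longrightarrow> Ck k (\<lambda>x. \<Sum>i\<in>I. f i x)"
  by (induction I rule: finite_induct) (auto intro: Ck_const Ck_add)

lemma Ck_laplacian: "Ck (Suc (Suc k)) f \<Longrightarrow> Ck k (laplacian f)"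
  unfolding laplacian_def[abs_def] by (intro Ck_sum) (auto intro: Ck_Suc_pd)

text \<open>Two integrations by parts along each axis move the Laplacian onto the weight. In
  dimension 4 the Laplacian of F(|y - x|^2) is 4 s F'' + 2 * 4 F', whence the 8.\<close>

lemma green_radial:
  assumes w: "Ck (Suc (Suc 0)) w"
    and F: "\<And>s. (F has_real_derivative F1 s) (at s)" "\<And>s. (F1 has_real_derivative F2 s) (at s)"
    and c: "continuous_on UNIV F2"
    and supp: "\<And>s. s > r \<Longrightarrow> F s = 0" "\<And>s. s > r \<Longrightarrow> F1 s = 0" "\<And>s. s > r \<Longrightarrow> F2 s = 0"
    and s_def: "s = (\<lambda>y. (norm (y - x))\<^sup>2)"
  shows "(\<integral>y. laplacian w y * F (s y) \<partial>lborel) = (\<integral>y. w y * (4 * s y * F2 (s y) + 8 * F1 (s y)) \<partial>lborel)"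
proof -
  have cF: "continuous_on UNIV F" "continuous_on UNIV F1"
    using DERIV_isCont[OF F(1)] DERIV_isCont[OF F(2)] by (auto simp: continuous_on_eq_continuous_at)
  have cs: "continuous_on UNIV s" by (auto simp: s_def intro!: continuous_intros)
  have cc: "continuous_on UNIV (\<lambda>y. F (s y))" "continuous_on UNIV (\<lambda>y. F1 (s y))" "continuous_on UNIV (\<lambda>y. F2 (s y))"
    using continuous_on_compose2[OF _ cs subset_UNIV] cF c by auto
  have w1: "Ck (Suc 0) (pd i w)" "Ck 0 (pd i (pd i w))" for i
    using w by (auto intro: Ck_Suc_pd)
  have cw: "continuous_on UNIV w" "continuous_on UNIV (pd i w)" "continuous_on UNIV (pd i (pd i w))" for i
    using w by auto
  have large: "s y > r" if "norm (y - x) > \<bar>r\<bar> + 1" for y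
  proof -
    have "(\<bar>r\<bar> + 1) * 1 \<le> norm (y - x) * norm (y - x)"
      using that by (intro mult_mono) auto
    then show ?thesis by (simp add: s_def power2_eq_square)
  qed
  note supp' = supp[OF large]
  let ?b = "\<lambda>i y. 2 * (y - x) $ i * F1 (s y)"
  let ?d = "\<lambda>i y. 2 * F1 (s y) + 4 * ((y - x) $ i)\<^sup>2 * F2 (s y)"
  have db: "((\<lambda>t. ?b i (y + t *\<^sub>R axis i 1)) has_real_derivative ?d i y) (at 0)" for i y
  proof -
    have 1: "((\<lambda>t. F1 (s (y + t *\<^sub>R axis i 1))) has_real_derivative 2 * (y - x) $ i * F2 (s y)) (at 0)"
      using radial_derivative[OF F(2)] by (simp add: s_def)
    have 2: "((\<lambda>t. 2 * (y + t *\<^sub>R axis i 1 - x) $ i) has_real_derivative 2) (at 0)"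
      by (auto simp: axis_def intro!: derivative_eq_intros)
    show ?thesis using DERIV_mult[OF 2 1] by (simp add: algebra_simps power2_eq_square)
  qed
  have cb: "continuous_on UNIV (?b i)" "continuous_on UNIV (?d i)" for i
    using cc by (auto intro!: continuous_intros)
  have step: "(\<integral>y. pd i (pd i w) y * F (s y) \<partial>lborel) = (\<integral>y. w y * ?d i y \<partial>lborel)" for i
  proof -
    have "(\<integral>y. pd i (pd i w) y * F (s y) \<partial>lborel) = - (\<integral>y. pd i w y * ?b i y \<partial>lborel)"
      by (rule integral_by_parts_compact_support[where e = "axis i 1" and c = x and r = "\<bar>r\<bar> + 1"])
         (use cw cc cb supp' Ck_has_derivative_pd[OF w1(1)] radial_derivative[OF F(1)] in \<open>auto simp: s_def\<close>)
    also have "(\<integral>y. pd i w y * ?b i y \<partial>lborel) = - (\<integral>y. w y * ?d i y \<partial>lborel)"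
      by (rule integral_by_parts_compact_support[where e = "axis i 1" and c = x and r = "\<bar>r\<bar> + 1"])
         (use cw cc cb db supp' Ck_has_derivative_pd[OF w] in auto)
    finally show ?thesis by simp
  qed
  have int1: "integrable lborel (\<lambda>y. pd i (pd i w) y * F (s y))" for i
    by (rule integrable_continuous_compact_support[where c = x and r = "\<bar>r\<bar> + 1"])
       (use cw cc supp' in \<open>auto intro!: continuous_intros\<close>)
  have int2: "integrable lborel (\<lambda>y. w y * ?d i y)" for i
    by (rule integrable_continuous_compact_support[where c = x and r = "\<bar>r\<bar> + 1"])
       (use cw cb supp' in \<open>auto intro!: continuous_on_mult\<close>)
  have "(\<integral>y. laplacian w y * F (s y) \<partial>lborel) = (\<Sum>i\<in>UNIV. \<integral>y. pd i (pd i w) y * F (s y) \<partial>lborel)"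
    unfolding laplacian_def sum_distrib_right using int1 by (subst Bochner_Integration.integral_sum) auto
  also have "\<dots> = (\<integral>y. (\<Sum>i\<in>UNIV. w y * ?d i y) \<partial>lborel)"
    unfolding step using int2 by (subst Bochner_Integration.integral_sum) auto
  also have "(\<lambda>y. \<Sum>i\<in>UNIV. w y * ?d i y) = (\<lambda>y. w y * (4 * s y * F2 (s y) + 8 * F1 (s y)))"
  proof
    fix y
    have "s y = (\<Sum>i\<in>UNIV. ((y - x) $ i)\<^sup>2)"
      unfolding s_def power2_norm_eq_inner by (simp add: inner_vec_def power2_eq_square)
    then show "(\<Sum>i\<in>UNIV. w y * ?d i y) = w y * (4 * s y * F2 (s y) + 8 * F1 (s y))"
      by (simp add: sum_4 algebra_simps)
  qed
  finally show ?thesis .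
qed

section \<open>Moments against radial weights\<close>

definition chi :: "real^4 \<Rightarrow> real \<Rightarrow> real^4 \<Rightarrow> real" where
  "chi x \<rho> y = max 0 (1 - (norm (y - x))\<^sup>2 / \<rho>)"

definition ball_moment :: "nat \<Rightarrow> (real^4 \<Rightarrow> real) \<Rightarrow> real^4 \<Rightarrow> real \<Rightarrow> real" where
  "ball_moment k w x \<rho> = (\<integral>y. chi x \<rho> y ^ k * w y \<partial>lborel)"

text \<open>An exponent of at least 2 smooths the kink: at 0 the difference quotient is at most
  |h|^(n+1).\<close>

lemma DERIV_max_power:
  "((\<lambda>r::real. max 0 r ^ Suc (Suc n)) has_real_derivative real (Suc (Suc n)) * max 0 r ^ Suc n) (at r)"
proof -
  consider "r < 0" | "r > 0" | "r = 0" by linarith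
  then show ?thesis
  proof cases
    case 1
    have "((\<lambda>r::real. 0) has_real_derivative 0) (at r)" by simp
    then have "((\<lambda>r::real. max 0 r ^ Suc (Suc n)) has_real_derivative 0) (at r)"
      by (rule has_field_derivative_transform_within_open[where S = "{..<0}"]) (use 1 in auto)
    then show ?thesis using 1 by simp
  next
    case 2
    have "((\<lambda>r::real. r ^ Suc (Suc n)) has_real_derivative real (Suc (Suc n)) * r ^ Suc n) (at r)"
      by (rule DERIV_cong[OF DERIV_pow]) simp
    then have "((\<lambda>r::real. max 0 r ^ Suc (Suc n)) has_real_derivative real (Suc (Suc n)) * r ^ Suc n) (at r)"
      by (rule has_field_derivative_transform_within_open[where S = "{0<..}"]) (use 2 in auto)
    then show ?thesis using 2 by simp
  next
    case 3
    have "((\<lambda>h::real. max 0 h ^ Suc (Suc n) / h) \<longlongrightarrow> 0) (at 0)"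
    proof (rule Lim_null_comparison)
      have "norm (max 0 h ^ Suc (Suc n) / h) \<le> \<bar>h\<bar> ^ Suc n" for h :: real
        by (cases "h > 0") (simp_all add: max_def mult_nonpos_nonneg)
      then show "\<forall>\<^sub>F h in at 0. norm (max 0 h ^ Suc (Suc n) / h) \<le> \<bar>h\<bar> ^ Suc n" for h :: real by simp
      have "((\<lambda>h::real. \<bar>h\<bar> ^ Suc n) \<longlongrightarrow> \<bar>0\<bar> ^ Suc n) (at 0)"
        by (intro tendsto_intros)
      then show "((\<lambda>h::real. \<bar>h\<bar> ^ Suc n) \<longlongrightarrow> 0) (at 0)" by simp
    qed
    then show ?thesis using 3 by (simp add: has_field_derivative_iff)
  qed
qed

lemma DERIV_max_power':
  assumes "k \<ge> 2"
  shows "((\<lambda>r::real. max 0 r ^ k) has_real_derivative real k * max 0 r ^ (k - 1)) (at r)"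
proof -
  obtain n where "k = Suc (Suc n)" using assms by (metis add_2_eq_Suc le_Suc_ex)
  then show ?thesis using DERIV_max_power[of n r] by simp
qed

lemma chi_nonneg: "0 \<le> chi x \<rho> y"
  by (simp add: chi_def)

lemma chi_le_1: "\<rho> > 0 \<Longrightarrow> chi x \<rho> y \<le> 1"
  by (simp add: chi_def)

lemma chi_eq_0: "\<rho> > 0 \<Longrightarrow> \<rho> \<le> (norm (y - x))\<^sup>2 \<Longrightarrow> chi x \<rho> y = 0"
  by (simp add: chi_def field_simps)

lemma norm_sq_gt:
  fixes z :: "'a::real_normed_vector"
  assumes "norm z > r + 1" "r \<ge> 0"
  shows "(norm z)\<^sup>2 > r"
proof -
  have "(r + 1) * 1 \<le> norm z * norm z"
    using assms by (intro mult_mono) auto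
  then show ?thesis by (simp add: power2_eq_square)
qed

lemma continuous_on_chi: "continuous_on UNIV (chi x \<rho>)"
  unfolding chi_def[abs_def] by (cases "\<rho> = 0") (auto intro!: continuous_intros)

lemma integrable_chi_power:
  assumes "continuous_on UNIV w" "\<rho> > 0" "k > 0"
  shows "integrable lborel (\<lambda>y. chi x \<rho> y ^ k * w y)"
proof (rule integrable_continuous_compact_support[where c = x and r = "\<rho> + 1"])
  show "chi x \<rho> y ^ k * w y = 0" if "norm (y - x) > \<rho> + 1" for y
    using norm_sq_gt[OF that] assms chi_eq_0[of \<rho> y x] by (simp add: power_0_left)
qed (auto intro!: continuous_intros continuous_on_chi assms)

text \<open>On the support, |y - x|^2 / \<rho> equals 1 - \<open>chi\<close>. Factors of the squared
  distance, which arise from differentiation in \<rho> and from the Laplacian, thus become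
  differences of powers, and the family \<open>ball_moment\<close> is closed under both operations.
  The exponent must be positive because 0^0 = 1 off the support.\<close>

lemma chi_power_mult:
  assumes "\<rho> > 0" "k \<ge> 1"
  shows "(norm (y - x))\<^sup>2 / \<rho> * chi x \<rho> y ^ k = chi x \<rho> y ^ k - chi x \<rho> y ^ Suc k"
proof (cases "chi x \<rho> y = 0")
  case True
  then show ?thesis using assms by (simp add: power_0_left)
next
  case False
  then have "(norm (y - x))\<^sup>2 / \<rho> = 1 - chi x \<rho> y" by (auto simp: chi_def max_def split: if_splits)
  then show ?thesis by (simp only: left_diff_distrib) simp
qed

lemma DERIV_chi_power:
  assumes "\<rho> > 0" "k \<ge> 2"
  shows "((\<lambda>\<rho>. chi x \<rho> y ^ k) has_real_derivative real k * chi x \<rho> y ^ (k - 1) * ((norm (y - x))\<^sup>2 / \<rho>\<^sup>2)) (at \<rho>)"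
  unfolding chi_def
  by (rule DERIV_chain2[OF DERIV_max_power'[OF assms(2)]])
     (use assms in \<open>auto intro!: derivative_eq_intros simp: power2_eq_square\<close>)

lemma DERIV_ball_moment:
  assumes w: "continuous_on UNIV w" and \<rho>: "\<rho> > 0" and k: "k \<ge> 2"
  shows "((\<lambda>\<rho>. ball_moment k w x \<rho>) has_real_derivative
      real k / \<rho> * (ball_moment (k - 1) w x \<rho> - ball_moment k w x \<rho>)) (at \<rho>)"
proof -
  obtain B where B: "B > 0" "\<And>y. norm (y - x) \<le> 2 * \<rho> + 1 \<Longrightarrow> \<bar>w y\<bar> \<le> B"
    using continuous_bounded_on_cball[OF w, of x "2 * \<rho> + 1"] by metis
  define G where "G y = (real k * (2 / \<rho>) * B) * indicator (cball x (2 * \<rho> + 1)) y" for y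
  have lip: "\<bar>chi x t y ^ k * w y - chi x \<rho> y ^ k * w y\<bar> \<le> G y * \<bar>t - \<rho>\<bar>" if t: "\<bar>t - \<rho>\<bar> < \<rho> / 2" for t y
  proof (cases "norm (y - x) \<le> 2 * \<rho> + 1")
    case True
    have "norm (chi x t y ^ k - chi x \<rho> y ^ k) \<le> (real k * (2 / \<rho>)) * norm (t - \<rho>)"
    proof (rule field_differentiable_bound[of "{\<rho>/2..3*\<rho>/2}" "\<lambda>t. chi x t y ^ k" "\<lambda>s. real k * chi x s y ^ (k - 1) * ((norm (y - x))\<^sup>2 / s\<^sup>2)"])
      fix s assume "s \<in> {\<rho>/2..3*\<rho>/2}"
      then have s: "s > 0" "1 / s \<le> 2 / \<rho>" using \<rho> by (auto simp: field_simps)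
      show "((\<lambda>t. chi x t y ^ k) has_real_derivative real k * chi x s y ^ (k - 1) * ((norm (y - x))\<^sup>2 / s\<^sup>2)) (at s within {\<rho>/2..3*\<rho>/2})"
        using DERIV_chi_power[OF s(1) k] by (rule DERIV_subset) auto
      \<comment> \<open>By \<open>chi_power_mult\<close> this product is a difference of powers
        lying in [0, 1]; the remaining factor 1/s is at most 2/\<rho>.\<close>
      have "chi x s y ^ (k - 1) * ((norm (y - x))\<^sup>2 / s) \<le> 1"
        using chi_power_mult[OF s(1), of "k - 1" y x] k zero_le_power[OF chi_nonneg, of x s y k]
          power_le_one[OF chi_nonneg chi_le_1[OF s(1)], of x y "k - 1"]
        by (auto simp: mult.commute)
      then have "chi x s y ^ (k - 1) * ((norm (y - x))\<^sup>2 / s) * (1 / s) \<le> 1 * (2 / \<rho>)"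
        using s by (intro mult_mono) auto
      then have "real k * (chi x s y ^ (k - 1) * ((norm (y - x))\<^sup>2 / s) * (1 / s)) \<le> real k * (1 * (2 / \<rho>))"
        by (intro mult_left_mono) auto
      then show "norm (real k * chi x s y ^ (k - 1) * ((norm (y - x))\<^sup>2 / s\<^sup>2)) \<le> real k * (2 / \<rho>)"
        using chi_nonneg[of x s y] by (simp add: power2_eq_square abs_mult)
    qed (use t \<rho> in \<open>auto simp: abs_if field_simps split: if_splits\<close>)
    then have "\<bar>chi x t y ^ k - chi x \<rho> y ^ k\<bar> * \<bar>w y\<bar> \<le> (real k * (2 / \<rho>)) * \<bar>t - \<rho>\<bar> * B"
      using B(2)[OF True] \<rho> by (intro mult_mono) auto
    then show ?thesis using True
      by (simp add: G_def dist_norm norm_minus_commute abs_mult[symmetric] algebra_simps)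
  next
    case False
    have "t > 0" "t < 2 * \<rho>" using t \<rho> by (auto simp: abs_if split: if_splits)
    moreover have "(norm (y - x))\<^sup>2 > 2 * \<rho>" using False norm_sq_gt[of "2 * \<rho>" "y - x"] \<rho> by auto
    ultimately have "chi x t y = 0" "chi x \<rho> y = 0" using \<rho> by (auto intro!: chi_eq_0)
    then show ?thesis using k B \<rho> by (simp add: power_0_left G_def)
  qed
  let ?F' = "\<lambda>y. real k / \<rho> * (chi x \<rho> y ^ (k - 1) * w y - chi x \<rho> y ^ k * w y)"
  have eq: "real k * chi x \<rho> y ^ (k - 1) * ((norm (y - x))\<^sup>2 / \<rho>\<^sup>2) * w y = ?F' y" for y
  proof -
    have "real k * chi x \<rho> y ^ (k - 1) * ((norm (y - x))\<^sup>2 / \<rho>\<^sup>2) * w y =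
      real k / \<rho> * ((norm (y - x))\<^sup>2 / \<rho> * chi x \<rho> y ^ (k - 1)) * w y"
      by (simp add: power2_eq_square)
    also have "\<dots> = ?F' y"
      using k by (subst chi_power_mult[OF \<rho>]) (auto simp: algebra_simps)
    finally show ?thesis .
  qed
  have i: "integrable lborel (\<lambda>y. chi x \<rho> y ^ (k - 1) * w y)" "integrable lborel (\<lambda>y. chi x \<rho> y ^ k * w y)"
    using k by (auto intro!: integrable_chi_power w \<rho>)
  have "((\<lambda>t. \<integral>y. chi x t y ^ k * w y \<partial>lborel) has_real_derivative (\<integral>y. ?F' y \<partial>lborel)) (at \<rho>)"
  proof (rule has_real_derivative_integral(2)[where e = "\<rho> / 2" and G = G])
    show "AE y in lborel. ((\<lambda>t. chi x t y ^ k * w y) has_real_derivative ?F' y) (at \<rho>)"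
      using DERIV_cmult_right[OF DERIV_chi_power[OF \<rho> k]] unfolding eq[symmetric] by (intro AE_I2)
    show "integrable lborel G" unfolding G_def
      by (intro integrable_mult_right integrable_indicator_cball)
    show "integrable lborel (\<lambda>y. chi x t y ^ k * w y)" if "\<bar>t - \<rho>\<bar> < \<rho> / 2" for t
      using that \<rho> k by (intro integrable_chi_power w) (auto simp: abs_if split: if_splits)
    show "?F' \<in> borel_measurable lborel" using i by auto
  qed (use \<rho> lip in auto)
  also have "(\<integral>y. ?F' y \<partial>lborel) = real k / \<rho> * (ball_moment (k - 1) w x \<rho> - ball_moment k w x \<rho>)"
    unfolding ball_moment_def using i by simp
  finally show ?thesis unfolding ball_moment_def .
qed

text \<open>Green's identity for the weight (1 - s/\<rho>)^k. The term with \<open>F2\<close>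
  carries a factor s, which \<open>chi_power_mult\<close> absorbs; \<open>k \<ge> 3\<close> makes
  the power k - 1 in \<open>F1\<close> differentiable.\<close>

lemma ball_moment_laplacian:
  assumes w: "Ck (Suc (Suc 0)) w" and \<rho>: "\<rho> > 0" and k: "k \<ge> 3"
  shows "ball_moment k (laplacian w) x \<rho> =
    4 * real k / \<rho> * ((real k - 1) * ball_moment (k - 2) w x \<rho> - (real k + 1) * ball_moment (k - 1) w x \<rho>)"
proof -
  let ?m = "\<lambda>s. max 0 (1 - s / \<rho>)"
  let ?F1 = "\<lambda>s. - (real k / \<rho>) * ?m s ^ (k - 1)"
  let ?F2 = "\<lambda>s. real k * (real k - 1) / \<rho>\<^sup>2 * ?m s ^ (k - 2)"
  let ?s = "\<lambda>y. (norm (y - x))\<^sup>2"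
  have d: "((\<lambda>s. ?m s ^ j) has_real_derivative real j * ?m s ^ (j - 1) * (- 1 / \<rho>)) (at s)" if "j \<ge> 2" for j s
    by (rule DERIV_chain2[OF DERIV_max_power'[OF that]]) (use \<rho> in \<open>auto intro!: derivative_eq_intros\<close>)
  have z: "?m s = 0" if "s > \<rho>" for s using that \<rho> by (simp add: field_simps)
  have "(\<integral>y. laplacian w y * ?m (?s y) ^ k \<partial>lborel) = (\<integral>y. w y * (4 * ?s y * ?F2 (?s y) + 8 * ?F1 (?s y)) \<partial>lborel)"
  proof (rule green_radial[OF w, where r = \<rho>])
    show "((\<lambda>s. ?m s ^ k) has_real_derivative ?F1 s) (at s)" for s
      using d[of k s] k by simp
    have "((\<lambda>s. ?m s ^ (k - 1)) has_real_derivative real (k - 1) * ?m s ^ (k - 2) * (- 1 / \<rho>)) (at s)" for s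
      using d[of "k - 1" s] k by (simp add: numeral_2_eq_2)
    note * = DERIV_cmult[OF this, of "- (real k / \<rho>)"]
    have "- (real k / \<rho>) * (real (k - 1) * ?m s ^ (k - 2) * (- 1 / \<rho>)) = ?F2 s" for s
      using k by (simp add: power2_eq_square of_nat_diff)
    with * show "(?F1 has_real_derivative ?F2 s) (at s)" for s by metis
    show "continuous_on UNIV ?F2" using \<rho> by (auto intro!: continuous_intros)
  qed (use z k in \<open>auto simp: power_0_left\<close>)
  also have "(\<lambda>y. w y * (4 * ?s y * ?F2 (?s y) + 8 * ?F1 (?s y))) =
    (\<lambda>y. 4 * real k / \<rho> * ((real k - 1) * (chi x \<rho> y ^ (k - 2) * w y) - (real k + 1) * (chi x \<rho> y ^ (k - 1) * w y)))"
  proof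
    fix y
    have S: "Suc (k - 2) = k - 1" using k by simp
    have "4 * ?s y * ?F2 (?s y) = 4 * real k * (real k - 1) / \<rho> * (?s y / \<rho> * chi x \<rho> y ^ (k - 2))"
      by (simp add: chi_def power2_eq_square)
    also have "\<dots> = 4 * real k * (real k - 1) / \<rho> * (chi x \<rho> y ^ (k - 2) - chi x \<rho> y ^ (k - 1))"
      using k by (subst chi_power_mult[OF \<rho>]) (auto simp: S)
    finally show "w y * (4 * ?s y * ?F2 (?s y) + 8 * ?F1 (?s y)) =
      4 * real k / \<rho> * ((real k - 1) * (chi x \<rho> y ^ (k - 2) * w y) - (real k + 1) * (chi x \<rho> y ^ (k - 1) * w y))"
      using \<rho> by (simp add: chi_def) (simp add: field_simps)
  qed
  also have "(\<integral>y. 4 * real k / \<rho> * ((real k - 1) * (chi x \<rho> y ^ (k - 2) * w y) - (real k + 1) * (chi x \<rho> y ^ (k - 1) * w y)) \<partial>lborel) =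
     4 * real k / \<rho> * ((real k - 1) * ball_moment (k - 2) w x \<rho> - (real k + 1) * ball_moment (k - 1) w x \<rho>)"
  proof -
    have "integrable lborel (\<lambda>y. chi x \<rho> y ^ (k - 2) * w y)" "integrable lborel (\<lambda>y. chi x \<rho> y ^ (k - 1) * w y)"
      using k Ck_continuous[OF w] \<rho> by (auto intro!: integrable_chi_power)
    then show ?thesis unfolding ball_moment_def by simp
  qed
  finally show ?thesis
    unfolding ball_moment_def by (simp add: chi_def mult.commute)
qed

text \<open>The derivative of the unnormalised integral \<open>E t\<close> is the volume pi^2 t^2 /
  2 of the ball of radius sqrt t, so \<open>E t\<close> is pi^2 t^3 / 6 without polar
  coordinates.\<close>

lemma ball_moment_one_1:
  assumes \<rho>: "\<rho> > 0"
  shows "ball_moment 1 (\<lambda>_. 1) x \<rho> = pi\<^sup>2 * \<rho>\<^sup>2 / 6"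
proof -
  let ?s = "\<lambda>y. (norm (y - x))\<^sup>2"
  define E where "E t = (\<integral>y. max 0 (t - ?s y) \<partial>lborel)" for t
  \<comment> \<open>On this sphere the integrand has a kink in \<open>t\<close>. It is a null set,
    which is why \<open>has_real_derivative_integral\<close> asks for derivatives only almost
    everywhere.\<close>
  have sphere: "AE y in lborel. ?s y \<noteq> t" for t
  proof -
    have "sphere x (sqrt t) \<in> null_sets lborel"
      using negligible_sphere[of x "sqrt t"]
      by (simp add: negligible_iff_null_sets null_sets_completion_iff)
    then show ?thesis
      by (rule AE_mp[OF AE_not_in]) (auto simp: dist_norm norm_minus_commute real_sqrt_unique)
  qed
  have supp: "max 0 (t - ?s y) = 0" if "norm (y - x) > \<bar>t\<bar> + 1" for t y
    using norm_sq_gt[OF that] by auto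
  have int: "integrable lborel (\<lambda>y. max 0 (t - ?s y))" for t
    by (rule integrable_continuous_compact_support[where c = x and r = "\<bar>t\<bar> + 1"])
       (use supp in \<open>auto intro!: continuous_intros\<close>)
  have dE: "(E has_real_derivative (\<integral>y. indicator {y. ?s y < t} y \<partial>lborel)) (at t)" for t
    unfolding E_def
  proof (rule has_real_derivative_integral(2)[where e = 1 and G = "indicator (cball x (\<bar>t\<bar> + 2))"])
    show "AE y in lborel. ((\<lambda>t. max 0 (t - ?s y)) has_real_derivative indicator {y. ?s y < t} y) (at t)"
      using sphere[of t]
    proof eventually_elim
      case (elim y)
      then consider "?s y < t" | "?s y > t" by linarith
      then show ?case
      proof cases
        case 1
        have "((\<lambda>t. t - ?s y) has_real_derivative 1) (at t)" by (auto intro!: derivative_eq_intros)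
        then have "((\<lambda>t. max 0 (t - ?s y)) has_real_derivative 1) (at t)"
          by (rule has_field_derivative_transform_within_open[where S = "{?s y<..}"]) (use 1 in auto)
        then show ?thesis using 1 by simp
      next
        case 2
        have "((\<lambda>t. 0) has_real_derivative 0) (at t)" by simp
        then have "((\<lambda>t. max 0 (t - ?s y)) has_real_derivative 0) (at t)"
          by (rule has_field_derivative_transform_within_open[where S = "{..<?s y}"]) (use 2 in auto)
        then show ?thesis using 2 by simp
      qed
    qed
    show "\<bar>max 0 (t' - ?s y) - max 0 (t - ?s y)\<bar> \<le> indicator (cball x (\<bar>t\<bar> + 2)) y * \<bar>t' - t\<bar>"
      if "\<bar>t' - t\<bar> < 1" for t' y
    proof (cases "y \<in> cball x (\<bar>t\<bar> + 2)")
      case False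
      then have "norm (y - x) > \<bar>t'\<bar> + 1" "norm (y - x) > \<bar>t\<bar> + 1"
        using that by (auto simp: dist_norm norm_minus_commute)
      then show ?thesis using supp by simp
    qed auto
    show "(\<lambda>y. indicator {y. ?s y < t} y) \<in> borel_measurable lborel" by measurable
  qed (use int in \<open>auto intro!: integrable_indicator_cball\<close>)
  have vol: "(\<integral>y. indicator {y. ?s y < t} y \<partial>lborel) = pi\<^sup>2 / 2 * t\<^sup>2" if "t \<ge> 0" for t
  proof -
    have "{y. ?s y < t} = ball x (sqrt t)"
      using that real_less_rsqrt by (auto simp: dist_norm norm_minus_commute) 
        (metis norm_ge_zero real_sqrt_pow2 power_strict_mono pos2)
    moreover have "(sqrt t) ^ 4 = t\<^sup>2"
    proof -
      have "(sqrt t) ^ 4 = ((sqrt t)\<^sup>2)\<^sup>2" by (simp flip: power_mult)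
      then show ?thesis using that by simp
    qed
    ultimately show ?thesis
      using that by (simp add: content_ball unit_ball_vol_4)
  qed
  have "\<exists>c. \<forall>t\<in>{0..\<rho>}. E t - pi\<^sup>2 * t ^ 3 / 6 = c"
  proof (rule has_field_derivative_zero_constant)
    show "((\<lambda>t. E t - pi\<^sup>2 * t ^ 3 / 6) has_real_derivative 0) (at t within {0..\<rho>})" if "t \<in> {0..\<rho>}" for t
      by (rule DERIV_subset[OF DERIV_cong[OF DERIV_diff[OF dE]]])
         (use that vol[of t] in \<open>auto intro!: derivative_eq_intros simp del: integral_indicator\<close>)
  qed auto
  then obtain c where "\<And>t. t \<in> {0..\<rho>} \<Longrightarrow> E t - pi\<^sup>2 * t ^ 3 / 6 = c" by blast
  from this[of 0] this[of \<rho>] have "E \<rho> = E 0 + pi\<^sup>2 * \<rho> ^ 3 / 6" using \<rho> by simp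
  moreover have "E 0 = 0" unfolding E_def by simp
  moreover have "chi x \<rho> y ^ 1 * 1 = max 0 (\<rho> - ?s y) / \<rho>" for y
    using \<rho> by (auto simp: chi_def max_def field_simps)
  then have "ball_moment 1 (\<lambda>_. 1) x \<rho> = E \<rho> / \<rho>"
    unfolding ball_moment_def by (simp add: E_def)
  ultimately show ?thesis
    using \<rho> by (simp add: power3_eq_cube power2_eq_square)
qed

text \<open>The constant 1 is harmonic, so \<open>ball_moment_laplacian\<close> turns into a
  recursion between consecutive exponents.\<close>

lemma ball_moment_one:
  assumes \<rho>: "\<rho> > 0"
  shows "ball_moment (Suc n) (\<lambda>_. 1) x \<rho> = pi\<^sup>2 * \<rho>\<^sup>2 / ((real n + 2) * (real n + 3))"
proof (induction n)
  case 0
  then show ?case using ball_moment_one_1[OF \<rho>, of x] by simp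
next
  case (Suc n)
  have l: "laplacian (\<lambda>_. 1) = (\<lambda>_. 0)"
    by (simp add: laplacian_def pd_def fun_eq_iff)
  have "0 = 4 * real (Suc (Suc (Suc n))) / \<rho> * ((real (Suc (Suc (Suc n))) - 1) * ball_moment (Suc n) (\<lambda>_. 1) x \<rho>
     - (real (Suc (Suc (Suc n))) + 1) * ball_moment (Suc (Suc n)) (\<lambda>_. 1) x \<rho>)"
    using ball_moment_laplacian[OF Ck_const \<rho>, of "Suc (Suc (Suc n))" 1 x] unfolding l
    by (simp add: ball_moment_def)
  then have "(real n + 4) * ball_moment (Suc (Suc n)) (\<lambda>_. 1) x \<rho> = (real n + 2) * ball_moment (Suc n) (\<lambda>_. 1) x \<rho>"
    using \<rho> by (simp add: add.commute)
  then have "ball_moment (Suc (Suc n)) (\<lambda>_. 1) x \<rho> = (real n + 2) / (real n + 4) * (pi\<^sup>2 * \<rho>\<^sup>2 / ((real n + 2) * (real n + 3)))"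
    unfolding Suc by (simp add: eq_divide_eq) (simp only: mult_ac)
  also have "\<dots> = pi\<^sup>2 * \<rho>\<^sup>2 / ((real (Suc n) + 2) * (real (Suc n) + 3))"
    by (simp add: divide_simps) (simp add: algebra_simps)
  finally show ?case by simp
qed

text \<open>Divided by their mass, which \<open>ball_moment_one\<close> supplies, the weights form
  an approximate identity at \<open>x\<close>.\<close>

lemma ball_moment_tendsto:
  assumes w: "continuous_on UNIV w"
  shows "((\<lambda>\<rho>. ball_moment (Suc n) w x \<rho> / \<rho>\<^sup>2) \<longlongrightarrow> w x * pi\<^sup>2 / ((real n + 2) * (real n + 3))) (at_right 0)"
proof (rule tendstoI)
  fix e :: real assume e: "e > 0"
  define c where "c = pi\<^sup>2 / ((real n + 2) * (real n + 3))"
  have c: "c > 0" by (simp add: c_def)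
  have e': "e / (2 * c) > 0" using e c by simp
  obtain d where d: "d > 0" "\<And>y. dist y x < d \<Longrightarrow> dist (w y) (w x) < e / (2 * c)"
    using w[unfolded continuous_on_iff, rule_format, OF UNIV_I e', of x] by auto
  have "dist (ball_moment (Suc n) w x \<rho> / \<rho>\<^sup>2) (w x * pi\<^sup>2 / ((real n + 2) * (real n + 3))) < e"
    if \<rho>: "\<rho> > 0" "\<rho> < d\<^sup>2" for \<rho>
  proof -
    have i: "integrable lborel (\<lambda>y. chi x \<rho> y ^ Suc n * w y)" "integrable lborel (\<lambda>y. chi x \<rho> y ^ Suc n * 1)"
      by (rule integrable_chi_power; use w \<rho> in simp)+
    have m: "ball_moment (Suc n) (\<lambda>_. 1) x \<rho> = c * \<rho>\<^sup>2"
      using ball_moment_one[OF \<rho>(1)] by (simp add: c_def)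
    have "ball_moment (Suc n) w x \<rho> - w x * ball_moment (Suc n) (\<lambda>_. 1) x \<rho> =
      (\<integral>y. chi x \<rho> y ^ Suc n * w y - w x * (chi x \<rho> y ^ Suc n * 1) \<partial>lborel)"
      unfolding ball_moment_def using i by (subst Bochner_Integration.integral_diff) auto
    also have "\<bar>\<dots>\<bar> \<le> (\<integral>y. e / (2 * c) * (chi x \<rho> y ^ Suc n * 1) \<partial>lborel)"
    proof (rule Bochner_Integration.integral_abs_bound_integral)
      fix y
      show "\<bar>chi x \<rho> y ^ Suc n * w y - w x * (chi x \<rho> y ^ Suc n * 1)\<bar> \<le> e / (2 * c) * (chi x \<rho> y ^ Suc n * 1)"
      proof (cases "\<rho> \<le> (norm (y - x))\<^sup>2")
        case True
        then show ?thesis using chi_eq_0[of \<rho> y x] \<rho> by simp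
      next
        case False
        then have "(norm (y - x))\<^sup>2 < d\<^sup>2" using \<rho> by simp
        then have "norm (y - x) < d" using d(1) by (simp add: power_less_imp_less_base)
        then have "\<bar>w y - w x\<bar> \<le> e / (2 * c)" using d(2)[of y] by (simp add: dist_norm less_imp_le)
        then have "chi x \<rho> y ^ Suc n * \<bar>w y - w x\<bar> \<le> chi x \<rho> y ^ Suc n * (e / (2 * c))"
          by (intro mult_left_mono zero_le_power chi_nonneg)
        moreover have "chi x \<rho> y ^ Suc n * w y - w x * (chi x \<rho> y ^ Suc n * 1) = chi x \<rho> y ^ Suc n * (w y - w x)"
          by (simp add: algebra_simps)
        ultimately show ?thesis
          using zero_le_power[OF chi_nonneg, of x \<rho> y "Suc n"] by (simp only: abs_mult) (simp add: mult.commute)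
      qed
    qed (use i in \<open>auto simp del: power_Suc mult_1_right\<close>)
    also have "\<dots> = e / 2 * \<rho>\<^sup>2"
      using m c unfolding ball_moment_def by simp
    finally have "\<bar>ball_moment (Suc n) w x \<rho> - w x * (c * \<rho>\<^sup>2)\<bar> \<le> e / 2 * \<rho>\<^sup>2"
      unfolding m .
    moreover have "ball_moment (Suc n) w x \<rho> / \<rho>\<^sup>2 - w x * c = (ball_moment (Suc n) w x \<rho> - w x * (c * \<rho>\<^sup>2)) / \<rho>\<^sup>2"
      using \<rho> by (simp add: field_simps)
    ultimately have "\<bar>ball_moment (Suc n) w x \<rho> / \<rho>\<^sup>2 - w x * c\<bar> \<le> e / 2"
      using \<rho> by (simp add: abs_divide field_simps)
    then show ?thesis using e by (simp add: dist_real_def c_def)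
  qed
  then show "\<forall>\<^sub>F \<rho> in at_right 0. dist (ball_moment (Suc n) w x \<rho> / \<rho>\<^sup>2) (w x * pi\<^sup>2 / ((real n + 2) * (real n + 3))) < e"
    unfolding eventually_at_right_field using d(1) by (intro exI[of _ "d\<^sup>2"]) auto
qed

section \<open>The truncated logarithm and the representation formula\<close>

text \<open>Dyadic decomposition: where r/2^(j+1) < |y - x| \<le> r/2^j the integrand is at most
  4^(j+1)/r^2, and the ball of radius r/2^j has volume pi^2/2 (r/2^j)^4. The products 2 pi^2 r^2 /
  4^j are summable. All logarithmic singularities below are dominated by this function.\<close>

lemma integrable_inverse_norm_sq:
  fixes x :: "real^4"
  assumes r: "r > 0"
  shows "integrable lborel (\<lambda>y. indicator (cball x r) y / (norm (y - x))\<^sup>2)"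
proof (rule integrableI_bounded)
  let ?F = "\<lambda>y. indicator (cball x r) y / (norm (y - x))\<^sup>2 :: real"
  let ?c = "\<lambda>j. 4 ^ Suc j / r\<^sup>2"
  have ind [measurable]: "(indicator (cball x s) :: real^4 \<Rightarrow> real) \<in> borel_measurable borel"
    "(indicator (cball x s) :: real^4 \<Rightarrow> ennreal) \<in> borel_measurable borel" for s
    by (auto intro!: borel_measurable_indicator)
  have pt: "ennreal (norm (?F y)) \<le> (\<Sum>j. ennreal (?c j) * indicator (cball x (r / 2 ^ j)) y)" for y
  proof (cases "y \<in> cball x r \<and> y \<noteq> x")
    case False
    then have "?F y = 0" by auto
    then show ?thesis by (simp only: norm_zero ennreal_0) simp
  next
    case True
    define d where "d = norm (y - x)"
    have d: "d > 0" "d \<le> r" using True by (auto simp: d_def dist_norm norm_minus_commute)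
    obtain n where "(1 / 2) ^ n < d / r"
      using real_arch_pow_inv[of "d / r" "1/2"] d r by auto
    then have ex: "\<exists>n. r / 2 ^ Suc n < d" using r d
      by (intro exI[of _ n]) (auto simp: field_simps intro: less_le_trans)
    define j where "j = (LEAST n. r / 2 ^ Suc n < d)"
    have j1: "r / 2 ^ Suc j < d" unfolding j_def by (rule LeastI_ex[OF ex])
    have j2: "d \<le> r / 2 ^ j"
    proof (cases j)
      case (Suc i)
      then have "\<not> r / 2 ^ Suc i < d" unfolding j_def by (metis lessI not_less_Least)
      then show ?thesis using Suc by simp
    qed (use d in simp)
    have "(r / 2 ^ Suc j)\<^sup>2 \<le> d\<^sup>2" using j1 r by (intro power_mono) auto
    moreover have "(r / 2 ^ Suc j)\<^sup>2 = r\<^sup>2 / 4 ^ Suc j"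
    proof -
      have "(2 ^ Suc j)\<^sup>2 = (4::real) ^ Suc j"
        by (simp only: power_mult[symmetric] mult.commute[of "Suc j"]) (simp add: power_mult)
      then show ?thesis by (simp only: power_divide)
    qed
    ultimately have "1 / d\<^sup>2 \<le> ?c j"
      using d r by (simp add: field_simps)
    then have "ennreal (norm (?F y)) \<le> ennreal (?c j) * indicator (cball x (r / 2 ^ j)) y"
      using True j2 by (simp add: d_def dist_norm norm_minus_commute ennreal_leI)
    also have "\<dots> = sum (\<lambda>j. ennreal (?c j) * indicator (cball x (r / 2 ^ j)) y) {j}"
      by (simp only: sum.insert finite.emptyI empty_iff not_False_eq_True sum.empty add_0_right)
    also have "\<dots> \<le> (\<Sum>j. ennreal (?c j) * indicator (cball x (r / 2 ^ j)) y)"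
      by (rule sum_le_suminf) auto
    finally show ?thesis .
  qed
  have "(\<integral>\<^sup>+y. ennreal (norm (?F y)) \<partial>lborel) \<le> (\<integral>\<^sup>+y. (\<Sum>j. ennreal (?c j) * indicator (cball x (r / 2 ^ j)) y) \<partial>lborel)"
    by (intro nn_integral_mono pt)
  also have "\<dots> = (\<Sum>j. \<integral>\<^sup>+y. ennreal (?c j) * indicator (cball x (r / 2 ^ j)) y \<partial>lborel)"
    by (rule nn_integral_suminf) (intro borel_measurable_times_ennreal; simp add: ind)
  also have "\<dots> = (\<Sum>j. ennreal (2 * pi\<^sup>2 * r\<^sup>2 * (1 / 4) ^ j))"
  proof (rule suminf_cong)
    fix j
    have "(\<integral>\<^sup>+y. ennreal (?c j) * indicator (cball x (r / 2 ^ j)) y \<partial>lborel) = ennreal (?c j) * emeasure lborel (cball x (r / 2 ^ j))"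
      by (rule nn_integral_cmult_indicator) auto
    also have "\<dots> = ennreal (?c j) * ennreal (pi\<^sup>2 / 2 * (r / 2 ^ j) ^ 4)"
      using r by (simp add: emeasure_cball unit_ball_vol_4)
    also have "\<dots> = ennreal (?c j * (pi\<^sup>2 / 2 * (r / 2 ^ j) ^ 4))"
      using r by (intro ennreal_mult[symmetric]) auto
    also have "?c j * (pi\<^sup>2 / 2 * (r / 2 ^ j) ^ 4) = 2 * pi\<^sup>2 * r\<^sup>2 * (1 / 4) ^ j"
    proof -
      have "(2 ^ j) ^ 4 = (4::real) ^ j * 4 ^ j"
        by (simp flip: power_mult power_mult_distrib add: mult.commute[of j]) (simp add: power_mult)
      then show ?thesis using r by (simp add: power_divide field_simps power2_eq_square power4_eq_xxxx)
    qed
    finally show "(\<integral>\<^sup>+y. ennreal (?c j) * indicator (cball x (r / 2 ^ j)) y \<partial>lborel) = ennreal (2 * pi\<^sup>2 * r\<^sup>2 * (1 / 4) ^ j)" .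
  qed
  also have "\<dots> < \<infinity>"
  proof -
    have "summable (\<lambda>j. 2 * pi\<^sup>2 * r\<^sup>2 * (1 / 4) ^ j)"
      by (intro summable_mult summable_geometric) auto
    then have "(\<Sum>j. ennreal (2 * pi\<^sup>2 * r\<^sup>2 * (1 / 4) ^ j)) \<noteq> top"
      by (rule ennreal_suminf_neq_top) auto
    then show ?thesis by (simp add: less_top)
  qed
  finally show "(\<integral>\<^sup>+y. ennreal (norm (?F y)) \<partial>lborel) < \<infinity>" .
  have "(\<lambda>y. (norm (y - x))\<^sup>2) \<in> borel_measurable borel"
    by (intro borel_measurable_continuous_onI continuous_intros)
  then show "?F \<in> borel_measurable lborel" using ind(1)[of r] by simp
qed

text \<open>The Taylor polynomial of \<open>- ln\<close> at 1, so that \<open>trunc_log\<close> vanishes there to order 8.\<close>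

definition log_poly :: "real \<Rightarrow> real" where
  "log_poly t = (1 - t) + (1 - t)^2 / 2 + (1 - t)^3 / 3 + (1 - t)^4 / 4 + (1 - t)^5 / 5 + (1 - t)^6 / 6 + (1 - t)^7 / 7"

definition trunc_log :: "real \<Rightarrow> real" where
  "trunc_log t = (if t < 1 then - ln t - log_poly t else 0)"

lemma trunc_log_measurable [measurable]: "trunc_log \<in> borel_measurable borel"
  unfolding trunc_log_def[abs_def] log_poly_def by measurable

text \<open>The derivatives of the terms of \<open>log_poly\<close> form a geometric sum, which
  collapses with -1/t to -(1 - t)^7 / t. The power 7 is chosen to match the weight in
  \<open>DERIV_davg\<close>.\<close>

lemma DERIV_trunc_log:
  assumes t: "t > 0"
  shows "(trunc_log has_real_derivative - (max 0 (1 - t) ^ 7 / t)) (at t)"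
proof -
  have d: "((\<lambda>t. - ln t - log_poly t) has_real_derivative - ((1 - t) ^ 7 / t)) (at t)" if "t > 0" for t :: real
  proof -
    have k: "((\<lambda>t. (1 - t) ^ Suc n / real (Suc n)) has_real_derivative - ((1 - t) ^ n)) (at t)" for n
      by (rule DERIV_cong[OF DERIV_cdivide[OF DERIV_power[where n = "Suc n"]]])
         (auto intro!: derivative_eq_intros simp del: of_nat_Suc)
    have "((\<lambda>t. - ln t - (\<Sum>n<7. (1 - t) ^ Suc n / real (Suc n))) has_real_derivative - (1 / t) - (\<Sum>n<7. - ((1 - t) ^ n))) (at t)"
      by (intro DERIV_diff DERIV_minus DERIV_sum k) (use that in \<open>auto intro!: derivative_eq_intros\<close>)
    moreover have "(\<Sum>n<7. (1 - t) ^ Suc n / real (Suc n)) = log_poly t" for t :: real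
      by (simp add: log_poly_def eval_nat_numeral)
    moreover have "- (1 / t) - (\<Sum>n<7. - ((1 - t) ^ n)) = - ((1 - t) ^ 7 / t)"
      using sum_gp_strict[of "1 - t" 7] that by (simp add: sum_negf diff_divide_distrib)
    ultimately show ?thesis by simp
  qed
  consider "t < 1" | "t > 1" | "t = 1" by linarith
  then show ?thesis
  proof cases
    case 1
    have "(trunc_log has_real_derivative - ((1 - t) ^ 7 / t)) (at t)"
      by (rule has_field_derivative_transform_within_open[OF d[OF t], where S = "{..<1}"])
         (use 1 in \<open>auto simp: trunc_log_def\<close>)
    then show ?thesis using 1 by simp
  next
    case 2
    have "((\<lambda>_. 0::real) has_real_derivative 0) (at t)" by simp
    then have "(trunc_log has_real_derivative 0) (at t)"
      by (rule has_field_derivative_transform_within_open[where S = "{1<..}"])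
         (use 2 in \<open>auto simp: trunc_log_def\<close>)
    then show ?thesis using 2 by simp
  next
    \<comment> \<open>At t = 1 both branches meet with value and derivative 0, so the two one-sided
      difference quotients are treated separately.\<close>
    case 3
    have "((\<lambda>t. ((- ln t - log_poly t) - (- ln 1 - log_poly 1)) / (t - 1)) \<longlongrightarrow> 0) (at 1)"
      using d[of 1] by (simp add: has_field_derivative_iff)
    then have "((\<lambda>t. (- ln t - log_poly t) / (t - 1)) \<longlongrightarrow> 0) (at_left 1)"
      by (intro filterlim_mono[OF _ order_refl at_le[of "{..<1}" UNIV]]) (auto simp: log_poly_def)
    then have l: "((\<lambda>t. trunc_log t / (t - 1)) \<longlongrightarrow> 0) (at_left 1)"
      by (rule Lim_transform_eventually)
         (auto simp: trunc_log_def eventually_at_left_field intro!: exI[of _ 0])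
    have "((\<lambda>t::real. 0::real) \<longlongrightarrow> 0) (at_right 1)" by simp
    then have r: "((\<lambda>t. trunc_log t / (t - 1)) \<longlongrightarrow> 0) (at_right 1)"
      by (rule Lim_transform_eventually)
         (auto simp: trunc_log_def eventually_at_right_field intro!: exI[of _ 2])
    show ?thesis using filterlim_split_at[OF l r] 3
      by (simp add: has_field_derivative_iff trunc_log_def)
  qed
qed

lemma trunc_log_antimono:
  assumes "0 < s" "s \<le> t"
  shows "trunc_log t \<le> trunc_log s"
proof (rule DERIV_nonpos_imp_nonincreasing[OF assms(2)])
  fix z assume "s \<le> z" "z \<le> t"
  then show "\<exists>y. (trunc_log has_real_derivative y) (at z) \<and> y \<le> 0"
    using DERIV_trunc_log[of z] assms by (intro exI[of _ "- (max 0 (1 - z) ^ 7 / z)"]) auto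
qed

text \<open>Monotonicity, compared with a point where the function is already cut off. At 0 it
  fails: the convention \<open>ln 0 = 0\<close> makes \<open>trunc_log 0\<close> equal to
  \<open>- log_poly 0\<close>, which is negative. The estimates below therefore exclude the centre
  as a null set.\<close>

lemma trunc_log_nonneg:
  assumes "0 < t"
  shows "0 \<le> trunc_log t"
  using trunc_log_antimono[of t "max t 1"] assms by (auto simp: trunc_log_def split: if_splits)

lemma log_poly_bounds:
  assumes "0 \<le> t" "t \<le> 1"
  shows "0 \<le> log_poly t" "log_poly t \<le> 3"
proof -
  have p: "0 \<le> (1 - t) ^ k" "(1 - t) ^ k \<le> 1" for k
    using assms by (auto intro: power_le_one)
  show "0 \<le> log_poly t"
    using p[of 2] p[of 3] p[of 4] p[of 5] p[of 6] p[of 7] assms by (simp add: log_poly_def)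
  show "log_poly t \<le> 3"
    using p[of 2] p[of 3] p[of 4] p[of 5] p[of 6] p[of 7] assms by (simp add: log_poly_def)
qed

lemma trunc_log_le_inverse:
  assumes "0 < t"
  shows "trunc_log t \<le> 1 / t"
proof (cases "t < 1")
  case True
  have "- ln t = ln (1 / t)" using assms by (simp add: ln_div)
  also have "\<dots> \<le> 1 / t - 1" using assms by (intro ln_le_minus_one) auto
  finally show ?thesis using log_poly_bounds[of t] True assms by (simp add: trunc_log_def)
qed (use assms in \<open>auto simp: trunc_log_def\<close>)

lemma trunc_log_eq_0: "t \<ge> 1 \<Longrightarrow> trunc_log t = 0"
  by (simp add: trunc_log_def)

lemma AE_lborel_neq: "AE y in lborel. y \<noteq> (x :: 'a::euclidean_space)"
  by (rule AE_mp[OF AE_not_in[of "{x}"]]) (auto simp: null_sets_def)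

lemma integrable_trunc_log:
  fixes f :: "real^4 \<Rightarrow> real"
  assumes f: "continuous_on UNIV f" and \<rho>: "\<rho> > 0"
  shows "integrable lborel (\<lambda>y. trunc_log ((norm (y - x))\<^sup>2 / \<rho>) * f y)"
proof -
  have [measurable]: "f \<in> borel_measurable borel" using f by (rule borel_measurable_continuous_onI)
  obtain B where B: "B > 0" "\<And>y. norm (y - x) \<le> \<rho> + 1 \<Longrightarrow> \<bar>f y\<bar> \<le> B"
    using continuous_bounded_on_cball[OF f, of x "\<rho> + 1"] by metis
  show ?thesis
  proof (rule Bochner_Integration.integrable_bound)
    show "integrable lborel (\<lambda>y. \<rho> * B * (indicator (cball x (\<rho> + 1)) y / (norm (y - x))\<^sup>2))"
      using \<rho> by (intro integrable_mult_right integrable_inverse_norm_sq) auto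
    show "AE y in lborel. norm (trunc_log ((norm (y - x))\<^sup>2 / \<rho>) * f y) \<le>
        norm (\<rho> * B * (indicator (cball x (\<rho> + 1)) y / (norm (y - x))\<^sup>2))"
      using AE_lborel_neq[of x]
    proof eventually_elim
      case (elim y)
      let ?t = "(norm (y - x))\<^sup>2 / \<rho>"
      have t: "?t > 0" using elim \<rho> by simp
      show ?case
      proof (cases "norm (y - x) \<le> \<rho> + 1")
        case True
        have "norm (trunc_log ?t * f y) \<le> 1 / ?t * B"
          unfolding norm_mult using trunc_log_le_inverse[OF t] trunc_log_nonneg[OF t] B True
          by (intro mult_mono) auto
        then show ?thesis using True B \<rho> by (simp add: dist_norm norm_minus_commute mult.commute)
      next
        case False
        then have "?t \<ge> 1" using norm_sq_gt[of \<rho> "y - x"] \<rho> by simp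
        then show ?thesis by (simp add: trunc_log_eq_0)
      qed
    qed
  qed measurable
qed

definition log_potential :: "(real^4 \<Rightarrow> real) \<Rightarrow> real^4 \<Rightarrow> real \<Rightarrow> real" where
  "log_potential f x \<rho> = (\<integral>y. trunc_log ((norm (y - x))\<^sup>2 / \<rho>) * f y \<partial>lborel)"

text \<open>The kernel is unbounded at the centre, but its \<rho>-derivative chi^7 / \<rho> is
  bounded, so a multiple of |f| dominates the difference quotients. At \<open>y = x\<close> the
  argument of the logarithm is 0 for every scale and the difference vanishes.\<close>

lemma DERIV_log_potential:
  assumes f: "continuous_on UNIV f" "integrable lborel f" and \<rho>: "\<rho> > 0"
  shows "((\<lambda>\<rho>. log_potential f x \<rho>) has_real_derivative ball_moment 7 f x \<rho> / \<rho>) (at \<rho>)"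
proof -
  have d: "((\<lambda>t. trunc_log ((norm (y - x))\<^sup>2 / t)) has_real_derivative chi x t y ^ 7 / t) (at t)"
    if "t > 0" "y \<noteq> x" for t y
  proof -
    have "((\<lambda>t. trunc_log ((norm (y - x))\<^sup>2 / t)) has_real_derivative
        - (max 0 (1 - (norm (y - x))\<^sup>2 / t) ^ 7 / ((norm (y - x))\<^sup>2 / t)) * (- ((norm (y - x))\<^sup>2 / t\<^sup>2))) (at t)"
      by (rule DERIV_chain2[OF DERIV_trunc_log])
         (use that in \<open>auto intro!: derivative_eq_intros simp: power2_eq_square\<close>)
    then show ?thesis
      by (rule DERIV_cong) (use that in \<open>simp add: chi_def power2_eq_square\<close>)
  qed
  have "((\<lambda>t. \<integral>y. trunc_log ((norm (y - x))\<^sup>2 / t) * f y \<partial>lborel) has_real_derivative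
     (\<integral>y. chi x \<rho> y ^ 7 * f y / \<rho> \<partial>lborel)) (at \<rho>)"
  proof (rule has_real_derivative_integral(2)[where e = "\<rho> / 2" and G = "\<lambda>y. 2 / \<rho> * \<bar>f y\<bar>"])
    show "AE y in lborel. ((\<lambda>t. trunc_log ((norm (y - x))\<^sup>2 / t) * f y) has_real_derivative chi x \<rho> y ^ 7 * f y / \<rho>) (at \<rho>)"
      using AE_lborel_neq[of x]
    proof eventually_elim
      case (elim y)
      show ?case using DERIV_cmult_right[OF d[OF \<rho> elim], of "f y"] by simp
    qed
    show "(\<lambda>y. chi x \<rho> y ^ 7 * f y / \<rho>) \<in> borel_measurable lborel"
      using integrable_chi_power[OF f(1) \<rho>, of 7 x] by auto
    show "\<bar>trunc_log ((norm (y - x))\<^sup>2 / t) * f y - trunc_log ((norm (y - x))\<^sup>2 / \<rho>) * f y\<bar> \<le> 2 / \<rho> * \<bar>f y\<bar> * \<bar>t - \<rho>\<bar>"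
      if t: "\<bar>t - \<rho>\<bar> < \<rho> / 2" for t y
    proof (cases "y = x")
      case False
      have "norm (trunc_log ((norm (y - x))\<^sup>2 / t) - trunc_log ((norm (y - x))\<^sup>2 / \<rho>)) \<le> 2 / \<rho> * norm (t - \<rho>)"
      proof (rule field_differentiable_bound[of "{\<rho>/2..3*\<rho>/2}" _ "\<lambda>s. chi x s y ^ 7 / s"])
        fix s assume "s \<in> {\<rho>/2..3*\<rho>/2}"
        then have s: "s > 0" "1 / s \<le> 2 / \<rho>" using \<rho> by (auto simp: field_simps)
        show "((\<lambda>t. trunc_log ((norm (y - x))\<^sup>2 / t)) has_real_derivative chi x s y ^ 7 / s) (at s within {\<rho>/2..3*\<rho>/2})"
          using d[OF s(1) False] by (rule DERIV_subset) auto
        have "chi x s y ^ 7 * (1 / s) \<le> 1 * (2 / \<rho>)"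
          using s power_le_one[OF chi_nonneg chi_le_1[OF s(1)]] by (intro mult_mono) auto
        then show "norm (chi x s y ^ 7 / s) \<le> 2 / \<rho>"
          using s chi_nonneg[of x s y] by simp
      qed (use t \<rho> in \<open>auto simp: abs_if field_simps split: if_splits\<close>)
      then have "\<bar>trunc_log ((norm (y - x))\<^sup>2 / t) - trunc_log ((norm (y - x))\<^sup>2 / \<rho>)\<bar> * \<bar>f y\<bar> \<le> 2 / \<rho> * \<bar>t - \<rho>\<bar> * \<bar>f y\<bar>"
        by (intro mult_right_mono) auto
      then show ?thesis unfolding abs_mult[symmetric] left_diff_distrib by (simp only: mult_ac)
    qed (use \<rho> in simp)
    show "integrable lborel (\<lambda>y. trunc_log ((norm (y - x))\<^sup>2 / t) * f y)" if "\<bar>t - \<rho>\<bar> < \<rho> / 2" for t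
      using that \<rho> by (intro integrable_trunc_log f) (auto simp: abs_if split: if_splits)
  qed (use \<rho> f in auto)
  then show ?thesis unfolding log_potential_def ball_moment_def by simp
qed

text \<open>Shrinking \<rho> increases the argument and hence decreases \<open>trunc_log\<close> to
  0, so the kernel at \<rho> = 1 is a majorant.\<close>

lemma log_potential_tendsto_0:
  assumes f: "continuous_on UNIV f"
  shows "((\<lambda>\<rho>. log_potential f x \<rho>) \<longlongrightarrow> 0) (at_right 0)"
proof (rule tendsto_at_right_sequentially[of 0 1])
  fix S :: "nat \<Rightarrow> real" assume S: "\<And>n. 0 < S n" "\<And>n. S n < 1" "S \<longlonglongrightarrow> 0"
  have "(\<lambda>n. log_potential f x (S n)) \<longlonglongrightarrow> (\<integral>y. 0 \<partial>(lborel :: (real^4) measure))"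
    unfolding log_potential_def
  proof (rule integral_dominated_convergence)
    show "integrable lborel (\<lambda>y. norm (trunc_log ((norm (y - x))\<^sup>2 / 1) * f y))"
      by (intro integrable_norm integrable_trunc_log f) auto
    show "(\<lambda>y. trunc_log ((norm (y - x))\<^sup>2 / S n) * f y) \<in> borel_measurable lborel" for n
      using integrable_trunc_log[OF f S(1)] by auto
    show "AE y in lborel. (\<lambda>n. trunc_log ((norm (y - x))\<^sup>2 / S n) * f y) \<longlonglongrightarrow> 0"
      using AE_lborel_neq[of x]
    proof eventually_elim
      case (elim y)
      then have "(norm (y - x))\<^sup>2 > 0" by simp
      from order_tendstoD(2)[OF S(3) this]
      have "\<forall>\<^sub>F n in sequentially. 0 = trunc_log ((norm (y - x))\<^sup>2 / S n) * f y"
      proof eventually_elim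
        case (elim n)
        then have "(norm (y - x))\<^sup>2 / S n \<ge> 1" using S(1)[of n] by simp
        then show ?case by (simp add: trunc_log_eq_0)
      qed
      then show ?case by (rule Lim_transform_eventually[OF tendsto_const])
    qed
    show "AE y in lborel. norm (trunc_log ((norm (y - x))\<^sup>2 / S n) * f y) \<le> norm (trunc_log ((norm (y - x))\<^sup>2 / 1) * f y)" for n
      using AE_lborel_neq[of x]
    proof eventually_elim
      case (elim y)
      let ?s = "(norm (y - x))\<^sup>2"
      have s: "?s > 0" using elim by simp
      have "?s * S n \<le> ?s * 1" using s S(2)[of n] by (intro mult_left_mono) auto
      then have "?s \<le> ?s / S n" using S(1)[of n] by (simp add: pos_le_divide_eq)
      then have "trunc_log (?s / S n) \<le> trunc_log (?s / 1)" using s by (intro trunc_log_antimono) auto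
      moreover have "0 \<le> trunc_log (?s / S n)" using s S(1)[of n] by (intro trunc_log_nonneg) auto
      ultimately show ?case unfolding norm_mult by (intro mult_right_mono) auto
    qed
  qed simp
  then show "(\<lambda>n. log_potential f x (S n)) \<longlonglongrightarrow> 0" by simp
qed simp

section \<open>Means of Pizzetti type and the representation formula\<close>

locale biharmonic_source =
  fixes u f :: "real^4 \<Rightarrow> real"
  assumes u: "Ck 4 u"
    and bilaplacian: "\<And>x. laplacian (laplacian u) x = f x"
    and f_integrable: "integrable lborel f"
begin

lemma Ck_u: "Ck (Suc (Suc 0)) u" "Ck (Suc (Suc 0)) (laplacian u)"
proof -
  have 4: "Ck (Suc (Suc (Suc (Suc 0)))) u" using u by (simp add: numeral_eq_Suc del: Ck.simps)
  then show "Ck (Suc (Suc 0)) u" using Ck_Suc_mono by blast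
  from 4 show "Ck (Suc (Suc 0)) (laplacian u)" by (rule Ck_laplacian)
qed

lemma bilaplacian': "laplacian (laplacian u) = f"
  using bilaplacian by auto

lemma continuous: "continuous_on UNIV u" "continuous_on UNIV (laplacian u)" "continuous_on UNIV f"
proof -
  show "continuous_on UNIV u" "continuous_on UNIV (laplacian u)"
    using Ck_u Ck_continuous by blast+
  have "Ck 0 (laplacian (laplacian u))" using Ck_u(2) by (rule Ck_laplacian)
  then show "continuous_on UNIV f" by (simp add: bilaplacian')
qed

text \<open>
  The constant \<open>42 / \<pi>^2\<close> makes \<open>avg\<close> a mean: the weight \<open>chi x \<rho> ^ 5\<close> has integral \<open>\<pi>^2 \<rho>^2 / 42\<close>.
  The combination \<open>bavg = avg - \<rho> davg\<close> eliminates the term linear in \<open>\<rho>\<close>, i.e. the Laplacian at \<open>x\<close>.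
\<close>

definition avg :: "real^4 \<Rightarrow> real \<Rightarrow> real" where
  "avg x \<rho> = 42 / pi\<^sup>2 * (ball_moment 5 u x \<rho> / \<rho>\<^sup>2)"

text \<open>The derivative of \<open>avg\<close>; 7/4 is 42 / (4 * 6), from
  \<open>DERIV_scaled_moment\<close> with k = 5.\<close>

definition davg :: "real^4 \<Rightarrow> real \<Rightarrow> real" where
  "davg x \<rho> = 7 / (4 * pi\<^sup>2) * (ball_moment 6 (laplacian u) x \<rho> / \<rho>\<^sup>2)"

definition bavg :: "real^4 \<Rightarrow> real \<Rightarrow> real" where
  "bavg x \<rho> = 42 / pi\<^sup>2 * ((8 * ball_moment 5 u x \<rho> - 5 * ball_moment 4 u x \<rho>) / \<rho>\<^sup>2)"

text \<open>Dividing by \<rho>^2, the order of the mass of the weight, turns the derivative into k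
  M(k-1) - (k+2) M(k) over \<rho>^3, where M(j) is the moment of exponent j. This is the combination
  that \<open>ball_moment_laplacian\<close> produces for exponent k + 1.\<close>

lemma DERIV_scaled_moment:
  assumes w: "Ck (Suc (Suc 0)) w" and \<rho>: "\<rho> > 0" and k: "k \<ge> 2"
  shows "((\<lambda>\<rho>. ball_moment k w x \<rho> / \<rho>\<^sup>2) has_real_derivative
    ball_moment (Suc k) (laplacian w) x \<rho> / (4 * (real k + 1) * \<rho>\<^sup>2)) (at \<rho>)"
proof -
  let ?M = "ball_moment k w x \<rho>" and ?N = "ball_moment (k - 1) w x \<rho>"
  have "((\<lambda>\<rho>. ball_moment k w x \<rho> / \<rho>\<^sup>2) has_real_derivative
      (real k / \<rho> * (?N - ?M) * \<rho>\<^sup>2 - ?M * (2 * \<rho>)) / (\<rho>\<^sup>2 * \<rho>\<^sup>2)) (at \<rho>)"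
    by (rule DERIV_divide[OF DERIV_ball_moment[OF Ck_continuous[OF w] \<rho> k]])
       (use \<rho> in \<open>auto intro!: derivative_eq_intros\<close>)
  moreover have "(real k / \<rho> * (?N - ?M) * \<rho>\<^sup>2 - ?M * (2 * \<rho>)) / (\<rho>\<^sup>2 * \<rho>\<^sup>2) =
     ball_moment (Suc k) (laplacian w) x \<rho> / (4 * (real k + 1) * \<rho>\<^sup>2)"
  proof -
    have "ball_moment (Suc k) (laplacian w) x \<rho> = 4 * (real k + 1) / \<rho> * (real k * ?N - (real k + 2) * ?M)"
      using ball_moment_laplacian[OF w \<rho>, of "Suc k" x] k by (simp add: add_ac)
    then have "ball_moment (Suc k) (laplacian w) x \<rho> / (4 * (real k + 1) * \<rho>\<^sup>2) =
      (real k * ?N - (real k + 2) * ?M) / \<rho> ^ 3"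
      using \<rho> by (simp add: power2_eq_square power3_eq_cube)
    also have "\<dots> = (real k / \<rho> * (?N - ?M) * \<rho>\<^sup>2 - ?M * (2 * \<rho>)) / (\<rho>\<^sup>2 * \<rho>\<^sup>2)"
      using \<rho> by (simp add: field_simps power2_eq_square power3_eq_cube)
    finally show ?thesis by simp
  qed
  ultimately show ?thesis by simp
qed

lemma DERIV_avg: "\<rho> > 0 \<Longrightarrow> (avg x has_real_derivative davg x \<rho>) (at \<rho>)"
  unfolding avg_def[abs_def] davg_def
  by (rule DERIV_cong[OF DERIV_cmult[OF DERIV_scaled_moment[OF Ck_u(1), of \<rho> 5]]]) simp_all

text \<open>The constant 16 pi^2 of the representation formula originates here: 7/4 divided by 4 * 7
  is 1/16.\<close>

lemma DERIV_davg: "\<rho> > 0 \<Longrightarrow> (davg x has_real_derivative ball_moment 7 f x \<rho> / (16 * pi\<^sup>2 * \<rho>\<^sup>2)) (at \<rho>)"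
  unfolding davg_def[abs_def]
  by (rule DERIV_cong[OF DERIV_cmult[OF DERIV_scaled_moment[OF Ck_u(2), of \<rho> 6]]]) (simp_all add: bilaplacian')

text \<open>With k = 6, \<open>ball_moment_laplacian\<close> removes the Laplacian from
  \<open>davg\<close>: \<rho> times \<open>davg\<close> is 42/pi^2 times (5 M(4) - 7 M(5)) /
  \<rho>^2, with M(j) the moment of \<open>u\<close> of exponent j. Hence the coefficients 8 = 1 + 7
  and 5 in \<open>bavg\<close>.\<close>

lemma bavg_eq:
  assumes "\<rho> > 0"
  shows "bavg x \<rho> = avg x \<rho> - \<rho> * davg x \<rho>"
proof -
  have "ball_moment 6 (laplacian u) x \<rho> = 24 / \<rho> * (5 * ball_moment 4 u x \<rho> - 7 * ball_moment 5 u x \<rho>)"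
    using ball_moment_laplacian[OF Ck_u(1) assms, of 6 x] by simp
  then have "davg x \<rho> = 42 / pi\<^sup>2 * ((5 * ball_moment 4 u x \<rho> - 7 * ball_moment 5 u x \<rho>) / \<rho> ^ 3)"
    using assms by (simp add: davg_def power2_eq_square power3_eq_cube) (simp add: field_simps)
  then show ?thesis using assms
    by (simp add: bavg_def avg_def field_simps power2_eq_square power3_eq_cube)
qed

text \<open>The derivative of \<open>bavg\<close> is -\<rho> times that of \<open>davg\<close>, and
  \<open>DERIV_log_potential\<close> cancels it exactly, so the right-hand side is constant in
  \<rho>. Its limit as \<rho> \<rightarrow> 0 is \<open>u x\<close> because 42 (8/42 - 5/30) =
  1.\<close>

lemma representation:
  assumes \<rho>: "\<rho> > 0"
  shows "u x = bavg x \<rho> + log_potential f x \<rho> / (16 * pi\<^sup>2)"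
proof -
  let ?\<phi> = "\<lambda>\<rho>. bavg x \<rho> + log_potential f x \<rho> / (16 * pi\<^sup>2)"
  have "(?\<phi> has_real_derivative 0) (at t)" if t: "t > 0" for t
  proof -
    have "((\<lambda>\<rho>. avg x \<rho> - \<rho> * davg x \<rho> + log_potential f x \<rho> / (16 * pi\<^sup>2)) has_real_derivative
        davg x t - (1 * davg x t + ball_moment 7 f x t / (16 * pi\<^sup>2 * t\<^sup>2) * t) + ball_moment 7 f x t / t / (16 * pi\<^sup>2)) (at t)"
      by (intro DERIV_add DERIV_diff DERIV_mult DERIV_cdivide DERIV_ident DERIV_avg DERIV_davg t
          DERIV_log_potential continuous f_integrable)
    then have "(?\<phi> has_real_derivative davg x t - (1 * davg x t + ball_moment 7 f x t / (16 * pi\<^sup>2 * t\<^sup>2) * t) + ball_moment 7 f x t / t / (16 * pi\<^sup>2)) (at t)"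
      by (rule has_field_derivative_transform_within_open[where S = "{0<..}"])
         (use t in \<open>auto simp: bavg_eq\<close>)
    then show ?thesis
      by (rule DERIV_cong) (use t in \<open>simp add: power2_eq_square\<close>)
  qed
  then have "\<exists>c. \<forall>t\<in>{0<..}. ?\<phi> t = c"
    by (intro has_field_derivative_zero_constant) (auto intro: DERIV_subset)
  then obtain c where c: "\<And>t. t > 0 \<Longrightarrow> ?\<phi> t = c" by auto
  have "((\<lambda>\<rho>. 42 / pi\<^sup>2 * (8 * (ball_moment (Suc 4) u x \<rho> / \<rho>\<^sup>2) - 5 * (ball_moment (Suc 3) u x \<rho> / \<rho>\<^sup>2))
       + log_potential f x \<rho> / (16 * pi\<^sup>2)) \<longlongrightarrow>
     42 / pi\<^sup>2 * (8 * (u x * pi\<^sup>2 / ((real 4 + 2) * (real 4 + 3))) - 5 * (u x * pi\<^sup>2 / ((real 3 + 2) * (real 3 + 3))))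
       + 0 / (16 * pi\<^sup>2)) (at_right 0)"
    by (intro tendsto_intros ball_moment_tendsto continuous log_potential_tendsto_0) auto
  also have "(\<lambda>\<rho>. 42 / pi\<^sup>2 * (8 * (ball_moment (Suc 4) u x \<rho> / \<rho>\<^sup>2) - 5 * (ball_moment (Suc 3) u x \<rho> / \<rho>\<^sup>2))
       + log_potential f x \<rho> / (16 * pi\<^sup>2)) = ?\<phi>"
    by (simp add: bavg_def diff_divide_distrib fun_eq_iff)
  also have "42 / pi\<^sup>2 * (8 * (u x * pi\<^sup>2 / ((real 4 + 2) * (real 4 + 3))) - 5 * (u x * pi\<^sup>2 / ((real 3 + 2) * (real 3 + 3))))
       + 0 / (16 * pi\<^sup>2) = u x"
    by (simp add: field_simps)
  finally have "(?\<phi> \<longlongrightarrow> u x) (at_right 0)" .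
  moreover have "(?\<phi> \<longlongrightarrow> c) (at_right 0)"
    by (rule Lim_transform_eventually[OF tendsto_const])
       (auto simp: eventually_at_right_field c intro!: exI[of _ 1])
  ultimately have "u x = c" by (intro tendsto_unique[of "at_right 0"]) auto
  then show ?thesis using c[OF \<rho>] by simp
qed

text \<open>The derivative of \<open>davg\<close> is at most K/\<rho>^2 in modulus, which is
  integrable at infinity; so \<open>davg\<close> is bounded below on [1, \<infinity>) and
  \<open>avg\<close> decreases at most linearly.\<close>

lemma avg_lower_bound:
  obtains C where "C \<ge> 0" "\<And>\<rho>. \<rho> \<ge> 1 \<Longrightarrow> avg x \<rho> \<ge> - C * \<rho>"
proof -
  define K where "K = (\<integral>y. \<bar>f y\<bar> \<partial>lborel) / (16 * pi\<^sup>2)"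
  have K: "K \<ge> 0" by (simp add: K_def)
  have b: "\<bar>ball_moment 7 f x t / (16 * pi\<^sup>2 * t\<^sup>2)\<bar> \<le> K / t\<^sup>2" if t: "t > 0" for t
  proof -
    have "\<bar>ball_moment 7 f x t\<bar> \<le> (\<integral>y. \<bar>f y\<bar> \<partial>lborel)"
      unfolding ball_moment_def
    proof (rule Bochner_Integration.integral_abs_bound_integral)
      show "integrable lborel (\<lambda>y. chi x t y ^ 7 * f y)" by (intro integrable_chi_power continuous t) auto
      fix y
      have "chi x t y ^ 7 * \<bar>f y\<bar> \<le> 1 * \<bar>f y\<bar>"
        by (intro mult_right_mono power_le_one chi_nonneg chi_le_1 t) auto
      then show "\<bar>chi x t y ^ 7 * f y\<bar> \<le> \<bar>f y\<bar>" using chi_nonneg[of x t y] by (simp add: abs_mult)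
    qed (use f_integrable in auto)
    then show ?thesis using t by (simp add: K_def abs_mult divide_simps)
  qed
  define C where "C = K + \<bar>davg x 1\<bar> + \<bar>avg x 1\<bar>"
  have d: "davg x \<rho> \<ge> - (K + \<bar>davg x 1\<bar>)" if \<rho>: "\<rho> \<ge> 1" for \<rho>
  proof -
    have "davg x 1 - K / 1 \<le> davg x \<rho> - K / \<rho>"
    proof (rule DERIV_nonneg_imp_nondecreasing[OF \<rho>])
      fix t assume "1 \<le> t" "t \<le> \<rho>"
      then have t: "t > 0" by simp
      have "((\<lambda>t. davg x t - K / t) has_real_derivative ball_moment 7 f x t / (16 * pi\<^sup>2 * t\<^sup>2) - (- K / t\<^sup>2)) (at t)"
        by (intro DERIV_diff DERIV_davg t) (use t in \<open>auto intro!: derivative_eq_intros simp: power2_eq_square\<close>)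
      then show "\<exists>y. ((\<lambda>t. davg x t - K / t) has_real_derivative y) (at t) \<and> 0 \<le> y"
        using b[OF t] unfolding abs_le_iff by (intro exI conjI) auto
    qed
    moreover have "K / \<rho> \<ge> 0" using K \<rho> by simp
    ultimately show ?thesis by simp
  qed
  have "avg x \<rho> \<ge> - C * \<rho>" if \<rho>: "\<rho> \<ge> 1" for \<rho>
  proof -
    let ?D = "K + \<bar>davg x 1\<bar>"
    have "avg x 1 + ?D * 1 \<le> avg x \<rho> + ?D * \<rho>"
    proof (rule DERIV_nonneg_imp_nondecreasing[OF \<rho>])
      fix t assume t: "1 \<le> t" "t \<le> \<rho>"
      have "((\<lambda>t. avg x t + ?D * t) has_real_derivative davg x t + ?D * 1) (at t)"
        by (intro DERIV_add DERIV_avg DERIV_cmult DERIV_ident) (use t in auto)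
      then show "\<exists>y. ((\<lambda>t. avg x t + ?D * t) has_real_derivative y) (at t) \<and> 0 \<le> y"
        using d[of t] t by (intro exI conjI) auto
    qed
    moreover have "\<bar>avg x 1\<bar> * 1 \<le> \<bar>avg x 1\<bar> * \<rho>" using \<rho> by (intro mult_left_mono) auto
    ultimately show ?thesis using K unfolding C_def by (simp add: algebra_simps)
  qed
  then show ?thesis using that[of C] K by (simp add: C_def)
qed

end

section \<open>The logarithmic potential\<close>

text \<open>The singularities cancel: \<open>smooth_log \<tau> s\<close> stays within a constant of \<open>ln (\<tau> + s)\<close>.\<close>

definition smooth_log :: "real \<Rightarrow> real \<Rightarrow> real" where
  "smooth_log \<tau> s = ln s + trunc_log (s / \<tau>)"

text \<open>The 4 consists of 3, the bound for \<open>log_poly\<close> on [0, 1], and 1, a bound for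
  ln 2.\<close>

lemma smooth_log_bounds:
  assumes "\<tau> > 0" "s > 0"
  shows "ln (\<tau> + s) - 4 \<le> smooth_log \<tau> s" "smooth_log \<tau> s \<le> ln (\<tau> + s)"
proof -
  have l2: "ln (2 * a) \<le> 1 + ln a" if "a > 0" for a :: real
    using that ln_le_minus_one[of 2] by (simp add: ln_mult)
  have "ln (\<tau> + s) - 4 \<le> smooth_log \<tau> s \<and> smooth_log \<tau> s \<le> ln (\<tau> + s)"
  proof (cases "s < \<tau>")
    case True
    then have 1: "smooth_log \<tau> s = ln \<tau> - log_poly (s / \<tau>)"
      using assms by (simp add: smooth_log_def trunc_log_def ln_div)
    have "ln (\<tau> + s) \<le> ln (2 * \<tau>)" "ln \<tau> \<le> ln (\<tau> + s)" using assms True by auto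
    moreover have "0 \<le> log_poly (s / \<tau>)" "log_poly (s / \<tau>) \<le> 3"
      using log_poly_bounds[of "s / \<tau>"] assms True by auto
    ultimately show ?thesis using 1 l2[OF assms(1)] by linarith
  next
    case False
    then have 1: "smooth_log \<tau> s = ln s"
      using assms by (simp add: smooth_log_def trunc_log_eq_0)
    have "ln (\<tau> + s) \<le> ln (2 * s)" "ln s \<le> ln (\<tau> + s)" using assms False by auto
    then show ?thesis using 1 l2[OF assms(2)] by linarith
  qed
  then show "ln (\<tau> + s) - 4 \<le> smooth_log \<tau> s" "smooth_log \<tau> s \<le> ln (\<tau> + s)" by auto
qed

lemma norm_sq_add_le:
  fixes a b :: "'a::real_inner"
  shows "(norm (a + b))\<^sup>2 \<le> 2 * (norm a)\<^sup>2 + 2 * (norm b)\<^sup>2"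
proof -
  have "(norm (a + b))\<^sup>2 + (norm (a - b))\<^sup>2 = 2 * (norm a)\<^sup>2 + 2 * (norm b)\<^sup>2"
    unfolding power2_norm_eq_inner by (simp add: inner_add_left inner_add_right inner_diff_left inner_diff_right)
  then show ?thesis by (metis add_increasing2 le_add_same_cancel1 order.refl zero_le_power2 order_trans)
qed

lemma ln_shift_le:
  fixes a b c \<tau> :: real
  assumes "\<tau> \<ge> 1" "a \<ge> 0" "b \<ge> 0" "c \<ge> 0" "a \<le> 2 * b + 2 * c"
  shows "ln (\<tau> + a) \<le> ln (2 + 2 * c) + ln (\<tau> + b)"
proof -
  have "2 * c * 1 \<le> 2 * c * \<tau>" "0 \<le> 2 * c * b" using assms mult_left_mono[of 1 \<tau> "2 * c"] by auto
  moreover have "(2 + 2 * c) * (\<tau> + b) = 2 * \<tau> + 2 * b + 2 * c * \<tau> + 2 * c * b" by (simp add: algebra_simps)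
  ultimately have "\<tau> + a \<le> (2 + 2 * c) * (\<tau> + b)" using assms by linarith
  then have "ln (\<tau> + a) \<le> ln ((2 + 2 * c) * (\<tau> + b))" using assms by simp
  also have "\<dots> = ln (2 + 2 * c) + ln (\<tau> + b)" using assms by (intro ln_mult_pos) auto
  finally show ?thesis .
qed

text \<open>Moving the centre changes \<tau> plus the squared distance by a factor of at most 2 + 2
  |x|^2. Being uniform in \<open>y\<close> and \<tau>, the bound serves for domination as \<tau>
  \<rightarrow> \<infinity>.\<close>

lemma ln_shift_norm:
  fixes x y :: "'a::real_inner"
  assumes "\<tau> \<ge> 1"
  shows "\<bar>ln (\<tau> + (norm y)\<^sup>2) - ln (\<tau> + (norm (y - x))\<^sup>2)\<bar> \<le> ln (2 + 2 * (norm x)\<^sup>2)"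
proof -
  have "(norm (y - x))\<^sup>2 \<le> 2 * (norm y)\<^sup>2 + 2 * (norm x)\<^sup>2" using norm_sq_add_le[of y "-x"] by simp
  moreover have "(norm y)\<^sup>2 \<le> 2 * (norm (y - x))\<^sup>2 + 2 * (norm x)\<^sup>2" using norm_sq_add_le[of "y - x" x] by simp
  ultimately show ?thesis
    using ln_shift_le[OF assms, of "(norm (y - x))\<^sup>2" "(norm y)\<^sup>2" "(norm x)\<^sup>2"]
      ln_shift_le[OF assms, of "(norm y)\<^sup>2" "(norm (y - x))\<^sup>2" "(norm x)\<^sup>2"]
    by (simp add: abs_le_iff)
qed

lemma two_ln_norm_ratio:
  fixes x y :: "'a::real_normed_vector"
  assumes "y \<noteq> 0" "y \<noteq> x"
  shows "2 * ln (norm y / norm (x - y)) = ln ((norm y)\<^sup>2) - ln ((norm (y - x))\<^sup>2)"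
  using assms by (simp add: ln_div ln_realpow norm_minus_commute)

text \<open>Twice the kernel of \<open>v\<close>, with the truncated logarithms centred at 0 and at
  \<open>x\<close> used to cancel its two singularities; see \<open>kernel_split\<close>.\<close>

definition kernel_diff :: "real^4 \<Rightarrow> real \<Rightarrow> real^4 \<Rightarrow> real" where
  "kernel_diff x \<tau> y = smooth_log \<tau> ((norm y)\<^sup>2) - smooth_log \<tau> ((norm (y - x))\<^sup>2)"

lemma kernel_diff_measurable [measurable]: "kernel_diff x \<tau> \<in> borel_measurable borel"
  unfolding kernel_diff_def[abs_def] smooth_log_def by measurable

lemma kernel_diff_bound:
  assumes "\<tau> \<ge> 1" "y \<noteq> 0" "y \<noteq> x"
  shows "\<bar>kernel_diff x \<tau> y\<bar> \<le> 4 + ln (2 + 2 * (norm x)\<^sup>2)"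
  using smooth_log_bounds[of \<tau> "(norm y)\<^sup>2"] smooth_log_bounds[of \<tau> "(norm (y - x))\<^sup>2"]
    ln_shift_norm[OF assms(1), of y x] assms unfolding kernel_diff_def abs_le_iff by auto

text \<open>Once \<tau> exceeds both squared distances, \<open>smooth_log \<tau> s\<close> is ln
  \<tau> - log_poly (s/\<tau>); the ln \<tau> cancels and both arguments tend to 0.\<close>

lemma kernel_diff_tendsto:
  assumes "y \<noteq> 0" "y \<noteq> x"
  shows "((\<lambda>\<tau>. kernel_diff x \<tau> y) \<longlongrightarrow> 0) at_top"
proof -
  have c: "isCont log_poly 0" unfolding log_poly_def[abs_def] by (auto intro!: continuous_intros)
  have l: "((\<lambda>\<tau>. log_poly (a / \<tau>)) \<longlongrightarrow> log_poly 0) at_top" for a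
    by (rule isCont_tendsto_compose[OF c]) (intro tendsto_divide_0[OF tendsto_const] filterlim_at_top_imp_at_infinity filterlim_ident)
  have "((\<lambda>\<tau>. log_poly ((norm (y - x))\<^sup>2 / \<tau>) - log_poly ((norm y)\<^sup>2 / \<tau>)) \<longlongrightarrow> log_poly 0 - log_poly 0) at_top"
    by (intro tendsto_diff l)
  then have "((\<lambda>\<tau>. log_poly ((norm (y - x))\<^sup>2 / \<tau>) - log_poly ((norm y)\<^sup>2 / \<tau>)) \<longlongrightarrow> 0) at_top" by simp
  then show ?thesis
  proof (rule Lim_transform_eventually)
    show "\<forall>\<^sub>F \<tau> in at_top. log_poly ((norm (y - x))\<^sup>2 / \<tau>) - log_poly ((norm y)\<^sup>2 / \<tau>) = kernel_diff x \<tau> y"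
      using eventually_gt_at_top[of "(norm y)\<^sup>2"] eventually_gt_at_top[of "(norm (y - x))\<^sup>2"] eventually_gt_at_top[of 0]
    proof eventually_elim
      case (elim \<tau>)
      then show ?case using assms by (simp add: kernel_diff_def smooth_log_def trunc_log_def ln_div)
    qed
  qed
qed

definition normalized_potential :: "(real^4 \<Rightarrow> real) \<Rightarrow> real^4 \<Rightarrow> real" where
  "normalized_potential f x = 1 / (8 * pi\<^sup>2) * (\<integral>y. ln (norm y / norm (x - y)) * f y \<partial>lborel)"

lemma integrable_bounded_mult:
  fixes f g :: "'a \<Rightarrow> real"
  assumes "integrable M f" "g \<in> borel_measurable M" "AE y in M. \<bar>g y\<bar> \<le> C"
  shows "integrable M (\<lambda>y. g y * f y)"
proof (rule Bochner_Integration.integrable_bound)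
  show "integrable M (\<lambda>y. C * f y)" using assms(1) by simp
  show "AE y in M. norm (g y * f y) \<le> norm (C * f y)"
    using assms(3) by eventually_elim (auto simp: abs_mult intro!: mult_right_mono)
qed (use assms in measurable)

context biharmonic_source
begin

abbreviation "v \<equiv> normalized_potential f"

lemma f_measurable [measurable]: "f \<in> borel_measurable borel"
  using borel_measurable_integrable[OF f_integrable] by simp

lemma integrable_kernel_diff:
  assumes "\<tau> \<ge> 1"
  shows "integrable lborel (\<lambda>y. kernel_diff x \<tau> y * f y)"
proof (rule integrable_bounded_mult[OF f_integrable])
  show "AE y in lborel. \<bar>kernel_diff x \<tau> y\<bar> \<le> 4 + ln (2 + 2 * (norm x)\<^sup>2)"
    using AE_lborel_neq[of x] AE_lborel_neq[of 0]
    by eventually_elim (rule kernel_diff_bound[OF assms])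
qed simp

lemma kernel_split:
  assumes "\<tau> > 0" "y \<noteq> 0" "y \<noteq> x"
  shows "ln (norm y / norm (x - y)) * f y = 1 / 2 * (kernel_diff x \<tau> y * f y
     - trunc_log ((norm (y - 0))\<^sup>2 / \<tau>) * f y + trunc_log ((norm (y - x))\<^sup>2 / \<tau>) * f y)"
proof -
  have "ln (norm y / norm (x - y)) = 1 / 2 * (kernel_diff x \<tau> y
     - trunc_log ((norm (y - 0))\<^sup>2 / \<tau>) + trunc_log ((norm (y - x))\<^sup>2 / \<tau>))"
    using two_ln_norm_ratio[OF assms(2,3)] by (simp add: kernel_diff_def smooth_log_def)
  then show ?thesis by (simp only: distrib_right left_diff_distrib mult.assoc)
qed

lemma integrable_kernel: "integrable lborel (\<lambda>y. ln (norm y / norm (x - y)) * f y)"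
proof -
  let ?g = "\<lambda>y. 1 / 2 * (kernel_diff x 1 y * f y
     - trunc_log ((norm (y - 0))\<^sup>2 / 1) * f y + trunc_log ((norm (y - x))\<^sup>2 / 1) * f y)"
  have "integrable lborel ?g"
    by (intro integrable_mult_right Bochner_Integration.integrable_add Bochner_Integration.integrable_diff
        integrable_kernel_diff integrable_trunc_log continuous) auto
  then show ?thesis
  proof (rule integrable_cong_AE_imp)
    show "AE y in lborel. ?g y = ln (norm y / norm (x - y)) * f y"
      using AE_lborel_neq[of x] AE_lborel_neq[of 0]
      by eventually_elim (rule kernel_split[OF zero_less_one, symmetric])
  qed measurable
qed

lemma potential_split:
  assumes \<tau>: "\<tau> \<ge> 1"
  shows "16 * pi\<^sup>2 * v x = (\<integral>y. kernel_diff x \<tau> y * f y \<partial>lborel) - log_potential f 0 \<tau> + log_potential f x \<tau>"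
proof -
  have i: "integrable lborel (\<lambda>y. kernel_diff x \<tau> y * f y)"
    "integrable lborel (\<lambda>y. trunc_log ((norm (y - 0))\<^sup>2 / \<tau>) * f y)"
    "integrable lborel (\<lambda>y. trunc_log ((norm (y - x))\<^sup>2 / \<tau>) * f y)"
    using \<tau> by (auto intro!: integrable_kernel_diff integrable_trunc_log[where x = 0, simplified]
       integrable_trunc_log continuous)
  have "(\<integral>y. ln (norm y / norm (x - y)) * f y \<partial>lborel) = (\<integral>y. 1 / 2 * (kernel_diff x \<tau> y * f y
     - trunc_log ((norm (y - 0))\<^sup>2 / \<tau>) * f y + trunc_log ((norm (y - x))\<^sup>2 / \<tau>) * f y) \<partial>lborel)"
  proof (rule integral_cong_AE)
    show "AE y in lborel. ln (norm y / norm (x - y)) * f y = 1 / 2 * (kernel_diff x \<tau> y * f y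
     - trunc_log ((norm (y - 0))\<^sup>2 / \<tau>) * f y + trunc_log ((norm (y - x))\<^sup>2 / \<tau>) * f y)"
      using AE_lborel_neq[of x] AE_lborel_neq[of 0]
      by eventually_elim (rule kernel_split, use \<tau> in auto)
  qed measurable
  also have "\<dots> = 1 / 2 * ((\<integral>y. kernel_diff x \<tau> y * f y \<partial>lborel) - log_potential f 0 \<tau> + log_potential f x \<tau>)"
    unfolding log_potential_def integral_mult_right_zero
    using i by (simp only: Bochner_Integration.integral_add Bochner_Integration.integral_diff Bochner_Integration.integrable_diff)
  finally show ?thesis by (simp add: normalized_potential_def)
qed

text \<open>The representation formulas at \<open>x\<close> and at 0 are subtracted, and
  \<open>potential_split\<close> replaces the difference of the potentials by \<open>v x\<close> and
  an error governed by \<open>kernel_diff\<close>.\<close>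

lemma bavg_minus_bavg_0:
  assumes "\<tau> \<ge> 1"
  shows "bavg x \<tau> - bavg 0 \<tau> = u x - v x - u 0 + (\<integral>y. kernel_diff x \<tau> y * f y \<partial>lborel) / (16 * pi\<^sup>2)"
proof -
  have "v x = ((\<integral>y. kernel_diff x \<tau> y * f y \<partial>lborel) - log_potential f 0 \<tau> + log_potential f x \<tau>) / (16 * pi\<^sup>2)"
    using potential_split[OF assms, of x] by (simp add: field_simps)
  moreover have "u x = bavg x \<tau> + log_potential f x \<tau> / (16 * pi\<^sup>2)" "u 0 = bavg 0 \<tau> + log_potential f 0 \<tau> / (16 * pi\<^sup>2)"
    using representation assms by auto
  ultimately show ?thesis by (simp add: add_divide_distrib diff_divide_distrib)
qed

lemma bavg_diff_tendsto: "((\<lambda>\<tau>. bavg x \<tau> - bavg 0 \<tau>) \<longlongrightarrow> u x - v x - u 0) at_top"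
proof -
  \<comment> \<open>The kernel bound holds for scales at least 1; \<open>max 1 \<tau>\<close> makes
    it available for every \<tau> without changing the limit.\<close>
  let ?m = "\<lambda>\<tau>::real. max 1 \<tau>"
  have mf: "filterlim ?m at_top at_top"
    unfolding filterlim_at_top
    by (intro allI eventually_mono[OF eventually_ge_at_top]) (auto intro: max.coboundedI2)
  have "((\<lambda>\<tau>. \<integral>y. kernel_diff x (?m \<tau>) y * f y \<partial>lborel) \<longlongrightarrow> (\<integral>y. 0 \<partial>(lborel :: (real^4) measure))) at_top"
  proof (rule integral_dominated_convergence_at_top)
    show "integrable lborel (\<lambda>y. (4 + ln (2 + 2 * (norm x)\<^sup>2)) * \<bar>f y\<bar>)" using f_integrable by simp
    show "\<forall>\<^sub>F \<tau> in at_top. AE y in lborel. norm (kernel_diff x (?m \<tau>) y * f y) \<le> (4 + ln (2 + 2 * (norm x)\<^sup>2)) * \<bar>f y\<bar>"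
    proof (rule always_eventually, rule allI)
      fix \<tau>
      show "AE y in lborel. norm (kernel_diff x (?m \<tau>) y * f y) \<le> (4 + ln (2 + 2 * (norm x)\<^sup>2)) * \<bar>f y\<bar>"
        using AE_lborel_neq[of x] AE_lborel_neq[of 0]
      proof eventually_elim
        case (elim y)
        then show ?case using kernel_diff_bound[of "?m \<tau>" y x] by (auto simp: abs_mult intro!: mult_right_mono)
      qed
    qed
    show "AE y in lborel. ((\<lambda>\<tau>. kernel_diff x (?m \<tau>) y * f y) \<longlongrightarrow> 0) at_top"
      using AE_lborel_neq[of x] AE_lborel_neq[of 0]
    proof eventually_elim
      case (elim y)
      have "((\<lambda>\<tau>. kernel_diff x (?m \<tau>) y * f y) \<longlongrightarrow> 0 * f y) at_top"
        using elim by (intro tendsto_mult tendsto_const filterlim_compose[OF kernel_diff_tendsto mf]) auto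
      then show ?case by simp
    qed
  qed auto
  then have "((\<lambda>\<tau>. u x - v x - u 0 + (\<integral>y. kernel_diff x (?m \<tau>) y * f y \<partial>lborel) / (16 * pi\<^sup>2)) \<longlongrightarrow> u x - v x - u 0 + 0 / (16 * pi\<^sup>2)) at_top"
    by (intro tendsto_intros) auto
  then have "((\<lambda>\<tau>. u x - v x - u 0 + (\<integral>y. kernel_diff x (?m \<tau>) y * f y \<partial>lborel) / (16 * pi\<^sup>2)) \<longlongrightarrow> u x - v x - u 0) at_top"
    by simp
  then show ?thesis
    by (rule Lim_transform_eventually)
       (auto simp: bavg_minus_bavg_0 max_def intro!: eventually_mono[OF eventually_ge_at_top[of 1]])
qed

end

section \<open>Growth of the mass of |u| on balls\<close>

locale conformal_biharmonic = biharmonic_source +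
  assumes exp_integrable: "integrable lborel (\<lambda>y. exp (4 * u y))"
begin

text \<open>Since |u| is twice the positive part minus u, and the positive part is at most exp (4
  u), a lower bound for the means of \<open>u\<close> suffices. The power r^6 is \<rho>^3: mass
  \<rho>^2 of the weight times the linear bound of \<open>avg_lower_bound\<close>.\<close>

lemma integral_abs_u_bound:
  obtains C where "C \<ge> 0" "\<And>r. r \<ge> 1 \<Longrightarrow> (\<integral>y. indicator (cball 0 r) y * \<bar>u y\<bar> \<partial>lborel) \<le> C * r ^ 6"
proof -
  obtain c where c: "c \<ge> 0" "\<And>\<rho>. \<rho> \<ge> 1 \<Longrightarrow> avg 0 \<rho> \<ge> - c * \<rho>" using avg_lower_bound[of 0] by metis
  define E where "E = (\<integral>y. exp (4 * u y) \<partial>lborel)"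
  have E: "E \<ge> 0" by (simp add: E_def)
  have u_le: "u y \<le> exp (4 * u y)" for y
    using exp_ge_add_one_self[of "4 * u y"] exp_gt_zero[of "4 * u y"] by linarith
  define C where "C = 32 * (2 * E + pi\<^sup>2 / 42 * (8 * c))"
  have "(\<integral>y. indicator (cball 0 r) y * \<bar>u y\<bar> \<partial>lborel) \<le> C * r ^ 6" if r: "r \<ge> 1" for r
  proof -
    \<comment> \<open>This choice makes the weight at least 1/2 on the ball of radius
      \<open>r\<close>, so its fifth power is at least 1/32, whence the factor 32; the 8 in
      \<open>C\<close> comes from \<rho>^3 = 8 r^6.\<close>
    define \<rho> where "\<rho> = 2 * r\<^sup>2"
    have r2: "r\<^sup>2 \<ge> 1" using r by simp
    have \<rho>: "\<rho> > 0" "\<rho> \<ge> 1" using r2 by (auto simp: \<rho>_def)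
    have i1: "integrable lborel (\<lambda>y. chi 0 \<rho> y ^ 5 * u y)" "integrable lborel (\<lambda>y. chi 0 \<rho> y ^ 5 * \<bar>u y\<bar>)"
      using \<rho> by (auto intro!: integrable_chi_power continuous_intros continuous)
    have pt: "chi 0 \<rho> y ^ 5 * \<bar>u y\<bar> \<le> 2 * exp (4 * u y) - chi 0 \<rho> y ^ 5 * u y" for y
    proof -
      have k: "0 \<le> chi 0 \<rho> y ^ 5" "chi 0 \<rho> y ^ 5 \<le> 1"
        using chi_nonneg power_le_one[OF chi_nonneg chi_le_1[OF \<rho>(1)]] by auto
      have "chi 0 \<rho> y ^ 5 * (\<bar>u y\<bar> + u y) \<le> 1 * (2 * exp (4 * u y))"
        using u_le[of y] k by (intro mult_mono) (auto simp: abs_if)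
      then show ?thesis by (simp add: algebra_simps)
    qed
    have m: "ball_moment 5 u 0 \<rho> \<ge> - (pi\<^sup>2 / 42 * (8 * c)) * r ^ 6"
    proof -
      have "42 / pi\<^sup>2 * (ball_moment 5 u 0 \<rho> / \<rho>\<^sup>2) \<ge> - c * \<rho>" using c(2)[OF \<rho>(2)] by (simp add: avg_def)
      then have "pi\<^sup>2 / 42 * \<rho>\<^sup>2 * (42 / pi\<^sup>2 * (ball_moment 5 u 0 \<rho> / \<rho>\<^sup>2)) \<ge> pi\<^sup>2 / 42 * \<rho>\<^sup>2 * (- c * \<rho>)"
        by (intro mult_left_mono) auto
      moreover have "pi\<^sup>2 / 42 * \<rho>\<^sup>2 * (42 / pi\<^sup>2 * (ball_moment 5 u 0 \<rho> / \<rho>\<^sup>2)) = ball_moment 5 u 0 \<rho>"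
        using \<rho> by simp
      moreover have "pi\<^sup>2 / 42 * \<rho>\<^sup>2 * (- c * \<rho>) = - (pi\<^sup>2 / 42 * (8 * c)) * r ^ 6"
        by (simp add: \<rho>_def power2_eq_square eval_nat_numeral)
      ultimately show ?thesis by linarith
    qed
    have "(\<integral>y. indicator (cball 0 r) y * \<bar>u y\<bar> \<partial>lborel) \<le> (\<integral>y. 32 * (chi 0 \<rho> y ^ 5 * \<bar>u y\<bar>) \<partial>lborel)"
    proof (rule integral_mono)
      show "integrable lborel (\<lambda>y. indicator (cball 0 r) y * \<bar>u y\<bar>)"
        using borel_integrable_compact[of "cball 0 r" "\<lambda>y. \<bar>u y\<bar>"] continuous_on_subset[OF continuous(1)]
        by (auto intro!: continuous_intros)
      show "integrable lborel (\<lambda>y. 32 * (chi 0 \<rho> y ^ 5 * \<bar>u y\<bar>))" using i1 by simp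
      fix y
      show "indicator (cball 0 r) y * \<bar>u y\<bar> \<le> 32 * (chi 0 \<rho> y ^ 5 * \<bar>u y\<bar>)"
      proof (cases "norm y \<le> r")
        case True
        then have "(norm y)\<^sup>2 \<le> r\<^sup>2" by (intro power_mono) auto
        then have "(norm y)\<^sup>2 / \<rho> \<le> 1 / 2" using r r2 by (simp add: \<rho>_def pos_divide_le_eq)
        then have "1 / 2 \<le> 1 - (norm (y - 0))\<^sup>2 / \<rho>" by simp
        then have "chi 0 \<rho> y \<ge> 1 / 2" unfolding chi_def by linarith
        then have "chi 0 \<rho> y ^ 5 \<ge> (1 / 2) ^ 5" by (intro power_mono) auto
        then have "1 * \<bar>u y\<bar> \<le> (32 * chi 0 \<rho> y ^ 5) * \<bar>u y\<bar>" by (intro mult_right_mono) (auto simp: power_divide)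
        then show ?thesis using True by simp
      next
        case False
        then show ?thesis using chi_nonneg[of 0 \<rho> y] by simp
      qed
    qed
    also have "\<dots> = 32 * (\<integral>y. chi 0 \<rho> y ^ 5 * \<bar>u y\<bar> \<partial>lborel)" by simp
    also have "(\<integral>y. chi 0 \<rho> y ^ 5 * \<bar>u y\<bar> \<partial>lborel) \<le> (\<integral>y. 2 * exp (4 * u y) - chi 0 \<rho> y ^ 5 * u y \<partial>lborel)"
      using i1 exp_integrable pt by (intro integral_mono) auto
    also have "\<dots> = 2 * E - ball_moment 5 u 0 \<rho>"
      using i1 exp_integrable by (simp add: E_def ball_moment_def)
    also have "\<dots> \<le> 2 * E * r ^ 6 + pi\<^sup>2 / 42 * (8 * c) * r ^ 6"
      using m mult_left_mono[of 1 "r ^ 6" "2 * E"] E r by simp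
    finally show ?thesis by (simp add: C_def algebra_simps)
  qed
  then show ?thesis using that[of C] E c by (simp add: C_def)
qed

end

section \<open>The difference is a quadratic polynomial\<close>

text \<open>
  A quadratic polynomial is recovered from finitely many of its values; this is what makes the class
  closed under pointwise limits.
\<close>

definition quadfit :: "(real^4 \<Rightarrow> real) \<Rightarrow> real^4 \<Rightarrow> real" where
  "quadfit q x = q 0 + (\<Sum>i\<in>UNIV. (q (axis i 1) - q (- axis i 1)) / 2 * x $ i) +
     (\<Sum>i\<in>UNIV. \<Sum>j\<in>UNIV. (q (axis i 1 + axis j 1) - q (axis i 1) - q (axis j 1) + q 0) / 2 * (x $ i * x $ j))"

lemma inner_matrix_vector_sum:
  fixes A :: "real^'n^'n"
  shows "x \<bullet> (A *v x) = (\<Sum>i\<in>UNIV. \<Sum>j\<in>UNIV. A $ i $ j * (x $ i * x $ j))"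
  by (simp add: inner_vec_def matrix_vector_mult_def sum_distrib_left mult_ac)

lemma poly_deg_le2_quadfit: "poly_deg_le2 (quadfit q)"
proof -
  let ?A = "\<chi> i j. (q (axis i 1 + axis j 1) - q (axis i 1) - q (axis j 1) + q 0) / 2 :: real^4^4"
  let ?b = "\<chi> i. (q (axis i 1) - q (- axis i 1)) / 2 :: real^4"
  have "quadfit q x = x \<bullet> (?A *v x) + ?b \<bullet> x + q 0" for x
    unfolding quadfit_def inner_matrix_vector_sum by (simp add: inner_vec_def)
  then show ?thesis unfolding poly_deg_le2_def by blast
qed

text \<open>Polarisation sees only the symmetric part of \<open>A\<close>, which defines the same
  quadratic form; exchanging the two sums shows this.\<close>

lemma quadfit_poly:
  assumes "poly_deg_le2 q"
  shows "quadfit q x = q x"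
proof -
  obtain A :: "real^4^4" and b :: "real^4" and c where q: "\<And>x. q x = x \<bullet> (A *v x) + b \<bullet> x + c"
    using assms unfolding poly_deg_le2_def by blast
  have e: "axis i 1 \<bullet> (A *v axis j 1) = A $ i $ j" for i j
    by (simp add: inner_axis' matrix_vector_mult_basis column_def)
  have 1: "(q (axis i 1) - q (- axis i 1)) / 2 = b $ i" for i
    unfolding q by (simp add: inner_axis linear_neg[OF matrix_vector_mul_linear])
  have 2: "(q (axis i 1 + axis j 1) - q (axis i 1) - q (axis j 1) + q 0) / 2 = (A $ i $ j + A $ j $ i) / 2" for i j
    unfolding q by (simp add: inner_add_left inner_add_right matrix_vector_right_distrib e)
  have "(\<Sum>i\<in>UNIV. \<Sum>j\<in>UNIV. A $ j $ i * (x $ i * x $ j)) = (\<Sum>j\<in>UNIV. \<Sum>i\<in>UNIV. A $ j $ i * (x $ j * x $ i))"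
    by (subst sum.swap) (simp add: mult_ac)
  then have "(\<Sum>i\<in>UNIV. \<Sum>j\<in>UNIV. (A $ i $ j + A $ j $ i) / 2 * (x $ i * x $ j)) = x \<bullet> (A *v x)"
    unfolding inner_matrix_vector_sum
    by (simp add: add_divide_distrib distrib_right sum.distrib sum_divide_distrib[symmetric])
  then show ?thesis
    unfolding quadfit_def 1 2 by (simp add: q inner_vec_def mult.commute)
qed

lemma quadfit_tendsto:
  assumes "\<And>x. ((\<lambda>t. p t x) \<longlongrightarrow> h x) F"
  shows "((\<lambda>t. quadfit (p t) x) \<longlongrightarrow> quadfit h x) F"
  unfolding quadfit_def by (intro tendsto_intros assms) simp_all

lemma poly_deg_le2_limit:
  assumes lim: "\<And>x. ((\<lambda>t. p t x) \<longlongrightarrow> h x) F" and p: "\<And>t. poly_deg_le2 (p t)" and F: "F \<noteq> bot"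
  shows "poly_deg_le2 h"
proof -
  have "quadfit h x = h x" for x
    by (rule tendsto_unique[OF F quadfit_tendsto[OF lim]]) (simp add: quadfit_poly[OF p] lim)
  then show ?thesis using poly_deg_le2_quadfit[of h] by (simp add: poly_deg_le2_def)
qed

lemma poly_deg_le2_add_const:
  assumes "poly_deg_le2 q"
  shows "poly_deg_le2 (\<lambda>x. q x + d)"
proof -
  obtain A :: "real^4^4" and b :: "real^4" and c where q: "\<And>x. q x = x \<bullet> (A *v x) + b \<bullet> x + c"
    using assms unfolding poly_deg_le2_def by blast
  show ?thesis unfolding poly_deg_le2_def
    by (rule exI[of _ A], rule exI[of _ b], rule exI[of _ "c + d"]) (simp add: q)
qed

text \<open>The summands mirror \<open>quad_kernel\<close> times \<open>u\<close>, grouped by their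
  dependence on \<open>x\<close>; the term with |x|^2 lands on the diagonal of the matrix.\<close>

lemma poly_deg_le2_integral:
  fixes M :: "(real^4) measure"
  assumes a: "integrable M a" and b: "\<And>i. integrable M (\<lambda>y. y $ i * b y)"
    and b': "integrable M b'" and c: "\<And>i j. integrable M (\<lambda>y. y $ i * y $ j * c y)"
  shows "poly_deg_le2 (\<lambda>x. \<integral>y. a y + (x \<bullet> y) * b y + (x \<bullet> x) * b' y + (x \<bullet> y)\<^sup>2 * c y \<partial>M)"
proof -
  let ?A = "\<chi> i j. (\<integral>y. y $ i * y $ j * c y \<partial>M) + (if i = j then \<integral>y. b' y \<partial>M else 0) :: real^4^4"
  let ?b = "\<chi> i. (\<integral>y. y $ i * b y \<partial>M) :: real^4"
  have "(\<integral>y. a y + (x \<bullet> y) * b y + (x \<bullet> x) * b' y + (x \<bullet> y)\<^sup>2 * c y \<partial>M) = x \<bullet> (?A *v x) + ?b \<bullet> x + (\<integral>y. a y \<partial>M)" for x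
  proof -
    have 1: "(x \<bullet> y) * b y = (\<Sum>i\<in>UNIV. x $ i * (y $ i * b y))" for y
      unfolding inner_vec_def sum_distrib_right by (simp add: mult.assoc)
    have 2: "(x \<bullet> y)\<^sup>2 * c y = (\<Sum>i\<in>UNIV. \<Sum>j\<in>UNIV. x $ i * x $ j * (y $ i * y $ j * c y))" for y
    proof -
      have "(x \<bullet> y)\<^sup>2 = (\<Sum>i\<in>UNIV. \<Sum>j\<in>UNIV. (x $ i * y $ i) * (x $ j * y $ j))"
        by (simp only: inner_vec_def power2_eq_square sum_product inner_real_def)
      then show ?thesis by (simp only: sum_distrib_right) (simp only: mult_ac)
    qed
    have i1: "integrable M (\<lambda>y. (x \<bullet> y) * b y)" "integrable M (\<lambda>y. (x \<bullet> y)\<^sup>2 * c y)"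
      unfolding 1 2 using b c by auto
    have "(\<integral>y. a y + (x \<bullet> y) * b y + (x \<bullet> x) * b' y + (x \<bullet> y)\<^sup>2 * c y \<partial>M)
      = (\<integral>y. a y \<partial>M) + (\<integral>y. (x \<bullet> y) * b y \<partial>M) + (x \<bullet> x) * (\<integral>y. b' y \<partial>M) + (\<integral>y. (x \<bullet> y)\<^sup>2 * c y \<partial>M)"
      using a b' i1 by simp
    also have "(\<integral>y. (x \<bullet> y) * b y \<partial>M) = ?b \<bullet> x"
      unfolding 1 using b by (subst Bochner_Integration.integral_sum) (auto simp: inner_vec_def mult.commute)
    also have "(\<integral>y. (x \<bullet> y)\<^sup>2 * c y \<partial>M) = (\<Sum>i\<in>UNIV. \<Sum>j\<in>UNIV. x $ i * x $ j * (\<integral>y. y $ i * y $ j * c y \<partial>M))"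
      unfolding 2 using c
      by (subst Bochner_Integration.integral_sum, force, intro sum.cong refl,
          subst Bochner_Integration.integral_sum) auto
    also have "(x \<bullet> x) * (\<integral>y. b' y \<partial>M) = (\<Sum>i\<in>UNIV. \<Sum>j\<in>UNIV. x $ i * x $ j * (if i = j then \<integral>y. b' y \<partial>M else 0))"
      by (simp add: inner_vec_def sum_distrib_right if_distrib cong: if_cong)
    finally show ?thesis
      unfolding inner_matrix_vector_sum by (simp add: distrib_left sum.distrib mult.commute)
  qed
  then show ?thesis unfolding poly_deg_le2_def by blast
qed

text \<open>The kernel of \<open>bavg\<close> as a function of 1 - |y - x|^2 / \<rho>; see
  \<open>bavg_profile\<close>.\<close>

definition profile :: "real \<Rightarrow> real" where
  "profile r = 8 * max 0 r ^ 5 - 5 * max 0 r ^ 4"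

definition profile' :: "real \<Rightarrow> real" where
  "profile' r = 40 * max 0 r ^ 4 - 20 * max 0 r ^ 3"

definition profile'' :: "real \<Rightarrow> real" where
  "profile'' r = 160 * max 0 r ^ 3 - 60 * max 0 r ^ 2"

lemma profile_eq_0: "r \<le> 0 \<Longrightarrow> profile r = 0" "r \<le> 0 \<Longrightarrow> profile' r = 0" "r \<le> 0 \<Longrightarrow> profile'' r = 0"
  by (simp_all add: profile_def profile'_def profile''_def)

text \<open>The third derivative \<open>p3\<close> exists across the edge r = 0 because the lowest
  power is 4, and it is at most 600 in modulus for r \<le> 1; dividing by 3! gives 100.\<close>

lemma profile_taylor:
  assumes "r \<le> 1" "s \<le> 1"
  shows "\<bar>profile s - (profile r + profile' r * (s - r) + profile'' r * (s - r)\<^sup>2 / 2)\<bar> \<le> 100 * \<bar>s - r\<bar> ^ 3"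
proof (cases "s = r")
  case False
  define p3 where "p3 r = 480 * max 0 r ^ 2 - 120 * max 0 r" for r :: real
  define diff where "diff m = (if m = 0 then profile else if m = 1 then profile' else if m = 2 then profile'' else p3)" for m :: nat
  have d: "(diff m has_real_derivative diff (Suc m) t) (at t)" if "m < 3" for m t
  proof -
    note D = DERIV_max_power'[of 5 t] DERIV_max_power'[of 4 t] DERIV_max_power'[of 3 t] DERIV_max_power'[of 2 t]
    have "(profile has_real_derivative profile' t) (at t)"
      unfolding profile_def[abs_def] profile'_def
      by (rule DERIV_cong[OF DERIV_diff[OF DERIV_cmult[OF D(1)] DERIV_cmult[OF D(2)]]]) simp_all
    moreover have "(profile' has_real_derivative profile'' t) (at t)"
      unfolding profile'_def[abs_def] profile''_def
      by (rule DERIV_cong[OF DERIV_diff[OF DERIV_cmult[OF D(2)] DERIV_cmult[OF D(3)]]]) simp_all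
    moreover have "(profile'' has_real_derivative p3 t) (at t)"
      unfolding profile''_def[abs_def] p3_def
      by (rule DERIV_cong[OF DERIV_diff[OF DERIV_cmult[OF D(3)] DERIV_cmult[OF D(4)]]]) simp_all
    moreover have "m = 0 \<or> m = 1 \<or> m = 2" using that by auto
    ultimately show ?thesis by (auto simp: diff_def)
  qed
  obtain t where t: "if s < r then s < t \<and> t < r else r < t \<and> t < s"
    and eq: "profile s = (\<Sum>m<3. diff m r / fact m * (s - r) ^ m) + diff 3 t / fact 3 * (s - r) ^ 3"
    using Taylor[of 3 diff profile "min r s" "max r s" r s] d False by (auto simp: diff_def[of 0])
  have "t \<le> 1" using t assms by (auto split: if_splits)
  have "\<bar>p3 t\<bar> \<le> 600"
  proof -
    have "0 \<le> max 0 t" "max 0 t \<le> 1" using \<open>t \<le> 1\<close> by auto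
    moreover from this have "0 \<le> max 0 t ^ 2" "max 0 t ^ 2 \<le> 1" by (auto intro: power_le_one)
    ultimately show ?thesis unfolding p3_def by linarith
  qed
  moreover have "profile s - (profile r + profile' r * (s - r) + profile'' r * (s - r)\<^sup>2 / 2) = p3 t / 6 * (s - r) ^ 3"
    unfolding eq by (simp add: diff_def eval_nat_numeral)
  ultimately have "\<bar>profile s - (profile r + profile' r * (s - r) + profile'' r * (s - r)\<^sup>2 / 2)\<bar> = \<bar>p3 t\<bar> / 6 * \<bar>s - r\<bar> ^ 3"
    by (simp only: abs_mult power_abs abs_divide abs_numeral)
  also have "\<dots> \<le> 100 * \<bar>s - r\<bar> ^ 3" using \<open>\<bar>p3 t\<bar> \<le> 600\<close> by (intro mult_right_mono) auto
  finally show ?thesis .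
qed (simp add: assms)

lemma profile_deriv2_bound: "r \<le> 1 \<Longrightarrow> \<bar>profile'' r\<bar> \<le> 220"
proof -
  assume "r \<le> 1"
  then have m: "0 \<le> max 0 r" "max 0 r \<le> 1" by auto
  then have "0 \<le> max 0 r ^ k" "max 0 r ^ k \<le> 1" for k by (auto intro: power_le_one)
  from this[of 3] this[of 2] show ?thesis unfolding profile''_def by linarith
qed

text \<open>Second order Taylor expansion of the kernel about the one centred at 0, with increment
  (2 x.y - |x|^2) / \<rho>. From the square of the increment only the part quadratic in
  \<open>x\<close> is kept, so that the degree in \<open>x\<close> is 2.\<close>

definition quad_kernel :: "real \<Rightarrow> real^4 \<Rightarrow> real^4 \<Rightarrow> real" where
  "quad_kernel \<rho> x y = profile (1 - (norm y)\<^sup>2 / \<rho>) + profile' (1 - (norm y)\<^sup>2 / \<rho>) * ((2 * (x \<bullet> y) - x \<bullet> x) / \<rho>)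
     + profile'' (1 - (norm y)\<^sup>2 / \<rho>) * (2 * (x \<bullet> y)\<^sup>2 / \<rho>\<^sup>2)"

text \<open>Here \<open>q\<close> is the square root of the scale. The increment is at most 5 |x| /
  q, so the Taylor remainder gives 100 * 5^3 = 12500; the discarded cubic and quartic terms give 220
  * 5 = 1100, and the sum is rounded up. Beyond 2 q both kernels vanish because |x| \<le> q.\<close>

lemma quad_kernel_error:
  assumes q: "q \<ge> 1" "q \<ge> norm x"
  shows "\<bar>profile (1 - (norm (y - x))\<^sup>2 / q\<^sup>2) - quad_kernel (q\<^sup>2) x y\<bar> \<le> 14000 * norm x ^ 3 / q ^ 3 * indicator (cball 0 (2 * q)) y"
proof (cases "norm y \<le> 2 * q")
  case False
  have "q \<le> norm (y - x)" using False q norm_triangle_ineq2[of y x] by linarith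
  then have "q\<^sup>2 \<le> (norm (y - x))\<^sup>2" using q by (intro power_mono) auto
  then have "1 - (norm (y - x))\<^sup>2 / q\<^sup>2 \<le> 0" using q by simp
  moreover have "q\<^sup>2 \<le> (norm y)\<^sup>2" using q False by (intro power_mono) auto
  then have "1 - (norm y)\<^sup>2 / q\<^sup>2 \<le> 0" using q by simp
  ultimately show ?thesis using False by (simp add: quad_kernel_def profile_eq_0)
next
  case True
  define n where "n = norm x"
  define r where "r = 1 - (norm y)\<^sup>2 / q\<^sup>2"
  define s where "s = 1 - (norm (y - x))\<^sup>2 / q\<^sup>2"
  define k where "k = x \<bullet> y"
  have n: "n \<ge> 0" "n \<le> q" using q by (auto simp: n_def)
  have kb: "\<bar>k\<bar> \<le> n * (2 * q)"
    using Cauchy_Schwarz_ineq2[of x y] mult_left_mono[OF True, of "norm x"] by (simp add: k_def n_def)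
  have d: "s - r = (2 * k - n\<^sup>2) / q\<^sup>2"
  proof -
    have "(norm (y - x))\<^sup>2 = (norm y)\<^sup>2 - 2 * k + n\<^sup>2"
      unfolding power2_norm_eq_inner n_def k_def by (simp add: inner_diff_left inner_diff_right inner_commute)
    then show ?thesis unfolding s_def r_def by (simp add: diff_divide_distrib add_divide_distrib)
  qed
  have nn: "n\<^sup>2 \<le> n * q" unfolding power2_eq_square using n by (intro mult_left_mono) auto
  have db: "\<bar>s - r\<bar> \<le> 5 * n / q"
  proof -
    have "\<bar>2 * k - n\<^sup>2\<bar> \<le> 2 * \<bar>k\<bar> + n\<^sup>2" using zero_le_power2[of n] by linarith
    also have "\<dots> \<le> 5 * n * q" using kb nn by linarith
    finally have "\<bar>2 * k - n\<^sup>2\<bar> \<le> 5 * n * q" .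
    then have "\<bar>s - r\<bar> \<le> 5 * n * q / q\<^sup>2" unfolding d abs_divide using q by (simp add: divide_right_mono)
    then show ?thesis using q by (simp add: power2_eq_square)
  qed
  have rs: "r \<le> 1" "s \<le> 1" by (simp_all add: r_def s_def)
  have "\<bar>s - r\<bar> ^ 3 \<le> (5 * n / q) ^ 3" by (intro power_mono db) auto
  then have t1: "\<bar>profile s - (profile r + profile' r * (s - r) + profile'' r * (s - r)\<^sup>2 / 2)\<bar> \<le> 100 * (125 * n ^ 3 / q ^ 3)"
    using profile_taylor[OF rs] by (simp add: power_divide power_mult_distrib)
  have qk: "quad_kernel (q\<^sup>2) x y = profile r + profile' r * (s - r) + profile'' r * (2 * k\<^sup>2 / (q\<^sup>2)\<^sup>2)"
    unfolding quad_kernel_def d by (simp add: r_def k_def n_def power2_norm_eq_inner)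
  have e: "(s - r)\<^sup>2 / 2 - 2 * k\<^sup>2 / (q\<^sup>2)\<^sup>2 = (n ^ 4 - 4 * k * n\<^sup>2) / (2 * q ^ 4)"
  proof -
    have "(2 * k - n\<^sup>2)\<^sup>2 / 2 - 2 * k\<^sup>2 = (n ^ 4 - 4 * k * n\<^sup>2) / 2"
      by algebra
    then have "((2 * k - n\<^sup>2)\<^sup>2 / 2 - 2 * k\<^sup>2) / (q\<^sup>2)\<^sup>2 = (n ^ 4 - 4 * k * n\<^sup>2) / 2 / (q\<^sup>2)\<^sup>2" by (rule arg_cong)
    moreover have "((2 * k - n\<^sup>2)\<^sup>2 / 2 - 2 * k\<^sup>2) / (q\<^sup>2)\<^sup>2 = (s - r)\<^sup>2 / 2 - 2 * k\<^sup>2 / (q\<^sup>2)\<^sup>2"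
      unfolding d power_divide by (subst diff_divide_distrib) (simp add: mult.commute)
    moreover have "(n ^ 4 - 4 * k * n\<^sup>2) / 2 / (q\<^sup>2)\<^sup>2 = (n ^ 4 - 4 * k * n\<^sup>2) / (2 * q ^ 4)" by simp
    ultimately show ?thesis by metis
  qed
  have n4: "\<bar>n ^ 4 - 4 * k * n\<^sup>2\<bar> \<le> 10 * (n ^ 3 * q)"
  proof -
    have "\<bar>4 * k * n\<^sup>2\<bar> \<le> 4 * (n * (2 * q)) * n\<^sup>2" unfolding abs_mult using kb by (intro mult_mono) auto
    moreover have "n ^ 4 \<le> n ^ 3 * q" using n mult_left_mono[of n q "n ^ 3"] by (simp add: eval_nat_numeral)
    moreover have "0 \<le> n ^ 4" using n by simp
    ultimately show ?thesis by (simp add: eval_nat_numeral abs_le_iff)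
  qed
  have "\<bar>(s - r)\<^sup>2 / 2 - 2 * k\<^sup>2 / (q\<^sup>2)\<^sup>2\<bar> \<le> 10 * (n ^ 3 * q) / (2 * q ^ 4)"
  proof -
    have "\<bar>2 * q ^ 4\<bar> = 2 * q ^ 4" using q by simp
    then show ?thesis unfolding e abs_divide using n4
      by (metis abs_ge_zero divide_right_mono)
  qed
  also have "\<dots> = 5 * n ^ 3 / q ^ 3" using q by (simp add: eval_nat_numeral)
  finally have "\<bar>profile'' r\<bar> * \<bar>(s - r)\<^sup>2 / 2 - 2 * k\<^sup>2 / (q\<^sup>2)\<^sup>2\<bar> \<le> 220 * (5 * n ^ 3 / q ^ 3)"
    using profile_deriv2_bound[OF rs(1)] by (intro mult_mono) auto
  moreover have "profile s - quad_kernel (q\<^sup>2) x y = (profile s - (profile r + profile' r * (s - r) + profile'' r * (s - r)\<^sup>2 / 2))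
     + profile'' r * ((s - r)\<^sup>2 / 2 - 2 * k\<^sup>2 / (q\<^sup>2)\<^sup>2)"
    unfolding qk by (simp add: algebra_simps)
  ultimately have "\<bar>profile s - quad_kernel (q\<^sup>2) x y\<bar> \<le> 100 * (125 * n ^ 3 / q ^ 3) + 220 * (5 * n ^ 3 / q ^ 3)"
    using t1 by (simp only: abs_mult[symmetric])
  also have "\<dots> \<le> 14000 * n ^ 3 / q ^ 3" using n q by (simp add: divide_right_mono)
  finally show ?thesis using True by (simp add: s_def n_def)
qed

section \<open>Comparison of \<open>bavg\<close> with quadratic polynomials\<close>

context conformal_biharmonic
begin

definition quad_avg :: "real \<Rightarrow> real^4 \<Rightarrow> real" where
  "quad_avg \<rho> x = 42 / (pi\<^sup>2 * \<rho>\<^sup>2) * (\<integral>y. quad_kernel \<rho> x y * u y \<partial>lborel)"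

lemma continuous_profile: "continuous_on UNIV profile" "continuous_on UNIV profile'" "continuous_on UNIV profile''"
  unfolding profile_def[abs_def] profile'_def[abs_def] profile''_def[abs_def] by (intro continuous_intros)+

lemma profile_norm_eq_0:
  assumes "\<rho> > 0" "norm (y - x) > \<rho> + 1"
  shows "profile (1 - (norm (y - x))\<^sup>2 / \<rho>) = 0" "profile' (1 - (norm (y - x))\<^sup>2 / \<rho>) = 0" "profile'' (1 - (norm (y - x))\<^sup>2 / \<rho>) = 0"
proof -
  have "1 - (norm (y - x))\<^sup>2 / \<rho> \<le> 0" using norm_sq_gt[OF assms(2)] assms(1) by simp
  then show "profile (1 - (norm (y - x))\<^sup>2 / \<rho>) = 0" "profile' (1 - (norm (y - x))\<^sup>2 / \<rho>) = 0" "profile'' (1 - (norm (y - x))\<^sup>2 / \<rho>) = 0"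
    by (rule profile_eq_0)+
qed

lemma continuous_profile_norm:
  fixes x :: "real^4"
  assumes "\<rho> > 0"
  shows "continuous_on UNIV (\<lambda>y. profile (1 - (norm (y - x))\<^sup>2 / \<rho>))" "continuous_on UNIV (\<lambda>y. profile' (1 - (norm (y - x))\<^sup>2 / \<rho>))"
    "continuous_on UNIV (\<lambda>y. profile'' (1 - (norm (y - x))\<^sup>2 / \<rho>))"
  by (rule continuous_on_compose2[OF continuous_profile(1)] continuous_on_compose2[OF continuous_profile(2)]
     continuous_on_compose2[OF continuous_profile(3)]; use assms in \<open>auto intro!: continuous_intros\<close>)+

lemma quad_avg_poly:
  assumes \<rho>: "\<rho> > 0"
  shows "poly_deg_le2 (quad_avg \<rho>)"
proof -
  define c where "c = 42 / (pi\<^sup>2 * \<rho>\<^sup>2)"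
  define P P1 P2 where "P y = profile (1 - (norm (y - 0))\<^sup>2 / \<rho>)" and "P1 y = profile' (1 - (norm (y - 0))\<^sup>2 / \<rho>)"
    and "P2 y = profile'' (1 - (norm (y - 0))\<^sup>2 / \<rho>)" for y :: "real^4"
  have cont: "continuous_on UNIV P" "continuous_on UNIV P1" "continuous_on UNIV P2"
    unfolding P_def P1_def P2_def by (rule continuous_profile_norm[OF \<rho>])+
  have z: "P y = 0" "P1 y = 0" "P2 y = 0" if "norm (y - 0) > \<rho> + 1" for y
    using profile_norm_eq_0[OF \<rho> that] unfolding P_def P1_def P2_def by auto
  have int: "integrable lborel (\<lambda>y. g y * Q y * h y)"
    if "continuous_on UNIV g" "continuous_on UNIV Q" "continuous_on UNIV h" "\<And>y. norm (y - 0) > \<rho> + 1 \<Longrightarrow> Q y = 0"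
    for g Q h :: "real^4 \<Rightarrow> real"
    by (rule integrable_continuous_compact_support[where c = 0 and r = "\<rho> + 1"])
       (intro continuous_on_mult that, simp only: that mult_zero_left mult_zero_right)
  have "poly_deg_le2 (\<lambda>x. \<integral>y. c * P y * u y + (x \<bullet> y) * (c * (2 / \<rho>) * P1 y * u y)
    + (x \<bullet> x) * (c * (- 1 / \<rho>) * P1 y * u y) + (x \<bullet> y)\<^sup>2 * (c * (2 / \<rho>\<^sup>2) * P2 y * u y) \<partial>lborel)"
  proof (rule poly_deg_le2_integral)
    show "integrable lborel (\<lambda>y. c * P y * u y)" "integrable lborel (\<lambda>y. c * (- 1 / \<rho>) * P1 y * u y)"
      by (intro int continuous_on_const cont continuous z; assumption)+
    show "integrable lborel (\<lambda>y. y $ i * (c * (2 / \<rho>) * P1 y * u y))" for i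
    proof -
      have "integrable lborel (\<lambda>y. (y $ i * (c * (2 / \<rho>))) * P1 y * u y)"
        by (intro int continuous_intros cont continuous z; assumption)
      then show ?thesis by (simp only: mult.assoc)
    qed
    show "integrable lborel (\<lambda>y. y $ i * y $ j * (c * (2 / \<rho>\<^sup>2) * P2 y * u y))" for i j
    proof -
      have "integrable lborel (\<lambda>y. (y $ i * y $ j * (c * (2 / \<rho>\<^sup>2))) * P2 y * u y)"
        by (intro int continuous_intros cont continuous z; assumption)
      then show ?thesis by (simp only: mult.assoc)
    qed
  qed
  moreover have "quad_avg \<rho> x = (\<integral>y. c * P y * u y + (x \<bullet> y) * (c * (2 / \<rho>) * P1 y * u y)
    + (x \<bullet> x) * (c * (- 1 / \<rho>) * P1 y * u y) + (x \<bullet> y)\<^sup>2 * (c * (2 / \<rho>\<^sup>2) * P2 y * u y) \<partial>lborel)" for x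
  proof -
    have "c * ((p + p1 * ((2 * k - n) / \<rho>) + p2 * (2 * k\<^sup>2 / \<rho>\<^sup>2)) * w) =
      c * p * w + k * (c * (2 / \<rho>) * p1 * w) + n * (c * (- 1 / \<rho>) * p1 * w) + k\<^sup>2 * (c * (2 / \<rho>\<^sup>2) * p2 * w)"
      for p p1 p2 k n w :: real
      by (simp add: divide_inverse algebra_simps)
    from this[of "P _" "P1 _" "x \<bullet> _" "x \<bullet> x" "P2 _" "u _"]
    show ?thesis
      unfolding quad_avg_def c_def[symmetric] integral_mult_right_zero[symmetric] quad_kernel_def
      by (intro Bochner_Integration.integral_cong refl) (simp add: P_def P1_def P2_def)
  qed
  then have "quad_avg \<rho> = (\<lambda>x. \<integral>y. c * P y * u y + (x \<bullet> y) * (c * (2 / \<rho>) * P1 y * u y)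
    + (x \<bullet> x) * (c * (- 1 / \<rho>) * P1 y * u y) + (x \<bullet> y)\<^sup>2 * (c * (2 / \<rho>\<^sup>2) * P2 y * u y) \<partial>lborel)"
    by (rule ext)
  ultimately show ?thesis by (simp only:)
qed

lemma bavg_profile:
  assumes "\<rho> > 0"
  shows "bavg x \<rho> = 42 / (pi\<^sup>2 * \<rho>\<^sup>2) * (\<integral>y. profile (1 - (norm (y - x))\<^sup>2 / \<rho>) * u y \<partial>lborel)"
proof -
  have i: "integrable lborel (\<lambda>y. chi x \<rho> y ^ 5 * u y)" "integrable lborel (\<lambda>y. chi x \<rho> y ^ 4 * u y)"
    by (auto intro!: integrable_chi_power continuous assms)
  have "(\<integral>y. profile (1 - (norm (y - x))\<^sup>2 / \<rho>) * u y \<partial>lborel) = (\<integral>y. 8 * (chi x \<rho> y ^ 5 * u y) - 5 * (chi x \<rho> y ^ 4 * u y) \<partial>lborel)"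
    by (rule Bochner_Integration.integral_cong[OF refl]) (simp add: profile_def chi_def algebra_simps)
  also have "\<dots> = 8 * ball_moment 5 u x \<rho> - 5 * ball_moment 4 u x \<rho>"
    unfolding ball_moment_def using i by simp
  finally show ?thesis by (simp add: bavg_def)
qed

text \<open>Counting powers: normalisation q^(-4), kernel error q^(-3) and mass q^6 of |u| leave
  q^(-1). An expansion of one order less would leave no decay.\<close>

lemma bavg_quad_avg:
  obtains C where "C \<ge> 0" "\<And>q x. q \<ge> 1 \<Longrightarrow> q \<ge> norm x \<Longrightarrow> \<bar>bavg x (q\<^sup>2) - quad_avg (q\<^sup>2) x\<bar> \<le> C * norm x ^ 3 / q"
proof -
  obtain D where D: "D \<ge> 0" "\<And>r. r \<ge> 1 \<Longrightarrow> (\<integral>y. indicator (cball 0 r) y * \<bar>u y\<bar> \<partial>lborel) \<le> D * r ^ 6"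
    using integral_abs_u_bound by metis
  define C where "C = 42 / pi\<^sup>2 * (14000 * (D * 64))"
  have "\<bar>bavg x (q\<^sup>2) - quad_avg (q\<^sup>2) x\<bar> \<le> C * norm x ^ 3 / q" if q: "q \<ge> 1" "q \<ge> norm x" for q x
  proof -
    let ?p = "\<lambda>y. profile (1 - (norm (y - x))\<^sup>2 / q\<^sup>2)" and ?k = "quad_kernel (q\<^sup>2) x"
    let ?n = "14000 * norm x ^ 3 / q ^ 3"
    have q2: "q\<^sup>2 > 0" using q by simp
    have i: "integrable lborel (\<lambda>y. ?p y * u y)"
      by (rule integrable_continuous_compact_support[where c = x and r = "q\<^sup>2 + 1"])
         (auto simp: profile_norm_eq_0(1)[OF q2] intro!: continuous_intros continuous_profile_norm continuous q2)
    have k: "integrable lborel (\<lambda>y. ?k y * u y)"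
    proof (rule integrable_continuous_compact_support[where c = 0 and r = "q\<^sup>2 + 1"])
      have "continuous_on UNIV ?k"
        using continuous_profile_norm[OF q2, of 0] q2 unfolding quad_kernel_def
        by (intro continuous_intros) auto
      then show "continuous_on UNIV (\<lambda>y. ?k y * u y)" by (intro continuous_intros continuous)
      show "?k y * u y = 0" if "norm (y - 0) > q\<^sup>2 + 1" for y
        using profile_norm_eq_0[OF q2 that] by (simp add: quad_kernel_def)
    qed
    have iu: "integrable lborel (\<lambda>y. indicator (cball 0 (2 * q)) y * \<bar>u y\<bar>)"
      using borel_integrable_compact[of "cball 0 (2 * q)" "\<lambda>y. \<bar>u y\<bar>"] continuous_on_subset[OF continuous(1)]
      by (auto intro!: continuous_intros)
    have "bavg x (q\<^sup>2) - quad_avg (q\<^sup>2) x = 42 / (pi\<^sup>2 * (q\<^sup>2)\<^sup>2) * (\<integral>y. ?p y * u y - ?k y * u y \<partial>lborel)"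
      unfolding bavg_profile[OF q2] quad_avg_def using i k by (simp add: right_diff_distrib)
    also have "\<bar>\<dots>\<bar> = 42 / (pi\<^sup>2 * (q\<^sup>2)\<^sup>2) * \<bar>\<integral>y. ?p y * u y - ?k y * u y \<partial>lborel\<bar>"
      by (simp add: abs_mult)
    also have "\<dots> \<le> 42 / (pi\<^sup>2 * (q\<^sup>2)\<^sup>2) * (?n * (D * (2 * q) ^ 6))"
    proof (rule mult_left_mono)
      have "\<bar>\<integral>y. ?p y * u y - ?k y * u y \<partial>lborel\<bar> \<le> (\<integral>y. ?n * (indicator (cball 0 (2 * q)) y * \<bar>u y\<bar>) \<partial>lborel)"
      proof (rule Bochner_Integration.integral_abs_bound_integral)
        show "\<bar>?p y * u y - ?k y * u y\<bar> \<le> ?n * (indicator (cball 0 (2 * q)) y * \<bar>u y\<bar>)" for y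
          using mult_right_mono[OF quad_kernel_error[OF q, of y], of "\<bar>u y\<bar>"]
          by (simp only: abs_mult[symmetric] left_diff_distrib mult.assoc abs_ge_zero)
      qed (use i k iu in auto)
      also have "\<dots> = ?n * (\<integral>y. indicator (cball 0 (2 * q)) y * \<bar>u y\<bar> \<partial>lborel)" by simp
      also have "\<dots> \<le> ?n * (D * (2 * q) ^ 6)" using q by (intro mult_left_mono D) auto
      finally show "\<bar>\<integral>y. ?p y * u y - ?k y * u y \<partial>lborel\<bar> \<le> ?n * (D * (2 * q) ^ 6)" .
    qed simp
    also have "\<dots> = C * norm x ^ 3 / q"
      using q by (simp add: C_def power_mult_distrib) (simp add: field_simps eval_nat_numeral)
    finally show ?thesis .
  qed
  then show ?thesis using that[of C] D by (simp add: C_def)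
qed

lemma bavg_quad_avg_tendsto: "((\<lambda>q. bavg x (q\<^sup>2) - quad_avg (q\<^sup>2) x) \<longlongrightarrow> 0) at_top"
proof -
  obtain C where C: "C \<ge> 0" "\<And>q x. q \<ge> 1 \<Longrightarrow> q \<ge> norm x \<Longrightarrow> \<bar>bavg x (q\<^sup>2) - quad_avg (q\<^sup>2) x\<bar> \<le> C * norm x ^ 3 / q"
    using bavg_quad_avg by metis
  show ?thesis
  proof (rule Lim_null_comparison)
    show "\<forall>\<^sub>F q in at_top. norm (bavg x (q\<^sup>2) - quad_avg (q\<^sup>2) x) \<le> C * norm x ^ 3 / q"
      using eventually_ge_at_top[of "1::real"] eventually_ge_at_top[of "norm x"]
      by eventually_elim (simp add: C)
    show "((\<lambda>q. C * norm x ^ 3 / q) \<longlongrightarrow> 0) at_top"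
      by (intro tendsto_divide_0[OF tendsto_const] filterlim_at_top_imp_at_infinity filterlim_ident)
  qed
qed

text \<open>The limit is known for differences of \<open>bavg\<close>, so the value at 0 is
  subtracted from the approximating polynomials too. The maximum with 1 keeps every scale
  positive.\<close>

lemma poly_u_minus_v: "poly_deg_le2 (\<lambda>x. u x - v x)"
proof -
  let ?p = "\<lambda>q x. quad_avg ((max 1 q)\<^sup>2) x + - quad_avg ((max 1 q)\<^sup>2) 0"
  have sq: "filterlim (\<lambda>q::real. q\<^sup>2) at_top at_top"
    by (rule filterlim_pow_at_top) (auto intro: filterlim_ident)
  have "poly_deg_le2 (\<lambda>x. u x - v x - u 0)"
  proof (rule poly_deg_le2_limit[where p = ?p and F = at_top])
    show "poly_deg_le2 (?p q)" for q
      by (intro poly_deg_le2_add_const quad_avg_poly) auto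
    fix x
    have "((\<lambda>q. (bavg x (q\<^sup>2) - bavg 0 (q\<^sup>2)) - (bavg x (q\<^sup>2) - quad_avg (q\<^sup>2) x) + (bavg 0 (q\<^sup>2) - quad_avg (q\<^sup>2) 0)) \<longlongrightarrow>
        u x - v x - u 0 - 0 + 0) at_top"
      by (intro tendsto_add tendsto_diff bavg_quad_avg_tendsto filterlim_compose[OF bavg_diff_tendsto sq])
    then have "((\<lambda>q. (bavg x (q\<^sup>2) - bavg 0 (q\<^sup>2)) - (bavg x (q\<^sup>2) - quad_avg (q\<^sup>2) x) + (bavg 0 (q\<^sup>2) - quad_avg (q\<^sup>2) 0)) \<longlongrightarrow>
        u x - v x - u 0) at_top" by simp
    then show "((\<lambda>q. ?p q x) \<longlongrightarrow> u x - v x - u 0) at_top"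
      by (rule Lim_transform_eventually) (auto intro!: eventually_mono[OF eventually_ge_at_top[of "1::real"]] simp: max_def)
  qed simp
  from poly_deg_le2_add_const[OF this, of "u 0"] show ?thesis by simp
qed

end

section \<open>The polynomial is bounded above\<close>

lemma ln_le_sqrt:
  assumes "m \<ge> 0"
  shows "ln (2 + 2 * m\<^sup>2) \<le> 4 * sqrt (2 + 2 * m)"
proof -
  have "2 + 2 * m\<^sup>2 \<le> (2 + 2 * m)\<^sup>2" using assms by (simp add: power2_eq_square algebra_simps)
  then have "ln (2 + 2 * m\<^sup>2) \<le> ln ((2 + 2 * m)\<^sup>2)" using assms by (simp add: add_pos_nonneg)
  also have "\<dots> = 2 * ln (2 + 2 * m)" using assms by (simp add: ln_realpow)
  also have "ln (2 + 2 * m) = 2 * ln (sqrt (2 + 2 * m))" using assms by (simp add: ln_sqrt)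
  also have "ln (sqrt (2 + 2 * m)) \<le> sqrt (2 + 2 * m)"
    using ln_le_minus_one[of "sqrt (2 + 2 * m)"] assms by simp
  finally show ?thesis by simp
qed

text \<open>Division by \<open>t\<close> leaves \<alpha> t + \<beta> below a quantity tending to 0.
  The range t \<ge> 1/n corresponds to points of norm at least 1 on a ray.\<close>

lemma quadratic_growth_contradiction:
  fixes \<alpha> \<beta> a c K n :: real
  assumes n: "n > 0" and le: "\<And>t. t \<ge> 1 / n \<Longrightarrow> \<alpha> * t\<^sup>2 + \<beta> * t + c \<le> a + K * sqrt (2 + 2 * (n * t))"
  shows "\<alpha> \<le> 0" "\<alpha> = 0 \<Longrightarrow> \<beta> \<le> 0"
proof -
  have i: "((\<lambda>t::real. d / t) \<longlongrightarrow> 0) at_top" for d :: real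
    by (intro tendsto_divide_0[OF tendsto_const] filterlim_at_top_imp_at_infinity filterlim_ident)
  have ev: "\<forall>\<^sub>F t in at_top. t \<ge> 1 / n \<and> t > 0"
    using eventually_ge_at_top[of "1 / n"] eventually_gt_at_top[of 0] by eventually_elim auto
  let ?g = "\<lambda>t. (a - c) / t + K * sqrt (2 / t * (1 / t) + 2 * n / t)"
  have "(?g \<longlongrightarrow> 0 + K * sqrt (0 * 0 + 0)) at_top" by (intro tendsto_intros i)
  then have g: "(?g \<longlongrightarrow> 0) at_top" by simp
  have le': "\<alpha> * t + \<beta> \<le> ?g t" if t: "t \<ge> 1 / n" "t > 0" for t
  proof -
    have "2 / t * (1 / t) + 2 * n / t = (2 + 2 * (n * t)) / t\<^sup>2" using t by (simp add: field_simps power2_eq_square)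
    then have "sqrt (2 / t * (1 / t) + 2 * n / t) = sqrt (2 + 2 * (n * t)) / t"
      using t by (simp add: real_sqrt_divide)
    moreover have "(\<alpha> * t + \<beta>) * t \<le> (a - c) + K * sqrt (2 + 2 * (n * t))"
      using le[OF t(1)] by (simp add: algebra_simps power2_eq_square)
    then have "\<alpha> * t + \<beta> \<le> ((a - c) + K * sqrt (2 + 2 * (n * t))) / t" using t by (simp add: pos_le_divide_eq)
    ultimately show ?thesis by (simp add: add_divide_distrib)
  qed
  show "\<alpha> \<le> 0"
  proof (rule ccontr)
    assume "\<not> \<alpha> \<le> 0"
    have "\<forall>\<^sub>F t in at_top. ?g t < 1" using g by (rule order_tendstoD) simp
    then have "\<forall>\<^sub>F t in at_top. \<alpha> * t + \<beta> < 1"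
      using ev by eventually_elim (use le' in force)
    moreover have "\<forall>\<^sub>F t in at_top. t \<ge> (1 - \<beta>) / \<alpha>" by (rule eventually_ge_at_top)
    ultimately have "\<forall>\<^sub>F t :: real in at_top. False"
      by eventually_elim (use \<open>\<not> \<alpha> \<le> 0\<close> in \<open>simp add: pos_divide_le_eq mult.commute\<close>)
    then show False by simp
  qed
  show "\<beta> \<le> 0" if "\<alpha> = 0"
    by (rule tendsto_lowerbound[OF g]) (use ev le' that in \<open>auto elim!: eventually_mono\<close>)
qed

text \<open>Along rays the growth bound makes the symmetric part \<open>S\<close> negative
  semidefinite; on the kernel of \<open>S\<close>, used for w and -w, it forces b.w = 0. Hence
  \<open>b\<close> lies in the range of \<open>S\<close>, and completing the square gives the
  bound.\<close>

lemma poly_deg_le2_bounded_above: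
  assumes P: "poly_deg_le2 P" and le: "\<And>x. norm x \<ge> 1 \<Longrightarrow> P x \<le> a + K * ln (2 + 2 * (norm x)\<^sup>2)" and K: "K \<ge> 0"
  shows "\<exists>M. \<forall>x. P x \<le> M"
proof -
  obtain A :: "real^4^4" and b :: "real^4" and c where A: "\<And>x. P x = x \<bullet> (A *v x) + b \<bullet> x + c"
    using P unfolding poly_deg_le2_def by blast
  define S where "S = (1 / 2) *\<^sub>R (A + transpose A)"
  have tr: "x \<bullet> (transpose A *v y) = y \<bullet> (A *v x)" for x y
    by (metis dot_lmul_matrix inner_commute transpose_matrix_vector)
  have Sv: "S *v x = (1 / 2) *\<^sub>R (A *v x + transpose A *v x)" for x
    by (simp add: S_def scaleR_matrix_vector_assoc[symmetric] matrix_vector_mult_add_rdistrib)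
  have sym: "x \<bullet> (S *v y) = y \<bullet> (S *v x)" for x y
    unfolding Sv inner_scaleR_right inner_add_right tr by simp
  have P: "P x = x \<bullet> (S *v x) + b \<bullet> x + c" for x
    unfolding A Sv inner_scaleR_right inner_add_right tr by simp
  have dir: "w \<bullet> (S *v w) \<le> 0" "w \<bullet> (S *v w) = 0 \<Longrightarrow> b \<bullet> w \<le> 0" if w: "w \<noteq> 0" for w
  proof -
    have "(w \<bullet> (S *v w)) * t\<^sup>2 + (b \<bullet> w) * t + c \<le> a + (K * 4) * sqrt (2 + 2 * (norm w * t))"
      if t: "t \<ge> 1 / norm w" for t
    proof -
      have t0: "t > 0" using t w by (meson less_le_trans zero_less_divide_1_iff zero_less_norm_iff)
      then have n: "norm (t *\<^sub>R w) = norm w * t" by simp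
      have "norm (t *\<^sub>R w) \<ge> 1" unfolding n using t w by (simp add: field_simps)
      from le[OF this] have "P (t *\<^sub>R w) \<le> a + K * ln (2 + 2 * (norm (t *\<^sub>R w))\<^sup>2)" .
      also have "\<dots> \<le> a + K * (4 * sqrt (2 + 2 * (norm w * t)))"
        unfolding n using ln_le_sqrt[of "norm w * t"] t0 K by (intro add_left_mono mult_left_mono) auto
      finally show ?thesis
        by (simp add: P matrix_vector_mult_scaleR power2_eq_square mult_ac)
    qed
    from quadratic_growth_contradiction[of "norm w", OF _ this] w
    show "w \<bullet> (S *v w) \<le> 0" "w \<bullet> (S *v w) = 0 \<Longrightarrow> b \<bullet> w \<le> 0" by auto
  qed
  have neg: "w \<bullet> (S *v w) \<le> 0" for w using dir(1)[of w] by (cases "w = 0") auto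
  have ker: "b \<bullet> w = 0" if "S *v w = 0" for w
  proof (cases "w = 0")
    case False
    have "S *v (- w) = 0" using that by (simp add: linear_neg[OF matrix_vector_mul_linear])
    then show ?thesis using dir(2)[of w] dir(2)[of "- w"] that False by auto
  qed simp
  have sub: "subspace (range ((*v) S))"
    by (intro linear_subspace_image matrix_vector_mul_linear subspace_UNIV)
  obtain y z where yz: "y \<in> span (range ((*v) S))" "\<And>w. w \<in> span (range ((*v) S)) \<Longrightarrow> orthogonal z w" "b = y + z"
    using orthogonal_subspace_decomp_exists[of "range ((*v) S)" b] by metis
  have "y \<in> range ((*v) S)" using yz(1) sub by (simp only: span_eq_iff[THEN iffD2, OF sub])
  then obtain q where q: "y = S *v q" by blast
  have zo: "z \<bullet> (S *v x) = 0" for x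
    using yz(2)[of "S *v x"] by (simp add: orthogonal_def span_base)
  \<comment> \<open>As \<open>z\<close> is orthogonal to the range of \<open>S\<close>, symmetry
    gives |S z|^2 = z.S(S z) = 0.\<close>
  have "S *v z = 0"
    using zo[of "S *v z"] sym[of z "S *v z"] by (metis inner_eq_zero_iff sym zo)
  then have "b \<bullet> z = 0" by (rule ker)
  moreover have "y \<bullet> z = 0" using zo[of q] by (simp add: q inner_commute)
  ultimately have "z = 0" using yz(3) by (simp add: inner_add_left)
  then have b: "b = S *v q" using yz(3) q by simp
  \<comment> \<open>Since b = 2 S h, the linear term is the mixed term of the square at x +
    h.\<close>
  define h where "h = (1 / 2) *\<^sub>R q"
  have "P x \<le> c - h \<bullet> (S *v h)" for x
  proof -
    have "(x + h) \<bullet> (S *v (x + h)) = x \<bullet> (S *v x) + 2 * (x \<bullet> (S *v h)) + h \<bullet> (S *v h)"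
      using sym[of h x] by (simp add: matrix_vector_right_distrib inner_add_left inner_add_right)
    moreover have "2 * (x \<bullet> (S *v h)) = b \<bullet> x"
      by (simp add: h_def b matrix_vector_mult_scaleR inner_commute)
    ultimately have "P x = (x + h) \<bullet> (S *v (x + h)) - h \<bullet> (S *v h) + c" by (simp add: P)
    then show ?thesis using neg[of "x + h"] by simp
  qed
  then show ?thesis by blast
qed

lemma trunc_log_scale:
  assumes "s > 0" "\<tau> \<ge> 1"
  shows "trunc_log (s / \<tau>) \<le> trunc_log s + 4 + ln \<tau>"
proof -
  have "\<tau> + s \<le> \<tau> * (1 + s)" using assms mult_left_mono[of 1 \<tau> s] by (simp add: algebra_simps)
  then have "ln (\<tau> + s) \<le> ln (\<tau> * (1 + s))" using assms by simp
  also have "\<dots> = ln \<tau> + ln (1 + s)" using assms by (intro ln_mult_pos) auto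
  finally show ?thesis
    using smooth_log_bounds(2)[of \<tau> s] smooth_log_bounds(1)[of 1 s] assms by (simp add: smooth_log_def)
qed

section \<open>Logarithmic control of \<open>bavg\<close> from below\<close>

context biharmonic_source
begin

lemma log_potential_bound:
  assumes \<tau>: "\<tau> \<ge> 1"
  shows "\<bar>log_potential f 0 \<tau>\<bar> \<le> (\<integral>y. trunc_log ((norm y)\<^sup>2) * \<bar>f y\<bar> \<partial>lborel) + (4 + ln \<tau>) * (\<integral>y. \<bar>f y\<bar> \<partial>lborel)"
proof -
  have i: "integrable lborel (\<lambda>y. trunc_log ((norm (y - 0))\<^sup>2 / 1) * \<bar>f y\<bar>)"
    by (intro integrable_trunc_log continuous_on_rabs continuous) auto
  have i': "integrable lborel (\<lambda>y. trunc_log ((norm (y - 0))\<^sup>2 / \<tau>) * f y)"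
    using \<tau> by (intro integrable_trunc_log continuous) auto
  have "\<bar>log_potential f 0 \<tau>\<bar> \<le> (\<integral>y. \<bar>trunc_log ((norm (y - 0))\<^sup>2 / \<tau>) * f y\<bar> \<partial>lborel)"
    unfolding log_potential_def by (rule integral_abs_bound)
  also have "\<dots> \<le> (\<integral>y. trunc_log ((norm y)\<^sup>2) * \<bar>f y\<bar> + (4 + ln \<tau>) * \<bar>f y\<bar> \<partial>lborel)"
  proof (rule integral_mono_AE)
    show "integrable lborel (\<lambda>y. \<bar>trunc_log ((norm (y - 0))\<^sup>2 / \<tau>) * f y\<bar>)" using i' by (rule integrable_abs)
    show "integrable lborel (\<lambda>y. trunc_log ((norm y)\<^sup>2) * \<bar>f y\<bar> + (4 + ln \<tau>) * \<bar>f y\<bar>)"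
      using i f_integrable by (intro Bochner_Integration.integrable_add integrable_mult_right) auto
    show "AE y in lborel. \<bar>trunc_log ((norm (y - 0))\<^sup>2 / \<tau>) * f y\<bar> \<le> trunc_log ((norm y)\<^sup>2) * \<bar>f y\<bar> + (4 + ln \<tau>) * \<bar>f y\<bar>"
      using AE_lborel_neq[of 0]
    proof eventually_elim
      case (elim y)
      then have "0 \<le> trunc_log ((norm y)\<^sup>2 / \<tau>)" "trunc_log ((norm y)\<^sup>2 / \<tau>) \<le> trunc_log ((norm y)\<^sup>2) + (4 + ln \<tau>)"
        using trunc_log_scale[OF _ \<tau>, of "(norm y)\<^sup>2"] \<tau> by (auto intro!: trunc_log_nonneg)
      then show ?case using mult_right_mono[of "trunc_log ((norm y)\<^sup>2 / \<tau>)" _ "\<bar>f y\<bar>"]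
        by (simp add: abs_mult distrib_right[symmetric] add.assoc)
    qed
  qed
  also have "\<dots> = (\<integral>y. trunc_log ((norm y)\<^sup>2) * \<bar>f y\<bar> \<partial>lborel) + (4 + ln \<tau>) * (\<integral>y. \<bar>f y\<bar> \<partial>lborel)"
    using i f_integrable by simp
  finally show ?thesis .
qed

text \<open>A direct estimate would involve \<open>f\<close> near \<open>x\<close>, where no bound
  is available. Instead \<open>potential_split\<close> trades the potential at \<open>x\<close> for
  the one at 0, which grows like ln \<tau>; the upper limit on \<tau> keeps this below ln (2 + 2
  |x|^2).\<close>

lemma bavg_lower_bound:
  obtains C where "C \<ge> 0" "\<And>x \<tau>. 1 \<le> \<tau> \<Longrightarrow> \<tau> \<le> 1 + (norm x)\<^sup>2 \<Longrightarrow>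
    bavg x \<tau> \<ge> u x - v x - C * (1 + ln (2 + 2 * (norm x)\<^sup>2))"
proof -
  define F where "F = (\<integral>y. \<bar>f y\<bar> \<partial>lborel)"
  define T where "T = (\<integral>y. trunc_log ((norm y)\<^sup>2) * \<bar>f y\<bar> \<partial>lborel)"
  have F: "F \<ge> 0" by (simp add: F_def)
  have "0 \<le> T" unfolding T_def
  proof (rule integral_nonneg_AE)
    show "AE y in lborel. 0 \<le> trunc_log ((norm y)\<^sup>2) * \<bar>f y\<bar>"
      using AE_lborel_neq[of 0] by eventually_elim (simp add: trunc_log_nonneg)
  qed
  define C where "C = (8 * F + T) / (16 * pi\<^sup>2)"
  have C: "C \<ge> 0" using F \<open>0 \<le> T\<close> by (simp add: C_def)
  have "bavg x \<tau> \<ge> u x - v x - C * (1 + ln (2 + 2 * (norm x)\<^sup>2))" if \<tau>: "1 \<le> \<tau>" "\<tau> \<le> 1 + (norm x)\<^sup>2" for x \<tau>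
  proof -
    let ?L = "ln (2 + 2 * (norm x)\<^sup>2)"
    let ?D = "\<integral>y. kernel_diff x \<tau> y * f y \<partial>lborel"
    have L: "?L \<ge> 0" "ln \<tau> \<le> ?L" using \<tau> by auto
    have "\<bar>?D\<bar> \<le> (\<integral>y. \<bar>kernel_diff x \<tau> y * f y\<bar> \<partial>lborel)" by (rule integral_abs_bound)
    also have "\<dots> \<le> (\<integral>y. (4 + ?L) * \<bar>f y\<bar> \<partial>lborel)"
    proof (rule integral_mono_AE)
      show "AE y in lborel. \<bar>kernel_diff x \<tau> y * f y\<bar> \<le> (4 + ?L) * \<bar>f y\<bar>"
        using AE_lborel_neq[of x] AE_lborel_neq[of 0]
      proof eventually_elim
        case (elim y)
        then show ?case using kernel_diff_bound[OF \<tau>(1), of y x] by (auto simp: abs_mult intro!: mult_right_mono)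
      qed
    qed (use integrable_kernel_diff[OF \<tau>(1)] f_integrable in auto)
    also have "\<dots> = (4 + ?L) * F" by (simp add: F_def)
    finally have D: "?D \<ge> - ((4 + ?L) * F)" by (simp add: abs_le_iff)
    have "log_potential f 0 \<tau> \<le> T + (4 + ln \<tau>) * F"
      using log_potential_bound[OF \<tau>(1)] by (simp add: F_def T_def abs_le_iff)
    moreover have "(4 + ln \<tau>) * F \<le> (4 + ?L) * F" using L F by (intro mult_right_mono) auto
    ultimately have "?D - log_potential f 0 \<tau> \<ge> - (T + 2 * ((4 + ?L) * F))" using D by simp
    moreover have "T + 2 * ((4 + ?L) * F) \<le> (8 * F + T) * (1 + ?L)"
      using L F \<open>0 \<le> T\<close> mult_nonneg_nonneg[of ?L F] mult_nonneg_nonneg[of ?L T] by (simp add: algebra_simps)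
    ultimately have "?D - log_potential f 0 \<tau> \<ge> - ((8 * F + T) * (1 + ?L))" by linarith
    then have "(?D - log_potential f 0 \<tau>) / (16 * pi\<^sup>2) \<ge> (- ((8 * F + T) * (1 + ?L))) / (16 * pi\<^sup>2)"
      by (intro divide_right_mono) auto
    moreover have "(- ((8 * F + T) * (1 + ?L))) / (16 * pi\<^sup>2) = - (C * (1 + ?L))" by (simp add: C_def)
    moreover have "bavg x \<tau> = u x - v x + (?D - log_potential f 0 \<tau>) / (16 * pi\<^sup>2)"
    proof -
      have "v x = (?D - log_potential f 0 \<tau> + log_potential f x \<tau>) / (16 * pi\<^sup>2)"
        using potential_split[OF \<tau>(1), of x] by (simp add: field_simps)
      moreover have "u x = bavg x \<tau> + log_potential f x \<tau> / (16 * pi\<^sup>2)" using representation \<tau> by auto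
      ultimately show ?thesis by (simp add: add_divide_distrib diff_divide_distrib)
    qed
    ultimately show ?thesis by simp
  qed
  then show ?thesis using that C by blast
qed

end

context conformal_biharmonic
begin

lemma avg_1_upper_bound:
  obtains C where "C \<ge> 0" "\<And>x. avg x 1 \<le> C"
proof -
  define E where "E = (\<integral>y. exp (4 * u y) \<partial>lborel)"
  have "avg x 1 \<le> 42 / pi\<^sup>2 * E" for x
  proof -
    have "ball_moment 5 u x 1 \<le> E" unfolding ball_moment_def E_def
    proof (rule integral_mono)
      fix y
      have k: "0 \<le> chi x 1 y ^ 5" "chi x 1 y ^ 5 \<le> 1"
        using chi_nonneg power_le_one[OF chi_nonneg chi_le_1] by auto
      have "u y \<le> exp (4 * u y)"
        using exp_ge_add_one_self[of "4 * u y"] exp_gt_zero[of "4 * u y"] by linarith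
      then have "chi x 1 y ^ 5 * u y \<le> chi x 1 y ^ 5 * exp (4 * u y)" using k by (intro mult_left_mono) auto
      also have "\<dots> \<le> 1 * exp (4 * u y)" using k by (intro mult_right_mono) auto
      finally show "chi x 1 y ^ 5 * u y \<le> exp (4 * u y)" by simp
    qed (use exp_integrable in \<open>auto intro!: integrable_chi_power continuous\<close>)
    then show ?thesis by (simp add: avg_def divide_right_mono)
  qed
  then show ?thesis using that[of "42 / pi\<^sup>2 * E"] by (simp add: E_def)
qed

text \<open>The ball of radius sqrt \<rho> about \<open>x\<close> lies in the ball of radius 2 sqrt
  \<rho> about 0, on which the mass of |u| is at most 64 D \<rho>^3.\<close>

lemma avg_far_lower_bound:
  obtains C where "C \<ge> 0" "\<And>x \<rho>. \<rho> \<ge> 1 \<Longrightarrow> (norm x)\<^sup>2 \<le> \<rho> \<Longrightarrow> avg x \<rho> \<ge> - C * \<rho>"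
proof -
  obtain D where D: "D \<ge> 0" "\<And>r. r \<ge> 1 \<Longrightarrow> (\<integral>y. indicator (cball 0 r) y * \<bar>u y\<bar> \<partial>lborel) \<le> D * r ^ 6"
    using integral_abs_u_bound by metis
  have "avg x \<rho> \<ge> - (42 / pi\<^sup>2 * (64 * D)) * \<rho>" if \<rho>: "\<rho> \<ge> 1" "(norm x)\<^sup>2 \<le> \<rho>" for x \<rho>
  proof -
    define q where "q = sqrt \<rho>"
    have q: "q \<ge> 1" "q\<^sup>2 = \<rho>" using \<rho> by (auto simp: q_def)
    have nx: "norm x \<le> q" using \<rho>(2) unfolding q_def by (simp add: real_le_rsqrt)
    have iu: "integrable lborel (\<lambda>y. indicator (cball 0 (2 * q)) y * \<bar>u y\<bar>)"
      using borel_integrable_compact[of "cball 0 (2 * q)" "\<lambda>y. \<bar>u y\<bar>"] continuous_on_subset[OF continuous(1)]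
      by (auto intro!: continuous_intros)
    have "\<bar>ball_moment 5 u x \<rho>\<bar> \<le> (\<integral>y. indicator (cball 0 (2 * q)) y * \<bar>u y\<bar> \<partial>lborel)"
      unfolding ball_moment_def
    proof (rule Bochner_Integration.integral_abs_bound_integral)
      fix y
      show "\<bar>chi x \<rho> y ^ 5 * u y\<bar> \<le> indicator (cball 0 (2 * q)) y * \<bar>u y\<bar>"
      proof (cases "norm y \<le> 2 * q")
        case True
        have "\<bar>chi x \<rho> y ^ 5\<bar> \<le> 1"
          using chi_nonneg[of x \<rho> y] power_le_one[OF chi_nonneg chi_le_1] \<rho> by auto
        then have "\<bar>chi x \<rho> y ^ 5 * u y\<bar> \<le> 1 * \<bar>u y\<bar>" unfolding abs_mult by (intro mult_right_mono) auto
        then show ?thesis using True by simp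
      next
        case False
        have "q \<le> norm (y - x)" using False nx norm_triangle_ineq2[of y x] by linarith
        then have "\<rho> \<le> (norm (y - x))\<^sup>2" unfolding q(2)[symmetric] using q by (intro power_mono) auto
        then show ?thesis using chi_eq_0[of \<rho> y x] \<rho> by simp
      qed
    qed (use \<rho> iu in \<open>auto intro!: integrable_chi_power continuous\<close>)
    also have "\<dots> \<le> D * (2 * q) ^ 6" using q by (intro D) auto
    also have "\<dots> = 64 * D * \<rho> * \<rho>\<^sup>2" by (simp add: q(2)[symmetric] eval_nat_numeral)
    finally have "ball_moment 5 u x \<rho> / \<rho>\<^sup>2 \<ge> - (64 * D * \<rho>)"
      using \<rho> by (simp add: abs_le_iff field_simps)
    then have "42 / pi\<^sup>2 * (ball_moment 5 u x \<rho> / \<rho>\<^sup>2) \<ge> 42 / pi\<^sup>2 * (- (64 * D * \<rho>))"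
      by (intro mult_left_mono) auto
    then show ?thesis by (simp add: avg_def)
  qed
  then show ?thesis using that[of "42 / pi\<^sup>2 * (64 * D)"] D by simp
qed

text \<open>The derivative of (avg x t - b) / t is (b - bavg x t) / t^2, hence nonpositive. This
  converts a bound on \<open>bavg\<close> at intermediate scales into a comparison of the scales 1
  and \<rho>.\<close>

lemma avg_over_rho:
  assumes \<rho>: "\<rho> \<ge> 1" and b: "\<And>\<tau>. 1 \<le> \<tau> \<Longrightarrow> \<tau> \<le> \<rho> \<Longrightarrow> bavg x \<tau> \<ge> b"
  shows "avg x \<rho> / \<rho> - b / \<rho> \<le> avg x 1 - b"
proof -
  have "(avg x \<rho> - b) / \<rho> \<le> (avg x 1 - b) / 1"
  proof (rule DERIV_nonpos_imp_nonincreasing[OF \<rho>])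
    fix t assume t: "1 \<le> t" "t \<le> \<rho>"
    have "((\<lambda>t. (avg x t - b) / t) has_real_derivative ((davg x t - 0) * t - (avg x t - b) * 1) / (t * t)) (at t)"
      by (intro DERIV_divide DERIV_diff DERIV_avg DERIV_const DERIV_ident) (use t in auto)
    moreover have "((davg x t - 0) * t - (avg x t - b) * 1) / (t * t) \<le> 0"
      using b[OF t] bavg_eq[of t x] t by (simp add: divide_nonpos_pos mult.commute)
    ultimately show "\<exists>y. ((\<lambda>t. (avg x t - b) / t) has_real_derivative y) (at t) \<and> y \<le> 0" by blast
  qed
  then show ?thesis by (simp add: diff_divide_distrib)
qed

text \<open>At scale 1 the mean is bounded above, and at scale \<rho> = 1 + |x|^2 it is at least -C1
  \<rho>. Between them \<open>avg_over_rho\<close> forces b (1 - 1/\<rho>) \<le> C0 + C1, and \<rho>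
  \<ge> 2 makes the factor at least 1/2.\<close>

lemma poly_bounded_above: "\<exists>M. \<forall>x. u x - v x \<le> M"
proof -
  obtain C where C: "C \<ge> 0" "\<And>x \<tau>. 1 \<le> \<tau> \<Longrightarrow> \<tau> \<le> 1 + (norm x)\<^sup>2 \<Longrightarrow>
    bavg x \<tau> \<ge> u x - v x - C * (1 + ln (2 + 2 * (norm x)\<^sup>2))" using bavg_lower_bound by metis
  obtain C0 where C0: "C0 \<ge> 0" "\<And>x. avg x 1 \<le> C0" using avg_1_upper_bound by metis
  obtain C1 where C1: "C1 \<ge> 0" "\<And>x \<rho>. \<rho> \<ge> 1 \<Longrightarrow> (norm x)\<^sup>2 \<le> \<rho> \<Longrightarrow> avg x \<rho> \<ge> - C1 * \<rho>"
    using avg_far_lower_bound by metis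
  have "u x - v x \<le> (2 * (C0 + C1) + C) + C * ln (2 + 2 * (norm x)\<^sup>2)" if x: "norm x \<ge> 1" for x
  proof -
    define b where "b = u x - v x - C * (1 + ln (2 + 2 * (norm x)\<^sup>2))"
    define \<rho> where "\<rho> = 1 + (norm x)\<^sup>2"
    have \<rho>: "\<rho> \<ge> 2" using x by (simp add: \<rho>_def)
    have "avg x \<rho> / \<rho> - b / \<rho> \<le> avg x 1 - b"
      using \<rho> C(2)[of _ x] by (intro avg_over_rho) (auto simp: b_def \<rho>_def)
    moreover have "avg x \<rho> / \<rho> \<ge> - C1" using C1(2)[of \<rho> x] \<rho> by (simp add: pos_le_divide_eq \<rho>_def)
    ultimately have *: "b - b / \<rho> \<le> C0 + C1" using C0(2)[of x] by linarith
    have "b \<le> 2 * (C0 + C1)"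
    proof (cases "b \<ge> 0")
      case True
      then have "b / \<rho> \<le> b / 2" using \<rho> by (intro divide_left_mono) auto
      then show ?thesis using * by simp
    qed (use C0 C1 in auto)
    then show ?thesis by (simp add: b_def algebra_simps)
  qed
  then show ?thesis by (rule poly_deg_le2_bounded_above[OF poly_u_minus_v _ C(1)])
qed

end

section \<open>Asymptotics of the potential\<close>

lemma tendsto_0_at_infinity_sequentially:
  fixes F :: "'a::real_normed_vector \<Rightarrow> real"
  assumes "\<And>X :: nat \<Rightarrow> 'a. (\<And>n. norm (X n) \<ge> max r (real n)) \<Longrightarrow> (\<lambda>n. F (X n)) \<longlonglongrightarrow> 0"
  shows "(F \<longlongrightarrow> 0) at_infinity"
proof (rule tendstoI, rule ccontr)
  fix e :: real assume e: "e > 0" and "\<not> (\<forall>\<^sub>F x in at_infinity. dist (F x) 0 < e)"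
  then have "\<And>b. \<exists>x. norm x \<ge> b \<and> \<not> dist (F x) 0 < e"
    unfolding eventually_at_infinity by blast
  then have "\<exists>X. \<forall>n. norm (X n) \<ge> max r (real n) \<and> \<not> dist (F (X n)) 0 < e" by (intro choice allI) blast
  then obtain X where X: "\<And>n. norm (X n) \<ge> max r (real n)" "\<And>n. \<not> dist (F (X n)) 0 < e" by blast
  from tendstoD[OF assms[OF X(1)] e] have "\<forall>\<^sub>F n in sequentially. dist (F (X n)) 0 < e" .
  then show False unfolding eventually_sequentially using X(2) by blast
qed

text \<open>The kernel of \<open>v\<close> plus ln |x|, with the distance to \<open>x\<close> cut
  off below at 1. The added ln |x| produces the leading term of the asymptotics and keeps the kernel
  bounded for fixed nonzero \<open>y\<close> as |x| \<rightarrow> \<infinity>.\<close>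

definition far_kernel :: "real^4 \<Rightarrow> real^4 \<Rightarrow> real" where
  "far_kernel x y = ln (norm y * norm x / max (norm (y - x)) 1)"

definition near_kernel :: "real^4 \<Rightarrow> real^4 \<Rightarrow> real" where
  "near_kernel x y = (if norm (y - x) < 1 then - ln (norm (y - x)) else 0)"

lemma far_kernel_measurable [measurable]: "far_kernel x \<in> borel_measurable borel"
  unfolding far_kernel_def[abs_def] by measurable

lemma near_kernel_measurable [measurable]: "near_kernel x \<in> borel_measurable borel"
  unfolding near_kernel_def[abs_def] by measurable

lemma far_near_kernel:
  assumes "y \<noteq> 0" "y \<noteq> x" "x \<noteq> 0"
  shows "ln (norm y / norm (x - y)) + ln (norm x) = far_kernel x y + near_kernel x y"
proof -
  have m: "max (norm (y - x)) 1 > 0" by auto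
  have "far_kernel x y = ln (norm y) + ln (norm x) - ln (max (norm (y - x)) 1)"
    unfolding far_kernel_def using assms m by (simp add: ln_div ln_mult)
  moreover have "ln (norm y / norm (x - y)) = ln (norm y) - ln (norm (y - x))"
    using assms by (simp add: ln_div norm_minus_commute)
  ultimately show ?thesis by (auto simp: near_kernel_def max_def)
qed

lemma near_kernel_nonneg: "near_kernel x y \<ge> 0"
  by (cases "y = x") (auto simp: near_kernel_def)

lemma near_kernel_le:
  assumes "y \<noteq> x"
  shows "near_kernel x y \<le> indicator (cball x 1) y / norm (y - x)" "indicator (cball x 1) y / norm (y - x) \<le> indicator (cball x 1) y / (norm (y - x))\<^sup>2"
proof -
  have d: "norm (y - x) > 0" using assms by simp
  have "- ln (norm (y - x)) = ln (1 / norm (y - x))" using d by (simp add: ln_div)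
  also have "\<dots> \<le> 1 / norm (y - x)" using ln_le_minus_one[of "1 / norm (y - x)"] d by simp
  finally show "near_kernel x y \<le> indicator (cball x 1) y / norm (y - x)"
    using d by (auto simp: near_kernel_def indicator_def dist_norm norm_minus_commute)
  show "indicator (cball x 1) y / norm (y - x) \<le> indicator (cball x 1) y / (norm (y - x))\<^sup>2"
  proof (cases "norm (y - x) \<le> 1")
    case True
    then have "(norm (y - x))\<^sup>2 \<le> norm (y - x)" using d by (simp add: power2_eq_square mult_left_le)
    then show ?thesis using d True by (intro divide_left_mono) auto
  qed (simp add: indicator_def dist_norm norm_minus_commute)
qed

text \<open>With m = max(|y - x|, 1), the triangle inequality gives |y| \<le> m (1 + |x|) and m
  \<le> (1 + |y|) |x|. After division by ln |x| the bound becomes a majorant independent of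
  \<open>x\<close>.\<close>

lemma far_kernel_bound:
  assumes x: "norm x \<ge> 2" and y: "y \<noteq> 0"
  shows "\<bar>far_kernel x y\<bar> \<le> 3 * ln (norm x) + 1 + indicator (cball 0 1) y / (norm y)\<^sup>2"
proof -
  let ?n = "norm x" and ?a = "norm y" and ?m = "max (norm (y - x)) 1"
  have a: "?a > 0" and m: "?m \<ge> 1" using y by auto
  have p: "?a * ?n / ?m > 0" using a m x by (intro divide_pos_pos mult_pos_pos) linarith+
  have lx: "ln ?n \<ge> 0" using x by simp
  have "?a \<le> norm (y - x) + ?n" using norm_triangle_ineq[of "y - x" x] by simp
  also have "\<dots> \<le> ?m + ?n * ?m" using m x mult_left_mono[of 1 ?m ?n] by auto
  also have "\<dots> = ?m * (1 + ?n)" by (simp add: algebra_simps)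
  finally have "?a * ?n / ?m \<le> (1 + ?n) * ?n"
    using m x mult_right_mono[of ?a "?m * (1 + ?n)" ?n] by (simp add: pos_divide_le_eq mult_ac)
  also have "\<dots> \<le> ?n ^ 3"
  proof -
    have "1 + ?n \<le> ?n * ?n" using x mult_right_mono[of 2 ?n ?n] by linarith
    then show ?thesis using mult_right_mono[of "1 + ?n" "?n * ?n" ?n] x by (simp add: power3_eq_cube)
  qed
  finally have "far_kernel x y \<le> ln (?n ^ 3)"
    unfolding far_kernel_def using p by (intro ln_mono)
  also have "\<dots> = 3 * ln ?n" using x by (simp add: ln_realpow)
  finally have up: "far_kernel x y \<le> 3 * ln ?n" .
  have "norm (y - x) \<le> ?a + ?n" by (rule norm_triangle_ineq4)
  also have "\<dots> \<le> (1 + ?a) * ?n" using x a mult_left_mono[of 1 ?n ?a] by (simp add: algebra_simps)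
  finally have m2: "?m \<le> (1 + ?a) * ?n"
    using x a mult_mono[of 1 "1 + ?a" 1 ?n] by auto
  have "- far_kernel x y = ln (?m / (?a * ?n))"
  proof -
    have "?m / (?a * ?n) = 1 / (?a * ?n / ?m)" by simp
    moreover have "ln (1 / z) = - ln z" if "z > 0" for z :: real using that by (simp add: ln_div)
    ultimately show ?thesis unfolding far_kernel_def using p by (simp only:)
  qed
  also have "\<dots> \<le> ln (1 + 1 / ?a)"
  proof (rule ln_mono)
    have "?m / (?a * ?n) \<le> (1 + ?a) * ?n / (?a * ?n)" using m2 a x by (intro divide_right_mono) auto
    also have "\<dots> = 1 + 1 / ?a"
    proof -
      have "x \<noteq> 0" using x by auto
      then show ?thesis using a by (simp add: field_simps)
    qed
    finally show "?m / (?a * ?n) \<le> 1 + 1 / ?a" .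
    show "0 < ?m / (?a * ?n)" using a m x by (intro divide_pos_pos mult_pos_pos) linarith+
  qed
  also have "\<dots> \<le> 1 / ?a" using ln_add_one_self_le_self[of "1 / ?a"] a by simp
  also have "\<dots> \<le> 1 + indicator (cball 0 1) y / ?a\<^sup>2"
  proof (cases "?a \<le> 1")
    case True
    then have "?a\<^sup>2 \<le> ?a" using a by (simp add: power2_eq_square mult_left_le)
    then have "1 / ?a \<le> 1 / ?a\<^sup>2" using a by (intro divide_left_mono) auto
    then show ?thesis using True by simp
  qed (use a in \<open>auto simp: field_simps\<close>)
  finally have "- far_kernel x y \<le> 1 + indicator (cball 0 1) y / ?a\<^sup>2" .
  moreover have "0 \<le> indicator (cball 0 1) y / ?a\<^sup>2" by simp
  ultimately show ?thesis using up lx by linarith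
qed

text \<open>For fixed \<open>y\<close> and large |x| the distance |y - x| lies between |x|/2 and 2
  |x|, so the kernel stays bounded while ln |x| diverges.\<close>

lemma far_kernel_limit:
  assumes X: "\<And>n. norm (X n) \<ge> max 2 (real n)" and y: "y \<noteq> 0"
  shows "(\<lambda>n. far_kernel (X n) y / ln (norm (X n))) \<longlonglongrightarrow> 0"
proof (rule Lim_null_comparison)
  have nX: "filterlim (\<lambda>n. norm (X n)) at_top sequentially"
    by (rule filterlim_at_top_mono[OF filterlim_real_sequentially]) (use X in \<open>auto intro: order_trans[OF _ X]\<close>)
  have lX: "filterlim (\<lambda>n. ln (norm (X n))) at_top sequentially"
    by (rule filterlim_compose[OF ln_at_top nX])
  show "(\<lambda>n. (\<bar>ln (norm y)\<bar> + ln 2) / ln (norm (X n))) \<longlonglongrightarrow> 0"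
    by (intro tendsto_divide_0[OF tendsto_const] filterlim_at_top_imp_at_infinity lX)
  have "\<forall>\<^sub>F n in sequentially. norm (X n) \<ge> 2 + 2 * norm y"
    using nX unfolding filterlim_at_top by blast
  then show "\<forall>\<^sub>F n in sequentially. norm (far_kernel (X n) y / ln (norm (X n))) \<le> (\<bar>ln (norm y)\<bar> + ln 2) / ln (norm (X n))"
  proof eventually_elim
    case (elim n)
    let ?x = "X n"
    have x: "norm ?x \<ge> 2" using X[of n] by simp
    have d1: "norm (y - ?x) \<ge> norm ?x / 2"
      using norm_triangle_ineq2[of ?x y] elim by (simp add: norm_minus_commute)
    have d2: "norm (y - ?x) \<le> 2 * norm ?x"
      using norm_triangle_ineq4[of y ?x] elim norm_ge_zero[of y] by linarith
    have m: "max (norm (y - ?x)) 1 = norm (y - ?x)" using d1 x by (simp add: max_def)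
    have p: "norm (y - ?x) > 0" using d1 x by linarith
    have "far_kernel ?x y = ln (norm y) + (ln (norm ?x) - ln (norm (y - ?x)))"
      unfolding far_kernel_def m using y x p by (simp add: ln_div ln_mult)
    moreover have "ln (norm (y - ?x)) \<le> ln (2 * norm ?x)" using d2 p x by (intro ln_mono) auto
    moreover have "ln (norm ?x / 2) \<le> ln (norm (y - ?x))" using d1 p x by (intro ln_mono) auto
    moreover have "ln (2 * norm ?x) = ln 2 + ln (norm ?x)" using x by (intro ln_mult_pos) auto
    moreover have "ln (norm ?x / 2) = ln (norm ?x) - ln 2" using x by (intro ln_divide_pos) auto
    ultimately have "\<bar>far_kernel ?x y\<bar> \<le> \<bar>ln (norm y)\<bar> + ln 2" by linarith
    moreover have "ln (norm ?x) > 0" using x by (intro ln_gt_zero) auto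
    ultimately show ?case by (simp add: divide_right_mono)
  qed
qed

context biharmonic_source
begin

abbreviation far_integral where "far_integral x \<equiv> \<integral>y. far_kernel x y * f y \<partial>lborel"
abbreviation near_integral where "near_integral x \<equiv> \<integral>y. near_kernel x y * f y \<partial>lborel"

lemma integrable_singular:
  "integrable lborel (\<lambda>y. indicator (cball x 1) y / (norm (y - x))\<^sup>2 * \<bar>f y\<bar>)"
proof -
  obtain B where B: "B > 0" "\<And>y. norm (y - x) \<le> 1 \<Longrightarrow> \<bar>f y\<bar> \<le> B"
    using continuous_bounded_on_cball[OF continuous(3), of x 1] by metis
  have m: "(indicator (cball x 1) :: real^4 \<Rightarrow> real) \<in> borel_measurable borel"
    by (auto intro!: borel_measurable_indicator)
  have "integrable lborel (\<lambda>y. (indicator (cball x 1) y * \<bar>f y\<bar>) * (indicator (cball x 1) y / (norm (y - x))\<^sup>2))"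
  proof (rule integrable_bounded_mult[OF integrable_inverse_norm_sq])
    show "AE y in lborel. \<bar>indicator (cball x 1) y * \<bar>f y\<bar>\<bar> \<le> B"
      using B by (intro AE_I2) (auto simp: indicator_def dist_norm norm_minus_commute)
    show "(\<lambda>y. indicator (cball x 1) y * \<bar>f y\<bar>) \<in> borel_measurable lborel" using m by simp
  qed simp
  also have "(\<lambda>y. (indicator (cball x 1) y * \<bar>f y\<bar>) * (indicator (cball x 1) y / (norm (y - x))\<^sup>2)) =
    (\<lambda>y. indicator (cball x 1) y / (norm (y - x))\<^sup>2 * \<bar>f y\<bar>)"
    by (auto simp: fun_eq_iff indicator_def)
  finally show ?thesis .
qed

lemma integrable_near: "integrable lborel (\<lambda>y. near_kernel x y * f y)"
proof (rule Bochner_Integration.integrable_bound[OF integrable_singular[of x]])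
  show "AE y in lborel. norm (near_kernel x y * f y) \<le> norm (indicator (cball x 1) y / (norm (y - x))\<^sup>2 * \<bar>f y\<bar>)"
    using AE_lborel_neq[of x]
  proof eventually_elim
    case (elim y)
    have "near_kernel x y \<le> indicator (cball x 1) y / (norm (y - x))\<^sup>2"
      using near_kernel_le[OF elim] by linarith
    then have "near_kernel x y * \<bar>f y\<bar> \<le> indicator (cball x 1) y / (norm (y - x))\<^sup>2 * \<bar>f y\<bar>"
      by (intro mult_right_mono) auto
    then show ?case using near_kernel_nonneg[of x y] by (simp add: abs_mult)
  qed
qed measurable

lemma integrable_far:
  assumes "norm x \<ge> 2"
  shows "integrable lborel (\<lambda>y. far_kernel x y * f y)"
proof (rule Bochner_Integration.integrable_bound)
  show "integrable lborel (\<lambda>y. (3 * ln (norm x) + 1) * \<bar>f y\<bar> + indicator (cball 0 1) y / (norm (y - 0))\<^sup>2 * \<bar>f y\<bar>)"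
    by (intro Bochner_Integration.integrable_add integrable_mult_right integrable_singular integrable_abs f_integrable)
  show "AE y in lborel. norm (far_kernel x y * f y) \<le>
      norm ((3 * ln (norm x) + 1) * \<bar>f y\<bar> + indicator (cball 0 1) y / (norm (y - 0))\<^sup>2 * \<bar>f y\<bar>)"
    using AE_lborel_neq[of 0]
  proof eventually_elim
    case (elim y)
    have "\<bar>far_kernel x y\<bar> * \<bar>f y\<bar> \<le> (3 * ln (norm x) + 1 + indicator (cball 0 1) y / (norm y)\<^sup>2) * \<bar>f y\<bar>"
      by (intro mult_right_mono far_kernel_bound assms elim) auto
    also have "\<dots> \<le> norm ((3 * ln (norm x) + 1) * \<bar>f y\<bar> + indicator (cball 0 1) y / (norm (y - 0))\<^sup>2 * \<bar>f y\<bar>)"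
      unfolding distrib_right[of _ _ "\<bar>f y\<bar>", symmetric] by simp
    finally show ?case by (simp add: abs_mult)
  qed
qed measurable

lemma potential_far_near:
  assumes x: "norm x \<ge> 2"
  shows "8 * pi\<^sup>2 * v x + (\<integral>y. f y \<partial>lborel) * ln (norm x) = far_integral x + near_integral x"
proof -
  have "8 * pi\<^sup>2 * v x = (\<integral>y. ln (norm y / norm (x - y)) * f y \<partial>lborel)"
    by (simp add: normalized_potential_def)
  then have "8 * pi\<^sup>2 * v x + (\<integral>y. f y \<partial>lborel) * ln (norm x) = (\<integral>y. ln (norm y / norm (x - y)) * f y + f y * ln (norm x) \<partial>lborel)"
    using integrable_kernel[of x] f_integrable by simp
  also have "\<dots> = (\<integral>y. far_kernel x y * f y + near_kernel x y * f y \<partial>lborel)"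
  proof (rule integral_cong_AE)
    show "AE y in lborel. ln (norm y / norm (x - y)) * f y + f y * ln (norm x) = far_kernel x y * f y + near_kernel x y * f y"
      using AE_lborel_neq[of x] AE_lborel_neq[of 0]
    proof eventually_elim
      case (elim y)
      have "x \<noteq> 0" using x by auto
      from far_near_kernel[OF elim(2,1) this]
      have "(ln (norm y / norm (x - y)) + ln (norm x)) * f y = (far_kernel x y + near_kernel x y) * f y" by simp
      then show ?case by (simp add: algebra_simps)
    qed
  qed measurable
  also have "\<dots> = far_integral x + near_integral x"
    by (rule Bochner_Integration.integral_add[OF integrable_far[OF x] integrable_near])
  finally show ?thesis .
qed

lemma far_integral_limit:
  assumes X: "\<And>n. norm (X n) \<ge> max 2 (real n)"
  shows "(\<lambda>n. far_integral (X n) / ln (norm (X n))) \<longlonglongrightarrow> 0"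
proof -
  have x2: "norm (X n) \<ge> 2" for n using X[of n] by simp
  have l: "ln (norm (X n)) \<ge> 1 / 2" for n
  proof -
    have "ln (2::real) \<ge> 1 / 2" using ln_ge_iff[of 2 "1/2"] exp_bound_half[of "1/2::real"] by simp
    also have "ln 2 \<le> ln (norm (X n))" using x2[of n] by (intro ln_mono) auto
    finally show ?thesis .
  qed
  have "(\<lambda>n. \<integral>y. far_kernel (X n) y * f y / ln (norm (X n)) \<partial>lborel) \<longlonglongrightarrow> (\<integral>y. 0 \<partial>(lborel :: (real^4) measure))"
  proof (rule integral_dominated_convergence)
    show "integrable lborel (\<lambda>y. 5 * \<bar>f y\<bar> + 2 * (indicator (cball 0 1) y / (norm (y - 0))\<^sup>2 * \<bar>f y\<bar>))"
      by (intro Bochner_Integration.integrable_add integrable_mult_right integrable_singular integrable_abs f_integrable)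
    show "AE y in lborel. (\<lambda>n. far_kernel (X n) y * f y / ln (norm (X n))) \<longlonglongrightarrow> 0"
      using AE_lborel_neq[of 0]
    proof eventually_elim
      case (elim y)
      show ?case using tendsto_mult_right[OF far_kernel_limit[OF X elim], of "f y"] by simp
    qed
    show "AE y in lborel. norm (far_kernel (X n) y * f y / ln (norm (X n))) \<le>
        5 * \<bar>f y\<bar> + 2 * (indicator (cball 0 1) y / (norm (y - 0))\<^sup>2 * \<bar>f y\<bar>)" for n
      using AE_lborel_neq[of 0]
    proof eventually_elim
      case (elim y)
      let ?L = "ln (norm (X n))" and ?s = "indicator (cball 0 1) y / (norm y)\<^sup>2 :: real"
      have L: "?L \<ge> 1 / 2" by (rule l)
      have s: "?s \<ge> 0" by simp
      have "\<bar>far_kernel (X n) y\<bar> \<le> 3 * ?L + 1 + ?s" by (rule far_kernel_bound[OF x2 elim])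
      also have "\<dots> \<le> (5 + 2 * ?s) * ?L"
        using L mult_left_mono[of "1 / 2" ?L "2 * ?s"] s by (simp add: algebra_simps)
      finally have "\<bar>far_kernel (X n) y\<bar> / ?L \<le> 5 + 2 * ?s" using L by (simp add: pos_divide_le_eq)
      then have "\<bar>far_kernel (X n) y\<bar> / ?L * \<bar>f y\<bar> \<le> (5 + 2 * ?s) * \<bar>f y\<bar>" by (intro mult_right_mono) auto
      then show ?case using L by (simp add: abs_mult distrib_right)
    qed
  qed measurable
  then show ?thesis by simp
qed

lemma local_mass_limit:
  assumes X: "\<And>n. norm (X n) \<ge> max 2 (real n)"
  shows "(\<lambda>n. \<integral>y. indicator (cball (X n) 1) y * \<bar>f y\<bar> \<partial>lborel) \<longlonglongrightarrow> 0"
proof -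
  have m: "(indicator (cball x 1) :: real^4 \<Rightarrow> real) \<in> borel_measurable borel" for x
    by (auto intro!: borel_measurable_indicator)
  have "(\<lambda>n. \<integral>y. indicator (cball (X n) 1) y * \<bar>f y\<bar> \<partial>lborel) \<longlonglongrightarrow> (\<integral>y. 0 \<partial>(lborel :: (real^4) measure))"
  proof (rule integral_dominated_convergence)
    show "integrable lborel (\<lambda>y. \<bar>f y\<bar>)" using f_integrable by (rule integrable_abs)
    show "AE y in lborel. (\<lambda>n. indicator (cball (X n) 1) y * \<bar>f y\<bar>) \<longlonglongrightarrow> 0"
    proof (rule AE_I2)
      fix y :: "real^4"
      obtain N :: nat where N: "real N > norm y + 1" using reals_Archimedean2 by blast
      have "\<forall>\<^sub>F n in sequentially. 0 = indicator (cball (X n) 1) y * \<bar>f y\<bar>"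
      proof (rule eventually_mono[OF eventually_ge_at_top[of N]])
        fix n assume "N \<le> n"
        then have "norm (X n) > norm y + 1" using X[of n] N by (auto intro: less_le_trans)
        then have "y \<notin> cball (X n) 1" using norm_triangle_ineq2[of "X n" y] by (auto simp: dist_norm)
        then show "0 = indicator (cball (X n) 1) y * \<bar>f y\<bar>" by simp
      qed
      then show "(\<lambda>n. indicator (cball (X n) 1) y * \<bar>f y\<bar>) \<longlonglongrightarrow> 0"
        by (rule Lim_transform_eventually[OF tendsto_const])
    qed
    show "AE y in lborel. norm (indicator (cball (X n) 1) y * \<bar>f y\<bar>) \<le> \<bar>f y\<bar>" for n
      by (intro AE_I2) (auto simp: indicator_def)
    show "(\<lambda>y. indicator (cball (X n) 1) y * \<bar>f y\<bar>) \<in> borel_measurable lborel" for n using m by simp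
  qed simp
  then show ?thesis by simp
qed

text \<open>Where the logarithm is at most a multiple of ln |x|, the factor ln |x| meets the mass of
  |f| on a unit ball, which tends to 0. Elsewhere |f| \<le> 1/d and the contribution is at most the
  constant \<open>S\<close>, the same for all centres by translation.\<close>

lemma near_integral_limit:
  assumes X: "\<And>n. norm (X n) \<ge> max 2 (real n)"
    and growth: "\<And>y. norm y \<ge> r \<Longrightarrow> \<bar>f y\<bar> \<le> B * norm y powr m" and m: "m \<ge> 0" and B: "B \<ge> 0"
  shows "(\<lambda>n. near_integral (X n) / ln (norm (X n))) \<longlonglongrightarrow> 0"
proof (rule Lim_null_comparison)
  define S where "S = (\<integral>y. indicator (cball 0 1) y / (norm (y - 0))\<^sup>2 \<partial>(lborel :: (real^4) measure))"
  have S: "(\<integral>y. indicator (cball x 1) y / (norm (y - x))\<^sup>2 \<partial>lborel) = S" for x :: "real^4"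
  proof -
    have "S = (\<integral>y. indicator (cball 0 1) (y + (- x)) / (norm ((y + (- x)) - 0))\<^sup>2 \<partial>lborel)"
      unfolding S_def
      by (rule integral_lborel_translation[symmetric, where g = "\<lambda>y. indicator (cball 0 1) y / (norm (y - 0))\<^sup>2"])
         (use borel_measurable_integrable[OF integrable_inverse_norm_sq[of 1 0]] in simp)
    then show ?thesis by (simp add: indicator_def dist_norm norm_minus_commute)
  qed
  let ?I = "\<lambda>n. \<integral>y. indicator (cball (X n) 1) y * \<bar>f y\<bar> \<partial>lborel"
  have nX: "filterlim (\<lambda>n. norm (X n)) at_top sequentially"
    by (rule filterlim_at_top_mono[OF filterlim_real_sequentially]) (use X in \<open>auto intro: order_trans[OF _ X]\<close>)
  have lX: "filterlim (\<lambda>n. ln (norm (X n))) at_top sequentially"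
    by (rule filterlim_compose[OF ln_at_top nX])
  have "(\<lambda>n. (m + 1) * ?I n + S / ln (norm (X n))) \<longlonglongrightarrow> (m + 1) * 0 + 0"
    by (intro tendsto_intros local_mass_limit X tendsto_divide_0[OF tendsto_const] filterlim_at_top_imp_at_infinity lX)
  then show "(\<lambda>n. (m + 1) * ?I n + S / ln (norm (X n))) \<longlonglongrightarrow> 0" by simp
  \<comment> \<open>The first bound puts the open unit ball about \<open>X n\<close> inside the
    region of the growth estimate; the second absorbs the constant B 2^m into one more power of |x|,
    hence the exponent m + 1.\<close>
  have "\<forall>\<^sub>F n in sequentially. norm (X n) \<ge> max (r + 1) (B * 2 powr m)"
    using nX unfolding filterlim_at_top by blast
  then show "\<forall>\<^sub>F n in sequentially. norm (near_integral (X n) / ln (norm (X n))) \<le> (m + 1) * ?I n + S / ln (norm (X n))"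
  proof eventually_elim
    case (elim n)
    let ?x = "X n" and ?L = "ln (norm (X n))"
    have x: "norm ?x \<ge> 2" using X[of n] by simp
    have L: "?L > 0" using x by (intro ln_gt_zero) auto
    have i1: "integrable lborel (\<lambda>y. indicator (cball ?x 1) y * \<bar>f y\<bar>)"
    proof (rule integrable_bounded_mult[where C = 1])
      show "indicator (cball ?x 1) \<in> borel_measurable lborel" by (auto intro!: borel_measurable_indicator)
    qed (use f_integrable in \<open>auto simp: indicator_def\<close>)
    have i2: "integrable lborel (\<lambda>y. indicator (cball ?x 1) y / (norm (y - ?x))\<^sup>2)"
      by (rule integrable_inverse_norm_sq) simp
    have "\<bar>near_integral ?x\<bar> \<le> (\<integral>y. \<bar>near_kernel ?x y * f y\<bar> \<partial>lborel)" by (rule integral_abs_bound)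
    also have "\<dots> \<le> (\<integral>y. (m + 1) * ?L * (indicator (cball ?x 1) y * \<bar>f y\<bar>) + indicator (cball ?x 1) y / (norm (y - ?x))\<^sup>2 \<partial>lborel)"
    proof (rule integral_mono_AE)
      show "integrable lborel (\<lambda>y. \<bar>near_kernel ?x y * f y\<bar>)" by (rule integrable_abs[OF integrable_near])
      show "integrable lborel (\<lambda>y. (m + 1) * ?L * (indicator (cball ?x 1) y * \<bar>f y\<bar>) + indicator (cball ?x 1) y / (norm (y - ?x))\<^sup>2)"
        by (intro Bochner_Integration.integrable_add integrable_mult_right i1 i2)
      show "AE y in lborel. \<bar>near_kernel ?x y * f y\<bar> \<le> (m + 1) * ?L * (indicator (cball ?x 1) y * \<bar>f y\<bar>) + indicator (cball ?x 1) y / (norm (y - ?x))\<^sup>2"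
        using AE_lborel_neq[of ?x]
      proof eventually_elim
        case (elim y)
        define d where "d = norm (y - ?x)"
        have d: "d > 0" using elim by (simp add: d_def)
        show ?case
        proof (cases "d < 1")
          case False
          then have "near_kernel ?x y = 0" by (simp add: near_kernel_def d_def)
          then show ?thesis using L m by simp
        next
          case True
          then have ind: "indicator (cball ?x 1) y = (1::real)" by (simp add: d_def dist_norm norm_minus_commute)
          have nk: "near_kernel ?x y = - ln d" using True by (simp add: near_kernel_def d_def)
          have nk0: "- ln d \<ge> 0" using near_kernel_nonneg[of ?x y] nk by simp
          \<comment> \<open>Either the logarithm is at most \<open>(m + 1) ln |x|\<close>, or \<open>d\<close> is so small that \<open>|f y| \<le> 1 / d\<close>.\<close>
          show ?thesis
          proof (cases "- ln d \<le> (m + 1) * ?L")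
            case True
            then have "(- ln d) * \<bar>f y\<bar> \<le> (m + 1) * ?L * \<bar>f y\<bar>" by (intro mult_right_mono) auto
            moreover have "0 \<le> 1 / d\<^sup>2" by simp
            moreover have "\<bar>near_kernel ?x y * f y\<bar> = (- ln d) * \<bar>f y\<bar>" using nk0 by (simp add: nk abs_mult)
            ultimately show ?thesis unfolding ind d_def[symmetric] by linarith
          next
            case False
            have y1: "norm y \<ge> norm ?x - 1" using True norm_triangle_ineq2[of ?x y] by (simp add: d_def norm_minus_commute)
            have y2: "norm y \<le> 2 * norm ?x" using True norm_triangle_ineq2[of y ?x] x by (simp add: d_def)
            have "\<bar>f y\<bar> \<le> B * norm y powr m" using y1 \<open>max (r + 1) (B * 2 powr m) \<le> norm ?x\<close> by (intro growth) auto
            also have "\<dots> \<le> B * (2 * norm ?x) powr m" using y2 m B by (intro mult_left_mono powr_mono2) auto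
            also have "\<dots> = (B * 2 powr m) * norm ?x powr m" by (simp add: powr_mult)
            also have "\<dots> \<le> norm ?x * norm ?x powr m"
              using \<open>max (r + 1) (B * 2 powr m) \<le> norm ?x\<close> by (intro mult_right_mono) auto
            also have "\<dots> = norm ?x powr (m + 1)" using x by (simp add: powr_add)
            also have "\<dots> = exp ((m + 1) * ?L)" using x by (auto simp: powr_def)
            also have "\<dots> \<le> exp (- ln d)" using False by simp
            also have "\<dots> = 1 / d" using d by (simp add: exp_minus inverse_eq_divide)
            finally have fd: "\<bar>f y\<bar> \<le> 1 / d" .
            have "- ln d \<le> 1 / d" using near_kernel_le(1)[OF elim] by (simp only: nk ind d_def[symmetric])
            then have "(- ln d) * \<bar>f y\<bar> \<le> 1 / d * (1 / d)" using fd nk0 d by (intro mult_mono) auto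
            moreover have "0 \<le> (m + 1) * ?L * \<bar>f y\<bar>" using L m by simp
            moreover have "\<bar>near_kernel ?x y * f y\<bar> = (- ln d) * \<bar>f y\<bar>" using nk0 by (simp add: nk abs_mult)
            ultimately show ?thesis unfolding ind d_def[symmetric] by (simp add: power2_eq_square)
          qed
        qed
      qed
    qed
    also have "\<dots> = (m + 1) * ?L * ?I n + S"
      using i1 i2 S[of ?x] by simp
    finally have "\<bar>near_integral ?x\<bar> / ?L \<le> ((m + 1) * ?L * ?I n + S) / ?L" using L by (intro divide_right_mono) auto
    also have "\<dots> = (m + 1) * ?I n + S / ?L" using L by (simp add: add_divide_distrib)
    finally show ?case using L by simp
  qed
qed

end

section \<open>Consequences of the sign of the source\<close>

locale conformal_q_curvature = conformal_biharmonic +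
  fixes p :: real
  assumes p_pos: "p > 0" and f_def: "\<And>y. f y = (1 - norm y powr p) * exp (4 * u y)"
begin

lemma f_nonpos: "norm y \<ge> 1 \<Longrightarrow> f y \<le> 0"
  using p_pos by (simp add: f_def ge_one_powr_ge_zero mult_nonpos_nonneg)

lemma near_integral_nonpos:
  assumes "norm x \<ge> 2"
  shows "near_integral x \<le> 0"
proof -
  have "near_kernel x y * f y \<le> 0" for y
  proof (cases "norm (y - x) < 1")
    case True
    then have "norm y \<ge> 1" using assms norm_triangle_ineq2[of x y] by (simp add: norm_minus_commute)
    then show ?thesis using f_nonpos near_kernel_nonneg by (intro mult_nonneg_nonpos) auto
  qed (simp add: near_kernel_def)
  then have "0 \<le> (\<integral>y. - (near_kernel x y * f y) \<partial>lborel)" by (intro integral_nonneg_AE) auto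
  then show ?thesis using integrable_near[of x] by simp
qed

text \<open>The growth of \<open>f\<close> is derived from this bound and so cannot enter here. The
  near integral is dropped because it is nonpositive, and the far integral is o(ln |x|) without any
  growth assumption on \<open>f\<close>.\<close>

lemma potential_upper_bound:
  obtains c r where "c \<ge> 0" "r \<ge> 2" "\<And>x. norm x \<ge> r \<Longrightarrow> v x \<le> c * ln (norm x)"
proof -
  have "((\<lambda>x. far_integral x / ln (norm x)) \<longlongrightarrow> 0) at_infinity"
    by (rule tendsto_0_at_infinity_sequentially[where r = 2]) (rule far_integral_limit)
  then have "\<forall>\<^sub>F x in at_infinity. far_integral x / ln (norm x) < 1" by (rule order_tendstoD) simp
  then obtain b where b: "\<And>x. norm x \<ge> b \<Longrightarrow> far_integral x / ln (norm x) < 1"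
    by (auto simp: eventually_at_infinity)
  define I where "I = \<bar>\<integral>y. f y \<partial>lborel\<bar>"
  define c where "c = (1 + I) / (8 * pi\<^sup>2)"
  have "v x \<le> c * ln (norm x)" if x: "norm x \<ge> max b 2" for x
  proof -
    have L: "ln (norm x) > 0" using x by (intro ln_gt_zero) auto
    have "far_integral x \<le> ln (norm x)" using b[of x] x L by (simp add: pos_divide_less_eq)
    moreover have "near_integral x \<le> 0" using x by (intro near_integral_nonpos) auto
    moreover have "- ((\<integral>y. f y \<partial>lborel) * ln (norm x)) \<le> I * ln (norm x)"
      using L mult_right_mono[of "- (\<integral>y. f y \<partial>lborel)" I "ln (norm x)"] by (simp add: I_def)
    moreover have "8 * pi\<^sup>2 * v x + (\<integral>y. f y \<partial>lborel) * ln (norm x) = far_integral x + near_integral x"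
      using x by (intro potential_far_near) auto
    ultimately have "8 * pi\<^sup>2 * v x \<le> (1 + I) * ln (norm x)" by (simp add: distrib_right)
    then show ?thesis by (simp add: c_def field_simps)
  qed
  then show ?thesis using that[of c "max b 2"] by (simp add: c_def I_def)
qed

lemma f_growth:
  obtains B m r where "B \<ge> 0" "m \<ge> 0" "\<And>y. norm y \<ge> r \<Longrightarrow> \<bar>f y\<bar> \<le> B * norm y powr m"
proof -
  obtain M where M: "\<And>x. u x - v x \<le> M" using poly_bounded_above by blast
  obtain c r where c: "c \<ge> 0" "r \<ge> 2" "\<And>x. norm x \<ge> r \<Longrightarrow> v x \<le> c * ln (norm x)"
    using potential_upper_bound by metis
  have "\<bar>f y\<bar> \<le> exp (4 * M) * norm y powr (p + 4 * c)" if y: "norm y \<ge> r" for y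
  proof -
    have n: "norm y \<ge> 2" using y c by simp
    have "1 \<le> norm y powr p" using n p_pos by (intro ge_one_powr_ge_zero) auto
    then have "\<bar>1 - norm y powr p\<bar> \<le> norm y powr p" by simp
    moreover have "exp (4 * u y) \<le> exp (4 * M + 4 * c * ln (norm y))" using M[of y] c(3)[OF y] by simp
    moreover have "exp (4 * M + 4 * c * ln (norm y)) = exp (4 * M) * norm y powr (4 * c)"
    proof -
      have "norm y powr (4 * c) = exp (4 * c * ln (norm y))" using n unfolding powr_def by (auto split: if_splits)
      then show ?thesis by (simp only: exp_add)
    qed
    ultimately have "\<bar>1 - norm y powr p\<bar> * exp (4 * u y) \<le> norm y powr p * (exp (4 * M) * norm y powr (4 * c))"
      by (intro mult_mono) auto
    then show ?thesis by (simp add: f_def abs_mult powr_add mult_ac)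
  qed
  then show ?thesis using that[of "exp (4 * M)" "p + 4 * c" r] c p_pos by simp
qed

lemma potential_asymptotics:
  "((\<lambda>x. (v x + (\<integral>y. f y \<partial>lborel) / (8 * pi\<^sup>2) * ln (norm x)) / ln (norm x)) \<longlongrightarrow> 0) at_infinity"
proof (rule tendsto_0_at_infinity_sequentially[where r = 2])
  fix X :: "nat \<Rightarrow> real^4" assume X: "\<And>n. norm (X n) \<ge> max 2 (real n)"
  obtain B m r where B: "B \<ge> 0" "m \<ge> 0" "\<And>y. norm y \<ge> r \<Longrightarrow> \<bar>f y\<bar> \<le> B * norm y powr m"
    using f_growth by metis
  have "(\<lambda>n. (far_integral (X n) / ln (norm (X n)) + near_integral (X n) / ln (norm (X n))) / (8 * pi\<^sup>2)) \<longlonglongrightarrow> (0 + 0) / (8 * pi\<^sup>2)"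
    by (intro tendsto_intros far_integral_limit near_integral_limit[OF X B(3,2,1)] X) auto
  moreover have "(far_integral (X n) / ln (norm (X n)) + near_integral (X n) / ln (norm (X n))) / (8 * pi\<^sup>2) =
    (v (X n) + (\<integral>y. f y \<partial>lborel) / (8 * pi\<^sup>2) * ln (norm (X n))) / ln (norm (X n))" for n
  proof -
    have "norm (X n) \<ge> 2" using X[of n] by simp
    from potential_far_near[OF this] show ?thesis
      by (simp add: add_divide_distrib[symmetric]) (simp add: field_simps)
  qed
  ultimately show "(\<lambda>n. (v (X n) + (\<integral>y. f y \<partial>lborel) / (8 * pi\<^sup>2) * ln (norm (X n))) / ln (norm (X n))) \<longlonglongrightarrow> 0"
    by simp
qed

end

text \<open>Beyond radius 2 the weight is at least 2^p - 1 > 0 in modulus, and inside continuity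
  suffices; the radius stays clear of the unit sphere, where the weight vanishes.\<close>

lemma integrable_exp_of_weighted:
  fixes u :: "real^4 \<Rightarrow> real"
  assumes p: "p > 0" and u: "continuous_on UNIV u"
    and int: "integrable lborel (\<lambda>y. (1 - norm y powr p) * exp (4 * u y))"
  shows "integrable lborel (\<lambda>y. exp (4 * u y))"
proof -
  define k where "k = 2 powr p - 1"
  have k: "k > 0" using p by (simp add: k_def)
  have ce: "continuous_on UNIV (\<lambda>y. exp (4 * u y))" using u by (intro continuous_intros)
  have i1: "integrable lborel (\<lambda>y. indicator (cball 0 2) y * exp (4 * u y))"
    using borel_integrable_compact[of "cball 0 2" "\<lambda>y. exp (4 * u y)"] continuous_on_subset[OF ce] by auto
  show ?thesis
  proof (rule Bochner_Integration.integrable_bound)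
    show "integrable lborel (\<lambda>y. indicator (cball 0 2) y * exp (4 * u y) + 1 / k * \<bar>(1 - norm y powr p) * exp (4 * u y)\<bar>)"
      by (intro Bochner_Integration.integrable_add i1 integrable_mult_right integrable_abs int)
    show "(\<lambda>y. exp (4 * u y)) \<in> borel_measurable lborel"
      using ce by (simp add: borel_measurable_continuous_onI)
    show "AE y in lborel. norm (exp (4 * u y)) \<le> norm (indicator (cball 0 2) y * exp (4 * u y) + 1 / k * \<bar>(1 - norm y powr p) * exp (4 * u y)\<bar>)"
    proof (rule AE_I2)
      fix y :: "real^4"
      have "exp (4 * u y) \<le> indicator (cball 0 2) y * exp (4 * u y) + 1 / k * \<bar>(1 - norm y powr p) * exp (4 * u y)\<bar>"
      proof (cases "norm y \<le> 2")
        case False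
        then have "2 powr p \<le> norm y powr p" using p by (intro powr_mono2) auto
        then have "k \<le> \<bar>1 - norm y powr p\<bar>" by (simp add: k_def)
        then have "k * exp (4 * u y) \<le> \<bar>1 - norm y powr p\<bar> * exp (4 * u y)" by (intro mult_right_mono) auto
        then have "exp (4 * u y) \<le> \<bar>1 - norm y powr p\<bar> * exp (4 * u y) / k"
          unfolding pos_le_divide_eq[OF k] by (simp only: mult.commute)
        then show ?thesis using False by (simp add: abs_mult)
      qed (use k in simp)
      then show "norm (exp (4 * u y)) \<le> norm (indicator (cball 0 2) y * exp (4 * u y) + 1 / k * \<bar>(1 - norm y powr p) * exp (4 * u y)\<bar>)"
        by simp
    qed
  qed
qed

theorem theorem1p2:
  fixes u :: "real^4 \<Rightarrow> real" and p :: real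
  assumes "p > 0"
    and "Ck 4 u"
    and "\<forall>x. laplacian (laplacian u) x = (1 - norm x powr p) * exp (4 * u x)"
    and "integrable lborel (\<lambda>y. (1 - norm y powr p) * exp (4 * u y))"
  defines "\<Lambda> \<equiv> (LINT y|lborel. (1 - norm y powr p) * exp (4 * u y))"
    and "v \<equiv> (\<lambda>x. 1 / (8 * pi\<^sup>2) *
            (LINT y|lborel. ln (norm y / norm (x - y)) * ((1 - norm y powr p) * exp (4 * u y))))"
  shows "\<exists>P. poly_deg_le2 P \<and> (\<exists>M. \<forall>x. P x \<le> M) \<and> (\<forall>x. u x = v x + P x) \<and>
           (\<lambda>x. u x - (- \<Lambda> / (8 * pi\<^sup>2) * ln (norm x) + P x)) \<in> o[at_infinity](\<lambda>x. ln (norm x))"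
proof -
  define f where "f = (\<lambda>y :: real^4. (1 - norm y powr p) * exp (4 * u y))"
  \<comment> \<open>This comes first because the continuity of \<open>u\<close> it provides is used
    to show that exp (4 u) is integrable, as the larger locale requires.\<close>
  interpret biharmonic_source u f
    by unfold_locales (use assms in \<open>auto simp: f_def\<close>)
  interpret conformal_q_curvature u f p
    by unfold_locales (use assms continuous(1) in \<open>auto simp: f_def intro!: integrable_exp_of_weighted[of p]\<close>)
  have v: "v x = normalized_potential f x" for x
    by (simp add: v_def normalized_potential_def f_def)
  have L: "\<Lambda> = (\<integral>y. f y \<partial>lborel)" by (simp add: \<Lambda>_def f_def)
  define P where "P x = u x - v x" for x
  have "((\<lambda>x. (u x - (- \<Lambda> / (8 * pi\<^sup>2) * ln (norm x) + P x)) / ln (norm x)) \<longlongrightarrow> 0) at_infinity"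
    using potential_asymptotics by (simp add: P_def v L)
  moreover have "\<forall>\<^sub>F x :: real^4 in at_infinity. ln (norm x) \<noteq> 0"
    unfolding eventually_at_infinity
  proof (intro exI[of _ 2] allI impI)
    fix x :: "real^4" assume "2 \<le> norm x"
    then have "ln (norm x) > 0" by (intro ln_gt_zero) auto
    then show "ln (norm x) \<noteq> 0" by simp
  qed
  ultimately have "(\<lambda>x. u x - (- \<Lambda> / (8 * pi\<^sup>2) * ln (norm x) + P x)) \<in> o[at_infinity](\<lambda>x. ln (norm x))"
    by (rule smalloI_tendsto)
  moreover have "poly_deg_le2 P" "\<exists>M. \<forall>x. P x \<le> M"
    using poly_u_minus_v poly_bounded_above by (simp_all add: P_def[abs_def] v)
  ultimately show ?thesis by (intro exI[of _ P]) (auto simp: P_def)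
qed

end
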